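(* Let $f_1:L_1\to\mathbb S^{2n_1+1}\subset\mathbb C^{n_1+1}$ and $f_2:L_2\to\mathbb S^{2n_2+1}\subset\mathbb C^{n_2+1}$ be two $C$-totally real minimal immersions of manifolds of dimensions $k_1$ and $k_2$ respectively. Suppose that $G_\gamma$ is a spiral minimal product of $f_1$ and $f_2$ (with varying or steady magnitudes), and let $g_\gamma$ be the metric induced by $G_\gamma$. Then $$\Delta_{g_\gamma}G_\gamma=-(k_1+k_2+1)\,G_\gamma .$$
   Context: **Laplacian.** For a Riemannian manifold $(M,g)$, $\Delta_g$ denotes the Laplace-Beltrami operator, given in local coordinates by $\Delta_g f=\frac{1}{\sqrt{g}}\frac{\partial}{\partial x_i}\left(\sqrt{g}\,g^{ij}\frac{\partial f}{\partial x_j}\right)$ with $g=\det(g_{ij})$ and $(g^{ij})=(g_{ij})^{-1}$. It acts componentwise on vector-valued maps. All spheres $\mathbb S^N$ are unit spheres. **$C$-totally real.** An immersion $f:L\to\mathbb S^{2n+1}\subset\mathbb C^{n+1}$ is $C$-totally real if for every $x\in L$ the vector $J f(x)$ is orthogonal (for the real Euclidean inner product) to $df(T_xL)$, where $J$ is the standard complex structure (multiplication by $i$) of $\mathbb C^{n+1}$. Write $g_1,g_2$ for the metrics on $L_1,L_2$ induced by $f_1,f_2$. **The map $G_\gamma$.** Let $\gamma=(\gamma_1,\gamma_2):I\to\mathbb S^3\subset\mathbb C\oplus\mathbb C$ be an immersed curve defined on an open interval $I\subset\mathbb R$ ($I=\mathbb R$ for the globally defined solution curves below), written as $$\gamma_1=a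 e^{i s_1},\qquad \gamma_2=b e^{i s_2},\qquad a=\cos s,\quad b=\sin s,$$ where $s\in(0,\frac{\pi}{2})$ and $s_1,s_2$ are real functions along the curve. Define $$G_\gamma: I\times L_1\times L_2\to\mathbb S^{2n_1+2n_2+3}\subset\mathbb C^{n_1+1}\oplus\mathbb C^{n_2+1},\qquad G_\gamma(t,x,y)=\big(\gamma_1(t)f_1(x),\,\gamma_2(t)f_2(y)\big).$$ With $t_{arc}$ an arc-length parameter of $\gamma$, the metric induced by $G_\gamma$ is $g_\gamma=dt_{arc}^2\oplus a^2(t_{arc})\,g_1\oplus b^2(t_{arc})\,g_2$. **Spiral minimal products.** $G_\gamma$ is called a spiral minimal product of $f_1$ and $f_2$ if $\gamma$ is a solution curve of one of the following two types. For constants $C_1\in\mathbb R$ and $C_2>0$ put $$P(s)=C_2(\cos s)^{2k_1+2}(\sin s)^{2k_2+2}-1-(C_1^2-1)\cos^2 s,\qquad s\in\left(0,\tfrac{\pi}{2}\right).$$ (1) *Varying magnitudes.* Assume $C_1,C_2$ are such that $J=\{s\in(0,\frac{\pi}{2}): P(s)>0\}$ is nonempty (it is then an open interval). A local solution curve is one parametrized by $s$ in (a subinterval of) $J$ and satisfying, for one choice of sign, $$\frac{ds_1}{ds}=\pm\frac{\tan s}{\sqrt{P(s)}},\qquad \frac{ds_2}{ds}=\pm\frac{C_1\cot s}{\sqrt{P(s)}}$$ (the same sign in both equations; the initial values of $s_1,s_2$ are arbitrary). A solution curve is either a local solution curve or a curve obtained by assembling, for fixed $C_1,C_2$, pieces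 with sign $+$ and pieces with sign $-$ alternately, in a $C^1$ manner, at points where $s$ reaches an endpoint of $J$. Such an assembled curve is real-analytic (when parametrized by arc length). (2) *Steady magnitudes.* Here $C_2$ equals the minimum over $s\in(0,\frac{\pi}{2})$ of $\dfrac{1+(C_1^2-1)\cos^2 s}{(\cos s)^{2k_1+2}(\sin s)^{2k_2+2}}$, the function $s$ is a constant $s_{C_1}$ at which this minimum is attained (so $a=\cos s_{C_1}$ and $b=\sin s_{C_1}$ are nonzero constants), and with respect to an arc-length parameter (up to reversal of orientation) $$\frac{ds_1}{dt_{arc}}=\frac{1}{\sqrt{C_2}\,a^{k_1+2}b^{k_2}},\qquad \frac{ds_2}{dt_{arc}}=\frac{C_1}{\sqrt{C_2}\,a^{k_1}b^{k_2+2}}.$$ *)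

theory Defs
  imports "HOL-Analysis.Analysis" "Jordan_Normal_Form.Determinant"
begin

section \<open>Calculus on open subsets of \<open>\<real>\<^sup>k\<close>\<close>

text \<open>
  Dimensions of manifolds are natural numbers, so that \<open>k = 0\<close> is allowed and the dimension
  \<open>k\<^sub>1 + k\<^sub>2 + 1\<close> can be formed.  A point of \<open>\<real>\<^sup>k\<close> is a function \<open>u :: nat \<Rightarrow> real\<close> with
  \<open>u i = 0\<close> for \<open>i \<ge> k\<close>, i.e. an element of \<open>topspace (Euclidean_space k)\<close>; coordinates are
  numbered from 0.
\<close>

definition pd :: "nat \<Rightarrow> ((nat \<Rightarrow> real) \<Rightarrow> 'v::real_normed_vector) \<Rightarrow> (nat \<Rightarrow> real) \<Rightarrow> 'v" where
  "pd i F u = vector_derivative (\<lambda>t. F (u(i := t))) (at (u i))"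

fun Cm_on :: "nat \<Rightarrow> nat \<Rightarrow> (nat \<Rightarrow> real) set \<Rightarrow> ((nat \<Rightarrow> real) \<Rightarrow> 'v::real_normed_vector) \<Rightarrow> bool" where
  "Cm_on 0 k U F \<longleftrightarrow> continuous_map (subtopology (Euclidean_space k) U) euclidean F"
| "Cm_on (Suc m) k U F \<longleftrightarrow>
     continuous_map (subtopology (Euclidean_space k) U) euclidean F \<and>
     (\<forall>i<k. (\<forall>u\<in>U. (\<lambda>t. F (u(i := t))) differentiable (at (u i))) \<and> Cm_on m k U (pd i F))"

definition smooth_on :: "nat \<Rightarrow> (nat \<Rightarrow> real) set \<Rightarrow> ((nat \<Rightarrow> real) \<Rightarrow> 'v::real_normed_vector) \<Rightarrow> bool" where
  "smooth_on k U F \<longleftrightarrow> (\<forall>m. Cm_on m k U F)"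


section \<open>Smooth manifolds\<close>

type_synonym 'a chart = "'a set \<times> ('a \<Rightarrow> nat \<Rightarrow> real)"

definition smooth_manifold :: "nat \<Rightarrow> 'a topology \<Rightarrow> 'a chart set \<Rightarrow> bool" where
  "smooth_manifold k X A \<longleftrightarrow>
     Hausdorff_space X \<and> second_countable X \<and>
     (\<Union>c\<in>A. fst c) = topspace X \<and>
     (\<forall>(U, \<phi>)\<in>A. openin X U \<and> openin (Euclidean_space k) (\<phi> ` U) \<and>
        homeomorphic_map (subtopology X U) (subtopology (Euclidean_space k) (\<phi> ` U)) \<phi>) \<and>
     (\<forall>(U, \<phi>)\<in>A. \<forall>(V, \<psi>)\<in>A. \<forall>j<k.
        smooth_on k (\<phi> ` (U \<inter> V)) (\<lambda>u. \<psi> (inv_into U \<phi> u) j))"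

definition in_chart :: "'a chart \<Rightarrow> ('a \<Rightarrow> 'v) \<Rightarrow> (nat \<Rightarrow> real) \<Rightarrow> 'v" where
  "in_chart c F = F \<circ> inv_into (fst c) (snd c)"

definition interval_atlas :: "real set \<Rightarrow> real chart set" where
  "interval_atlas I = {(I, \<lambda>t i. if i = 0 then t else 0)}"

text \<open>The product of a \<open>k\<close>-dimensional manifold with another one: the coordinates of the
  second factor are shifted by \<open>k\<close>.\<close>

definition prod_atlas :: "nat \<Rightarrow> 'a chart set \<Rightarrow> 'b chart set \<Rightarrow> ('a \<times> 'b) chart set" where
  "prod_atlas k A B =
     {(U \<times> V, \<lambda>(x, y) i. if i < k then \<phi> x i else \<psi> y (i - k)) | U \<phi> V \<psi>. (U, \<phi>) \<in> A \<and> (V, \<psi>) \<in> B}"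


section \<open>Riemannian metrics and the Laplace--Beltrami operator\<close>

text \<open>A metric is given by its coordinate matrices \<open>(g\<^sub>i\<^sub>j)\<close>: \<open>g c u\<close> is the matrix in the
  chart \<open>c\<close> at the point with coordinates \<open>u\<close>.\<close>

type_synonym 'a metric = "'a chart \<Rightarrow> (nat \<Rightarrow> real) \<Rightarrow> real mat"

definition inverse_mat :: "real mat \<Rightarrow> real mat" where
  "inverse_mat M = (THE B. B \<in> carrier_mat (dim_row M) (dim_row M) \<and> inverts_mat M B \<and> inverts_mat B M)"

definition laplace_beltrami ::
    "nat \<Rightarrow> 'a metric \<Rightarrow> 'a chart \<Rightarrow> ('a \<Rightarrow> 'v::real_normed_vector) \<Rightarrow> 'a \<Rightarrow> 'v" where
  "laplace_beltrami k g c f p =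
     (let F = in_chart c f; r = (\<lambda>u. sqrt (Determinant.det (g c u)))
      in (1 / r (snd c p)) *\<^sub>R
         (\<Sum>i<k. pd i (\<lambda>u. \<Sum>j<k. (r u * inverse_mat (g c u) $$ (i, j)) *\<^sub>R pd j F u) (snd c p)))"

definition induced_metric :: "nat \<Rightarrow> ('a \<Rightarrow> 'v::real_inner) \<Rightarrow> 'a metric" where
  "induced_metric k f c u = mat k k (\<lambda>(i, j). inner (pd i (in_chart c f) u) (pd j (in_chart c f) u))"


section \<open>Immersions into unit spheres\<close>

text \<open>The differential of \<open>f\<close> at \<open>p\<close>, where a tangent vector is given by its components \<open>w\<close>
  with respect to the coordinate frame of the chart \<open>c\<close>.\<close>

definition differential :: "nat \<Rightarrow> 'a chart \<Rightarrow> ('a \<Rightarrow> 'v::real_normed_vector) \<Rightarrow> 'a \<Rightarrow> (nat \<Rightarrow> real) \<Rightarrow> 'v" where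
  "differential k c f p w = (\<Sum>i<k. w i *\<^sub>R pd i (in_chart c f) (snd c p))"

definition tangent_image :: "nat \<Rightarrow> 'a chart \<Rightarrow> ('a \<Rightarrow> 'v::real_normed_vector) \<Rightarrow> 'a \<Rightarrow> 'v set" where
  "tangent_image k c f p = differential k c f p ` topspace (Euclidean_space k)"

definition immersion :: "nat \<Rightarrow> 'a chart set \<Rightarrow> ('a \<Rightarrow> 'v::real_normed_vector) \<Rightarrow> bool" where
  "immersion k A f \<longleftrightarrow>
     (\<forall>c\<in>A. smooth_on k (snd c ` fst c) (in_chart c f) \<and>
        (\<forall>p\<in>fst c. inj_on (differential k c f p) (topspace (Euclidean_space k))))"

definition sphere_immersion :: "nat \<Rightarrow> 'a topology \<Rightarrow> 'a chart set \<Rightarrow> ('a \<Rightarrow> 'v::real_normed_vector) \<Rightarrow> bool" where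
  "sphere_immersion k X A f \<longleftrightarrow> f ` topspace X \<subseteq> sphere 0 1 \<and> immersion k A f"

text \<open>Vectors in \<open>\<complex>\<^sup>N\<close> have type \<open>complex ^ 'm\<close>; the library's \<open>inner\<close> on this type is the real
  Euclidean inner product.\<close>

definition C_totally_real :: "nat \<Rightarrow> 'a chart set \<Rightarrow> ('a \<Rightarrow> complex ^ 'm) \<Rightarrow> bool" where
  "C_totally_real k A f \<longleftrightarrow>
     (\<forall>c\<in>A. \<forall>p\<in>fst c. \<forall>v\<in>tangent_image k c f p. inner (\<i> *s f p) v = 0)"

definition orthogonal_projection :: "'v::real_inner set \<Rightarrow> 'v \<Rightarrow> 'v" where
  "orthogonal_projection S v = (THE w. w \<in> S \<and> (\<forall>z\<in>S. inner (v - w) z = 0))"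

text \<open>The normal space at \<open>p\<close> of an immersion into the unit sphere: the vectors tangent to the
  sphere at \<open>f p\<close> and orthogonal to the image of the differential.\<close>

definition normal_space :: "nat \<Rightarrow> 'a chart \<Rightarrow> ('a \<Rightarrow> 'v::real_inner) \<Rightarrow> 'a \<Rightarrow> 'v set" where
  "normal_space k c f p = {v. inner v (f p) = 0 \<and> (\<forall>w\<in>tangent_image k c f p. inner v w = 0)}"

text \<open>The Levi-Civita connection of the sphere is the tangential part of the flat connection of
  the ambient space, hence the normal part of \<open>\<nabla>\<^bsub>\<partial>\<^sub>i\<^esub> \<partial>\<^sub>j\<close> is that of the second partial derivative.\<close>

definition second_fundamental_form ::
    "nat \<Rightarrow> 'a chart \<Rightarrow> ('a \<Rightarrow> 'v::real_inner) \<Rightarrow> 'a \<Rightarrow> nat \<Rightarrow> nat \<Rightarrow> 'v" where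
  "second_fundamental_form k c f p i j =
     orthogonal_projection (normal_space k c f p) (pd i (pd j (in_chart c f)) (snd c p))"

definition mean_curvature :: "nat \<Rightarrow> 'a chart \<Rightarrow> ('a \<Rightarrow> 'v::real_inner) \<Rightarrow> 'a \<Rightarrow> 'v" where
  "mean_curvature k c f p =
     (\<Sum>i<k. \<Sum>j<k. inverse_mat (induced_metric k f c (snd c p)) $$ (i, j) *\<^sub>R
        second_fundamental_form k c f p i j)"

definition minimal_in_sphere :: "nat \<Rightarrow> 'a chart set \<Rightarrow> ('a \<Rightarrow> 'v::real_inner) \<Rightarrow> bool" where
  "minimal_in_sphere k A f \<longleftrightarrow> (\<forall>c\<in>A. \<forall>p\<in>fst c. mean_curvature k c f p = 0)"


section \<open>Solution curves and spiral products\<close>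

definition S3_curve :: "(real \<Rightarrow> real) \<Rightarrow> (real \<Rightarrow> real) \<Rightarrow> (real \<Rightarrow> real) \<Rightarrow> real \<Rightarrow> complex \<times> complex" where
  "S3_curve s s1 s2 t =
     (complex_of_real (cos (s t)) * exp (\<i> * complex_of_real (s1 t)),
      complex_of_real (sin (s t)) * exp (\<i> * complex_of_real (s2 t)))"

definition P_fun :: "nat \<Rightarrow> nat \<Rightarrow> real \<Rightarrow> real \<Rightarrow> real \<Rightarrow> real" where
  "P_fun k1 k2 C1 C2 s = C2 * cos s ^ (2 * k1 + 2) * sin s ^ (2 * k2 + 2) - 1 - (C1\<^sup>2 - 1) * (cos s)\<^sup>2"

definition J_set :: "nat \<Rightarrow> nat \<Rightarrow> real \<Rightarrow> real \<Rightarrow> real set" where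
  "J_set k1 k2 C1 C2 = {s \<in> {0<..<pi/2}. P_fun k1 k2 C1 C2 s > 0}"

definition arc_length_param :: "real set \<Rightarrow> (real \<Rightarrow> complex \<times> complex) \<Rightarrow> bool" where
  "arc_length_param I \<gamma> \<longleftrightarrow>
     (\<forall>t\<in>I. \<gamma> differentiable (at t) \<and> norm (vector_derivative \<gamma> (at t)) = 1)"

definition local_solution ::
    "nat \<Rightarrow> nat \<Rightarrow> real \<Rightarrow> real \<Rightarrow> real set \<Rightarrow> (real \<Rightarrow> real) \<Rightarrow> (real \<Rightarrow> real) \<Rightarrow> (real \<Rightarrow> real) \<Rightarrow> bool" where
  "local_solution k1 k2 C1 C2 I s s1 s2 \<longleftrightarrow>
     I \<subseteq> J_set k1 k2 C1 C2 \<and> (\<forall>t\<in>I. s t = t) \<and>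
     (\<exists>\<epsilon>\<in>{1, -1}. \<forall>t\<in>I.
        (s1 has_real_derivative \<epsilon> * (tan t / sqrt (P_fun k1 k2 C1 C2 t))) (at t) \<and>
        (s2 has_real_derivative \<epsilon> * (C1 * cot t / sqrt (P_fun k1 k2 C1 C2 t))) (at t))"

text \<open>
  Curves assembled from pieces, parametrized by arc length.  \<open>T\<close> is the set of junction times,
  which do not accumulate in \<open>I\<close>, and \<open>\<epsilon> t\<close> is the sign of the piece containing \<open>t\<close>: it is
  constant between junctions and changes at every junction.  Away from \<open>T\<close> we have
  \<open>s' \<noteq> 0\<close>, so \<open>s\<close> is a parameter of the piece, and the equations for \<open>ds\<^sub>1/ds\<close> and \<open>ds\<^sub>2/ds\<close>
  are multiplied by \<open>s'\<close>.
\<close>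

definition assembled_solution ::
    "nat \<Rightarrow> nat \<Rightarrow> real \<Rightarrow> real \<Rightarrow> real set \<Rightarrow> (real \<Rightarrow> real) \<Rightarrow> (real \<Rightarrow> real) \<Rightarrow> (real \<Rightarrow> real) \<Rightarrow> bool" where
  "assembled_solution k1 k2 C1 C2 I s s1 s2 \<longleftrightarrow>
     s C1_differentiable_on I \<and> s1 C1_differentiable_on I \<and> s2 C1_differentiable_on I \<and>
     arc_length_param I (S3_curve s s1 s2) \<and>
     (\<exists>T \<epsilon>. T \<subseteq> I \<and>
        (\<forall>t\<in>I. \<forall>\<^sub>F t' in at t. t' \<notin> T) \<and>
        (\<forall>t\<in>I - T. \<epsilon> t \<in> {1, -1} \<and> (\<forall>\<^sub>F t' in at t. \<epsilon> t' = \<epsilon> t)) \<and>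
        (\<forall>t\<in>T. \<exists>e. (\<forall>\<^sub>F t' in at_left t. \<epsilon> t' = e) \<and> (\<forall>\<^sub>F t' in at_right t. \<epsilon> t' = - e)) \<and>
        (\<forall>t\<in>T. s t \<in> {0<..<pi/2} \<and> s t \<in> frontier (J_set k1 k2 C1 C2)) \<and>
        (\<forall>t\<in>I - T. s t \<in> J_set k1 k2 C1 C2 \<and>
           (\<exists>s'. s' \<noteq> 0 \<and> (s has_real_derivative s') (at t) \<and>
              (s1 has_real_derivative \<epsilon> t * (tan (s t) / sqrt (P_fun k1 k2 C1 C2 (s t))) * s') (at t) \<and>
              (s2 has_real_derivative \<epsilon> t * (C1 * cot (s t) / sqrt (P_fun k1 k2 C1 C2 (s t))) * s') (at t))))"

definition steady_solution ::
    "nat \<Rightarrow> nat \<Rightarrow> real \<Rightarrow> real \<Rightarrow> real set \<Rightarrow> (real \<Rightarrow> real) \<Rightarrow> (real \<Rightarrow> real) \<Rightarrow> (real \<Rightarrow> real) \<Rightarrow> bool" where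
  "steady_solution k1 k2 C1 C2 I s s1 s2 \<longleftrightarrow>
     (\<exists>s0. let Q = (\<lambda>s. (1 + (C1\<^sup>2 - 1) * (cos s)\<^sup>2) / (cos s ^ (2 * k1 + 2) * sin s ^ (2 * k2 + 2)));
              a = cos s0; b = sin s0
          in is_arg_min Q (\<lambda>s. s \<in> {0<..<pi/2}) s0 \<and> C2 = Q s0 \<and> (\<forall>t\<in>I. s t = s0) \<and>
             arc_length_param I (S3_curve s s1 s2) \<and>
             (\<exists>\<sigma>\<in>{1, -1}. \<forall>t\<in>I.
                (s1 has_real_derivative \<sigma> * (1 / (sqrt C2 * a ^ (k1 + 2) * b ^ k2))) (at t) \<and>
                (s2 has_real_derivative \<sigma> * (C1 / (sqrt C2 * a ^ k1 * b ^ (k2 + 2)))) (at t)))"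

definition open_interval :: "real set \<Rightarrow> bool" where
  "open_interval I \<longleftrightarrow> I \<noteq> {} \<and> open I \<and> is_interval I"

text \<open>The curves above come with a preferred parameter (\<open>s\<close> or arc length); as immersed
  curves they may be given with any other smooth regular parameter.\<close>

definition smooth_reparametrization :: "real set \<Rightarrow> real set \<Rightarrow> (real \<Rightarrow> real) \<Rightarrow> bool" where
  "smooth_reparametrization I K \<tau> \<longleftrightarrow>
     \<tau> ` I = K \<and> (\<forall>m. \<forall>t\<in>I. (deriv ^^ m) \<tau> differentiable (at t)) \<and> (\<forall>t\<in>I. deriv \<tau> t \<noteq> 0)"

definition solution_curve :: "nat \<Rightarrow> nat \<Rightarrow> real set \<Rightarrow> (real \<Rightarrow> complex \<times> complex) \<Rightarrow> bool" where
  "solution_curve k1 k2 I \<gamma> \<longleftrightarrow> open_interval I \<and>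
     (\<exists>K \<tau> C1 C2 s s1 s2.
        open_interval K \<and> smooth_reparametrization I K \<tau> \<and> C2 > 0 \<and>
        (\<forall>t\<in>I. \<gamma> t = S3_curve s s1 s2 (\<tau> t)) \<and>
        (local_solution k1 k2 C1 C2 K s s1 s2 \<or>
         assembled_solution k1 k2 C1 C2 K s s1 s2 \<or>
         steady_solution k1 k2 C1 C2 K s s1 s2))"

definition G_map ::
    "(real \<Rightarrow> complex \<times> complex) \<Rightarrow> ('a \<Rightarrow> complex ^ 'm1) \<Rightarrow> ('b \<Rightarrow> complex ^ 'm2) \<Rightarrow>
     real \<times> 'a \<times> 'b \<Rightarrow> (complex ^ 'm1) \<times> (complex ^ 'm2)" where
  "G_map \<gamma> f1 f2 = (\<lambda>(t, x, y). (fst (\<gamma> t) *s f1 x, snd (\<gamma> t) *s f2 y))"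

end

(*
  In a product chart the metric of the spiral product is block diagonal, because the C-totally real
  condition kills the mixed terms, so its Laplacian splits into three parts.  By Takahashi's theorem
  (the tangential part of Laplacian f vanishes, the part along f is -k f, and the remaining normal
  part is the mean curvature) the two factors contribute -k1/a^2 and -k2/b^2.  What is left is the
  equation a^-k1 b^-k2 D (a^k1 b^k2 D gamma_i) = (k_i / |gamma_i|^2 - (k1 + k2 + 1)) gamma_i for
  the profile curve, with D the derivative by arc length.  It holds because a^(k1+2) b^k2 D s1 and
  a^k1 b^(k2+2) D s2 are constant and (D s)^2 is a function R(s) with D (D s) = R'(s)/2; for
  assembled and steady curves the last equation has to be checked separately where D s = 0.
*)
theory Submission
  imports Defs
begin

section \<open>Matrices depending on a parameter\<close>

text \<open>Everything is computed in divergence form: the Laplacian is the divergence of the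
  vectors \<open>flux\<close> divided by the volume density, so no Christoffel symbols appear and
  the curve parameter and the two factors can be treated separately. The obstacle is regularity
  along the curve: assembled solutions are only given as C^1. The interface
  \<open>minimal_profile\<close> is therefore phrased with the speed \<open>w\<close>, the unit
  tangent \<open>(E1, E2)\<close> and the derivative of the tangent weighted by a^k1 b^k2. The flux
  in the curve direction is a multiple of exactly this weighted tangent, because the powers of
  \<open>w\<close> cancel in it; hence \<open>w\<close> is never differentiated. The constants of
  the overview are the angular momenta of the two rotations, with values \<open>c\<close> and
  \<open>C1 * c\<close>, where c^2 = 1 / C2. Substituting them into the unit speed condition gives
  (ds/dt)^2 = R(s), and \<open>P_fun\<close> is R times a positive factor, so J is where R > 0. In
  the steady case R = 1 - Q / C2: a minimum of Q with value C2 is a maximum of R with value 0, so R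
  and R' both vanish there.\<close>

lemma inverse_mat_eqI:
  assumes "M \<in> carrier_mat n n" "B \<in> carrier_mat n n" "M * B = 1\<^sub>m n" "B * M = 1\<^sub>m n"
  shows "inverse_mat M = B"
  unfolding inverse_mat_def
proof (rule the_equality)
  show "B \<in> carrier_mat (dim_row M) (dim_row M) \<and> inverts_mat M B \<and> inverts_mat B M"
    using assms by (auto simp: inverts_mat_def)
next
  fix B' assume "B' \<in> carrier_mat (dim_row M) (dim_row M) \<and> inverts_mat M B' \<and> inverts_mat B' M"
  then have B': "B' \<in> carrier_mat n n" "M * B' = 1\<^sub>m n"
    using assms by (auto simp: inverts_mat_def)
  have "B' = (B * M) * B'" using B' assms by simp
  also have "\<dots> = B * (M * B')" by (rule assoc_mult_mat) (use B' assms in auto)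
  also have "\<dots> = B" using B' assms by simp
  finally show "B' = B" .
qed

text \<open>Cramer's rule replaces the definite description \<open>inverse_mat\<close> by an
  explicit formula, from which differentiability of the entries can be read off.\<close>

lemma inverse_mat_adj:
  assumes M: "M \<in> carrier_mat n n" and d: "Determinant.det M \<noteq> 0"
  shows "inverse_mat M = (1 / Determinant.det M) \<cdot>\<^sub>m adj_mat M"
proof (rule inverse_mat_eqI[OF M])
  note adj = adj_mat[OF M]
  show "(1 / Determinant.det M) \<cdot>\<^sub>m adj_mat M \<in> carrier_mat n n"
    using adj by simp
  show "M * ((1 / Determinant.det M) \<cdot>\<^sub>m adj_mat M) = 1\<^sub>m n"
    unfolding mult_smult_distrib[OF M adj(1)] adj(2) using d by (intro eq_matI) auto
  show "(1 / Determinant.det M) \<cdot>\<^sub>m adj_mat M * M = 1\<^sub>m n"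
    unfolding mult_smult_assoc_mat[OF adj(1) M] adj(3) using d by (intro eq_matI) auto
qed

lemma inverse_mat_index:
  assumes "M \<in> carrier_mat n n" "Determinant.det M \<noteq> 0" "i < n" "j < n"
  shows "inverse_mat M $$ (i, j) = cofactor M j i / Determinant.det M"
  using assms by (simp add: inverse_mat_adj adj_mat_def)

lemma inverse_mat_carrier:
  assumes "M \<in> carrier_mat n n" "Determinant.det M \<noteq> 0"
  shows "inverse_mat M \<in> carrier_mat n n"
  using assms adj_mat(1)[OF assms(1)] by (simp add: inverse_mat_adj)

lemma inverse_mat_right:
  assumes "M \<in> carrier_mat n n" "Determinant.det M \<noteq> 0"
  shows "M * inverse_mat M = 1\<^sub>m n"
  unfolding inverse_mat_adj[OF assms] mult_smult_distrib[OF assms(1) adj_mat(1)[OF assms(1)]]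
    adj_mat(2)[OF assms(1)] using assms by (intro eq_matI) auto

lemma inverse_mat_left:
  assumes "M \<in> carrier_mat n n" "Determinant.det M \<noteq> 0"
  shows "inverse_mat M * M = 1\<^sub>m n"
  unfolding inverse_mat_adj[OF assms] mult_smult_assoc_mat[OF adj_mat(1)[OF assms(1)] assms(1)]
    adj_mat(3)[OF assms(1)] using assms by (intro eq_matI) auto

lemma sum_inverse_mat_left:
  assumes "M \<in> carrier_mat n n" "Determinant.det M \<noteq> 0" "i < n" "j < n"
  shows "(\<Sum>l<n. inverse_mat M $$ (i, l) * M $$ (l, j)) = (if i = j then 1 else 0)"
proof -
  have "(inverse_mat M * M) $$ (i, j) = (\<Sum>l<n. inverse_mat M $$ (i, l) * M $$ (l, j))"
    using assms inverse_mat_carrier[OF assms(1,2)]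
    by (auto simp: scalar_prod_def atLeast0LessThan intro!: sum.cong)
  then show ?thesis
    using inverse_mat_left[OF assms(1,2)] assms by simp
qed

section \<open>Block diagonal, scaled and symmetric matrices\<close>

lemma det_four_block_diag:
  fixes A D :: "real mat"
  assumes "A \<in> carrier_mat n n" "D \<in> carrier_mat m m"
  shows "Determinant.det (four_block_mat A (0\<^sub>m n m) (0\<^sub>m m n) D) = Determinant.det A * Determinant.det D"
  by (rule det_four_block_mat_upper_right_zero[OF assms(1) refl _ assms(2)]) simp

lemma inverse_mat_four_block_diag:
  assumes A: "A \<in> carrier_mat n n" "Determinant.det A \<noteq> 0" and D: "D \<in> carrier_mat m m" "Determinant.det D \<noteq> 0"
  shows "inverse_mat (four_block_mat A (0\<^sub>m n m) (0\<^sub>m m n) D) =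
     four_block_mat (inverse_mat A) (0\<^sub>m n m) (0\<^sub>m m n) (inverse_mat D)"
proof (rule inverse_mat_eqI[where n = "n + m"])
  note iA = inverse_mat_carrier[OF A] and iD = inverse_mat_carrier[OF D]
  show "four_block_mat A (0\<^sub>m n m) (0\<^sub>m m n) D \<in> carrier_mat (n + m) (n + m)"
    "four_block_mat (inverse_mat A) (0\<^sub>m n m) (0\<^sub>m m n) (inverse_mat D) \<in> carrier_mat (n + m) (n + m)"
    using A D iA iD by auto
  show "four_block_mat A (0\<^sub>m n m) (0\<^sub>m m n) D * four_block_mat (inverse_mat A) (0\<^sub>m n m) (0\<^sub>m m n) (inverse_mat D) = 1\<^sub>m (n + m)"
    by (subst mult_four_block_mat[OF A(1) zero_carrier_mat zero_carrier_mat D(1) iA zero_carrier_mat zero_carrier_mat iD])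
       (use A D iA iD in \<open>simp add: inverse_mat_right[OF A] inverse_mat_right[OF D]\<close>)
  show "four_block_mat (inverse_mat A) (0\<^sub>m n m) (0\<^sub>m m n) (inverse_mat D) * four_block_mat A (0\<^sub>m n m) (0\<^sub>m m n) D = 1\<^sub>m (n + m)"
    by (subst mult_four_block_mat[OF iA zero_carrier_mat zero_carrier_mat iD A(1) zero_carrier_mat zero_carrier_mat D(1)])
       (use A D iA iD in \<open>simp add: inverse_mat_left[OF A] inverse_mat_left[OF D]\<close>)
qed

lemma inverse_mat_smult:
  assumes A: "A \<in> carrier_mat n n" "Determinant.det A \<noteq> 0" and c: "c \<noteq> 0"
  shows "inverse_mat (c \<cdot>\<^sub>m A) = (1 / c) \<cdot>\<^sub>m inverse_mat A"
proof (rule inverse_mat_eqI[where n = n])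
  note iA = inverse_mat_carrier[OF A]
  show "c \<cdot>\<^sub>m A \<in> carrier_mat n n" "(1 / c) \<cdot>\<^sub>m inverse_mat A \<in> carrier_mat n n" using A iA by auto
  show "c \<cdot>\<^sub>m A * ((1 / c) \<cdot>\<^sub>m inverse_mat A) = 1\<^sub>m n"
    using mult_smult_distrib[of "c \<cdot>\<^sub>m A" n n "inverse_mat A" n "1 / c"]
      mult_smult_assoc_mat[OF A(1) iA, of c] inverse_mat_right[OF A] A iA c
    by (intro eq_matI) auto
  show "(1 / c) \<cdot>\<^sub>m inverse_mat A * (c \<cdot>\<^sub>m A) = 1\<^sub>m n"
    using mult_smult_distrib[of "(1 / c) \<cdot>\<^sub>m inverse_mat A" n n A n c]
      mult_smult_assoc_mat[OF iA A(1), of "1 / c"] inverse_mat_left[OF A] A iA c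
    by (intro eq_matI) auto
qed

text \<open>The transpose of the inverse is an inverse of the transpose, which is \<open>M\<close>
  again; uniqueness of the inverse does the rest.\<close>

lemma inverse_mat_symmetric:
  assumes M: "M \<in> carrier_mat n n" and d: "Determinant.det M \<noteq> 0"
    and s: "\<And>i j. i < n \<Longrightarrow> j < n \<Longrightarrow> M $$ (i, j) = M $$ (j, i)"
    and ij: "i < n" "j < n"
  shows "inverse_mat M $$ (i, j) = inverse_mat M $$ (j, i)"
proof -
  let ?B = "inverse_mat M"
  have B: "?B \<in> carrier_mat n n" using inverse_mat_carrier[OF M d] .
  have t: "transpose_mat M = M"
    using M s by (intro eq_matI) auto
  have "inverse_mat M = transpose_mat ?B"
  proof (rule inverse_mat_eqI[OF M])
    show "transpose_mat ?B \<in> carrier_mat n n" using B by simp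
    have "M * transpose_mat ?B = transpose_mat (?B * M)"
      using transpose_mult[OF B M] t by simp
    then show "M * transpose_mat ?B = 1\<^sub>m n" using inverse_mat_left[OF M d] by simp
    have "transpose_mat ?B * M = transpose_mat (M * ?B)"
      using transpose_mult[OF M B] t by simp
    then show "transpose_mat ?B * M = 1\<^sub>m n" using inverse_mat_right[OF M d] by simp
  qed
  then have "?B $$ (i, j) = transpose_mat ?B $$ (i, j)" by simp
  then show ?thesis using B ij by simp
qed

section \<open>Derivatives of determinants and inverses\<close>

text \<open>Jacobi's formula. In the Leibniz expansion the product rule produces, for each k, the
  determinant of the matrix \<open>B k\<close> whose k-th row is differentiated. Expanding it along
  row k gives cofactors of \<open>M x\<close>, since these do not see row k.\<close>

lemma has_real_derivative_det:
  fixes M :: "real \<Rightarrow> real mat"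
  assumes car: "\<And>t. M t \<in> carrier_mat n n"
    and der: "\<And>i j. i < n \<Longrightarrow> j < n \<Longrightarrow> ((\<lambda>t. M t $$ (i, j)) has_real_derivative M' i j) (at x)"
  shows "((\<lambda>t. Determinant.det (M t)) has_real_derivative
           (\<Sum>i<n. \<Sum>j<n. M' i j * cofactor (M x) i j)) (at x)"
proof -
  define B where "B k = Matrix.mat n n (\<lambda>(i, j). if i = k then M' k j else M x $$ (i, j))" for k
  have B: "B k \<in> carrier_mat n n" for k by (simp add: B_def)
  let ?P = "{p. p permutes {0..<n}}"
  have "((\<lambda>t. \<Sum>p\<in>?P. signof p * (\<Prod>i=0..<n. M t $$ (i, p i))) has_real_derivative
      (\<Sum>p\<in>?P. signof p * (\<Sum>k=0..<n. M' k (p k) * (\<Prod>i\<in>{0..<n}-{k}. M x $$ (i, p i))))) (at x)"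
    by (intro DERIV_sum DERIV_cmult has_field_derivative_prod der)
       (auto dest: permutes_in_image)
  moreover have "(\<Sum>p\<in>?P. signof p * (\<Sum>k=0..<n. M' k (p k) * (\<Prod>i\<in>{0..<n}-{k}. M x $$ (i, p i))))
      = (\<Sum>k=0..<n. \<Sum>j<n. M' k j * cofactor (M x) k j)"
  proof -
    have "(\<Sum>p\<in>?P. signof p * (M' k (p k) * (\<Prod>i\<in>{0..<n}-{k}. M x $$ (i, p i))))
        = (\<Sum>j<n. M' k j * cofactor (M x) k j)" if k: "k < n" for k
    proof -
      have "(\<Sum>p\<in>?P. signof p * (M' k (p k) * (\<Prod>i\<in>{0..<n}-{k}. M x $$ (i, p i))))
          = (\<Sum>p\<in>?P. signof p * (\<Prod>i=0..<n. B k $$ (i, p i)))"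
      proof (rule sum.cong[OF refl], rule arg_cong[where f = "\<lambda>z. _ * z"])
        fix p assume "p \<in> ?P"
        then have pn: "i < n \<Longrightarrow> p i < n" for i by (auto dest: permutes_in_image[of p _ i])
        have "(\<Prod>i=0..<n. B k $$ (i, p i)) = B k $$ (k, p k) * (\<Prod>i\<in>{0..<n}-{k}. B k $$ (i, p i))"
          using k by (intro prod.remove) auto
        also have "\<dots> = M' k (p k) * (\<Prod>i\<in>{0..<n}-{k}. M x $$ (i, p i))"
          using k pn by (auto simp: B_def intro!: prod.cong)
        finally show "M' k (p k) * (\<Prod>i\<in>{0..<n}-{k}. M x $$ (i, p i)) = (\<Prod>i=0..<n. B k $$ (i, p i))"
          by simp
      qed
      also have "\<dots> = Determinant.det (B k)" by (rule det_def'[OF B, symmetric])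
      also have "\<dots> = (\<Sum>j<n. B k $$ (k, j) * cofactor (B k) k j)"
        by (rule laplace_expansion_row[OF B k])
      also have "\<dots> = (\<Sum>j<n. M' k j * cofactor (M x) k j)"
      proof (rule sum.cong[OF refl])
        fix j assume j: "j \<in> {..<n}"
        have "mat_delete (B k) k j = mat_delete (M x) k j"
          using car[of x] k j unfolding mat_delete_def by (intro eq_matI) (auto simp: B_def)
        then show "B k $$ (k, j) * cofactor (B k) k j = M' k j * cofactor (M x) k j"
          using k j by (simp add: B_def cofactor_def)
      qed
      finally show ?thesis .
    qed
    then have "(\<Sum>k=0..<n. \<Sum>p\<in>?P. signof p * (M' k (p k) * (\<Prod>i\<in>{0..<n}-{k}. M x $$ (i, p i))))
      = (\<Sum>k=0..<n. \<Sum>j<n. M' k j * cofactor (M x) k j)" by simp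
    then show ?thesis
      unfolding sum_distrib_left by (subst sum.swap) simp
  qed
  ultimately show ?thesis
    by (simp add: det_def'[OF car] atLeast0LessThan)
qed

lemma det_differentiable:
  fixes M :: "real \<Rightarrow> real mat"
  assumes car: "\<And>t. M t \<in> carrier_mat n n"
    and der: "\<And>i j. i < n \<Longrightarrow> j < n \<Longrightarrow> (\<lambda>t. M t $$ (i, j)) differentiable (at x)"
  shows "(\<lambda>t. Determinant.det (M t)) differentiable (at x)"
proof -
  have "\<forall>i j. \<exists>d. i < n \<and> j < n \<longrightarrow> ((\<lambda>t. M t $$ (i, j)) has_real_derivative d) (at x)"
    using der by (auto simp: real_differentiable_def)
  then obtain M' where "\<And>i j. i < n \<Longrightarrow> j < n \<Longrightarrow> ((\<lambda>t. M t $$ (i, j)) has_real_derivative M' i j) (at x)"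
    by metis
  from has_real_derivative_det[OF car this] show ?thesis
    by (auto simp: real_differentiable_def)
qed

text \<open>The entries are cofactors divided by the determinant. At singular matrices
  \<open>inverse_mat\<close> is an unspecified value, so this quotient is used only near
  \<open>x\<close>, where continuity keeps the determinant away from 0.\<close>

lemma inverse_mat_differentiable:
  fixes M :: "real \<Rightarrow> real mat"
  assumes car: "\<And>t. M t \<in> carrier_mat n n"
    and der: "\<And>i j. i < n \<Longrightarrow> j < n \<Longrightarrow> (\<lambda>t. M t $$ (i, j)) differentiable (at x)"
    and d: "Determinant.det (M x) \<noteq> 0" and ij: "i < n" "j < n"
  shows "(\<lambda>t. inverse_mat (M t) $$ (i, j)) differentiable (at x)"
proof -
  have dd: "(\<lambda>t. Determinant.det (M t)) differentiable (at x)"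
    by (rule det_differentiable[OF car der])
  have "(\<lambda>t. Determinant.det (mat_delete (M t) j i)) differentiable (at x)"
  proof (rule det_differentiable[where n = "n - 1"])
    show "mat_delete (M t) j i \<in> carrier_mat (n - 1) (n - 1)" for t
      using mat_delete_carrier[OF car] .
    fix a b assume ab: "a < n - 1" "b < n - 1"
    have "mat_delete (M t) j i $$ (a, b) = M t $$ (if a < j then a else Suc a, if b < i then b else Suc b)" for t
      using car[of t] ab unfolding mat_delete_def by auto
    then show "(\<lambda>t. mat_delete (M t) j i $$ (a, b)) differentiable (at x)"
      using der ab by simp
  qed
  then have "(\<lambda>t. cofactor (M t) j i / Determinant.det (M t)) differentiable (at x)"
    unfolding cofactor_def using dd d by (intro differentiable_divide differentiable_mult) auto
  moreover have "\<forall>\<^sub>F t in nhds x. Determinant.det (M t) \<noteq> 0"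
  proof -
    have "isCont (\<lambda>t. Determinant.det (M t)) x"
      using dd differentiable_imp_continuous_within by blast
    then have "\<forall>\<^sub>F t in at x. Determinant.det (M t) \<noteq> 0"
      using d by (auto simp: isCont_def intro: tendsto_imp_eventually_ne)
    then show ?thesis
      unfolding eventually_at_filter by eventually_elim (use d in auto)
  qed
  then have ev: "\<forall>\<^sub>F t in nhds x. cofactor (M t) j i / Determinant.det (M t) = inverse_mat (M t) $$ (i, j)"
    by eventually_elim (use inverse_mat_index[OF car] ij in auto)
  ultimately show ?thesis
    unfolding real_differentiable_def
    using DERIV_cong_ev[OF refl ev refl] by auto
qed

text \<open>The library's \<open>sqrt\<close> is an odd function on all of \<open>\<real>\<close>, so Gram determinants need only be nonzero.\<close>

lemma has_real_derivative_sqrt: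
  assumes "x \<noteq> 0"
  shows "(sqrt has_real_derivative sqrt x / (2 * x)) (at x)"
proof (rule DERIV_real_sqrt_generic[OF assms])
  show "sqrt x / (2 * x) = inverse (sqrt x) / 2" if "x > 0"
    using that by (simp add: field_simps)
  have "sqrt x * sqrt x = - x" if "x < 0"
    using that by (metis abs_of_neg real_sqrt_abs2 real_sqrt_mult)
  then show "sqrt x / (2 * x) = - inverse (sqrt x) / 2" if "x < 0"
    using that by (simp add: field_simps)
qed

text \<open>Dividing Jacobi's formula by the determinant turns cofactors into entries of the
  inverse: the logarithmic derivative of the volume density is half the trace of the inverse times
  the derivative of \<open>M\<close>.\<close>

lemma has_real_derivative_sqrt_det:
  fixes M :: "real \<Rightarrow> real mat"
  assumes car: "\<And>t. M t \<in> carrier_mat n n"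
    and der: "\<And>i j. i < n \<Longrightarrow> j < n \<Longrightarrow> ((\<lambda>t. M t $$ (i, j)) has_real_derivative M' i j) (at x)"
    and d: "Determinant.det (M x) \<noteq> 0"
  shows "((\<lambda>t. sqrt (Determinant.det (M t))) has_real_derivative
      (\<Sum>i<n. \<Sum>j<n. inverse_mat (M x) $$ (j, i) * M' i j) * sqrt (Determinant.det (M x)) / 2) (at x)"
proof -
  have "(\<Sum>i<n. \<Sum>j<n. M' i j * cofactor (M x) i j)
      = Determinant.det (M x) * (\<Sum>i<n. \<Sum>j<n. inverse_mat (M x) $$ (j, i) * M' i j)"
    using d by (simp add: sum_distrib_left inverse_mat_index[OF car] mult.commute)
  then have "((\<lambda>t. Determinant.det (M t)) has_real_derivative
      Determinant.det (M x) * (\<Sum>i<n. \<Sum>j<n. inverse_mat (M x) $$ (j, i) * M' i j)) (at x)"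
    using has_real_derivative_det[OF car der] by simp
  from DERIV_chain2[OF has_real_derivative_sqrt[OF d] this] show ?thesis
    using d by (simp add: field_simps)
qed

section \<open>Partial derivatives\<close>

abbreviation has_pd :: "((nat \<Rightarrow> real) \<Rightarrow> 'v::real_normed_vector) \<Rightarrow> nat \<Rightarrow> (nat \<Rightarrow> real) \<Rightarrow> 'v \<Rightarrow> bool" where
  "has_pd F i u D \<equiv> ((\<lambda>t. F (u(i := t))) has_vector_derivative D) (at (u i))"

abbreviation pdiff :: "((nat \<Rightarrow> real) \<Rightarrow> 'v::real_normed_vector) \<Rightarrow> nat \<Rightarrow> (nat \<Rightarrow> real) \<Rightarrow> bool" where
  "pdiff F i u \<equiv> (\<lambda>t. F (u(i := t))) differentiable (at (u i))"

lemma pd_eqI: "has_pd F i u D \<Longrightarrow> pd i F u = D"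
  unfolding pd_def by (rule vector_derivative_at)

lemma pdiff_has_pd: "pdiff F i u \<Longrightarrow> has_pd F i u (pd i F u)"
  unfolding pd_def using vector_derivative_works by blast

lemma has_pd_pdiff: "has_pd F i u D \<Longrightarrow> pdiff F i u"
  by (rule differentiableI_vector)

text \<open>A partial derivative sees only the coordinate line through \<open>u\<close>, so an
  identity valid on a chart domain may be differentiated as soon as a piece of that line lies in the
  domain.\<close>

lemma has_pd_cong:
  assumes "\<forall>\<^sub>F t in nhds (u i). F (u(i := t)) = G (u(i := t))"
  shows "has_pd F i u D \<longleftrightarrow> has_pd G i u D"
  by (rule has_vector_derivative_cong_ev) (use assms eventually_nhds_x_imp_x[OF assms] in simp_all)

lemma pd_cong:
  assumes "\<forall>\<^sub>F t in nhds (u i). F (u(i := t)) = G (u(i := t))"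
  shows "pd i F u = pd i G u"
proof -
  have "has_pd F i u = has_pd G i u" using has_pd_cong[OF assms] by (intro ext)
  then show ?thesis by (simp only: pd_def vector_derivative_def)
qed

lemma continuous_on_fun_upd:
  "continuous_on S g \<Longrightarrow> continuous_on S h \<Longrightarrow> continuous_on S (\<lambda>z. (g z)(i := h z))"
  for g :: "'a::topological_space \<Rightarrow> 'i \<Rightarrow> 'b::topological_space"
proof (rule continuous_on_coordinatewise_then_product)
  assume "continuous_on S g" "continuous_on S h"
  then show "continuous_on S (\<lambda>z. ((g z)(i := h z)) j)" for j
    using continuous_on_product_then_coordinatewise[of S g j] by (cases "j = i") simp_all
qed

lemma openin_Euclidean_space_obtain:
  assumes "openin (Euclidean_space k) S"
  obtains T where "open T" "S = T \<inter> topspace (Euclidean_space k)"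
  using assms unfolding Euclidean_space_def openin_subtopology euclidean_product_topology
  by auto

text \<open>Changing a coordinate below k does not leave the Euclidean space, and inside it
  \<open>S\<close> is cut out by an open set of the product topology.\<close>

lemma eventually_fun_upd_in:
  assumes "openin (Euclidean_space k) S" "u \<in> S" "i < k"
  shows "\<forall>\<^sub>F t in nhds (u i). u(i := t) \<in> S"
proof -
  obtain T where T: "open T" "S = T \<inter> topspace (Euclidean_space k)"
    using openin_Euclidean_space_obtain[OF assms(1)] .
  have "open ((\<lambda>t. u(i := t)) -` T)"
    by (intro open_vimage T continuous_on_fun_upd continuous_intros)
  moreover have "u(i := t) \<in> topspace (Euclidean_space k)" for t
    using assms T by (auto simp: topspace_Euclidean_space)
  moreover have "u i \<in> (\<lambda>t. u(i := t)) -` T" using assms T by simp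
  ultimately show ?thesis
    unfolding eventually_nhds T(2) by auto
qed

lemma smooth_on_pdiff:
  assumes "smooth_on k S F" "u \<in> S" "i < k"
  shows "pdiff F i u"
  using assms unfolding smooth_on_def by (metis Cm_on.simps(2))

lemma smooth_on_pd:
  assumes "smooth_on k S F" "i < k"
  shows "smooth_on k S (pd i F)"
  using assms unfolding smooth_on_def by (metis Cm_on.simps(2))

lemma smooth_on_continuous_on:
  assumes "smooth_on k S F" "S \<subseteq> topspace (Euclidean_space k)"
  shows "continuous_on S F"
proof -
  have "Cm_on 0 k S F" using assms unfolding smooth_on_def by blast
  then have "continuous_map (subtopology (Euclidean_space k) S) euclidean F" by simp
  moreover have "subtopology (Euclidean_space k) S = top_of_set S"
  proof -
    have "{x. \<forall>i\<ge>k. x i = 0} \<inter> S = S"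
      using assms(2) by (auto simp: topspace_Euclidean_space)
    then show ?thesis
      by (simp only: Euclidean_space_def euclidean_product_topology subtopology_subtopology)
  qed
  ultimately show ?thesis by simp
qed

section \<open>Symmetry of second partial derivatives\<close>

lemma mixed_difference_MVT:
  fixes f :: "real \<Rightarrow> real \<Rightarrow> real"
  assumes h: "h > 0"
    and ds: "\<And>s t. s \<in> {a..a+h} \<Longrightarrow> t \<in> {b..b+h} \<Longrightarrow> ((\<lambda>s. f s t) has_real_derivative f1 s t) (at s)"
    and dst: "\<And>s t. s \<in> {a..a+h} \<Longrightarrow> t \<in> {b..b+h} \<Longrightarrow> ((\<lambda>t. f1 s t) has_real_derivative f12 s t) (at t)"
  obtains s t where "s \<in> {a..a+h}" "t \<in> {b..b+h}"
    "f (a + h) (b + h) - f (a + h) b - f a (b + h) + f a b = h * h * f12 s t"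
proof -
  have "\<exists>z. a < z \<and> z < a + h \<and>
      (f (a + h) (b + h) - f (a + h) b) - (f a (b + h) - f a b) = ((a + h) - a) * (f1 z (b + h) - f1 z b)"
    by (rule MVT2) (use h in \<open>auto intro!: DERIV_diff ds\<close>)
  then obtain s where s: "a < s" "s < a + h"
    "f (a + h) (b + h) - f (a + h) b - f a (b + h) + f a b = h * (f1 s (b + h) - f1 s b)"
    by (auto simp: algebra_simps)
  have "\<exists>z. b < z \<and> z < b + h \<and> f1 s (b + h) - f1 s b = ((b + h) - b) * f12 s z"
    by (rule MVT2) (use h s in \<open>auto intro!: dst\<close>)
  then obtain t where t: "b < t" "t < b + h" "f1 s (b + h) - f1 s b = h * f12 s t" by auto
  show ?thesis by (rule that[of s t]) (use s t in auto)
qed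

text \<open>The second difference over a square of side h is symmetric in the two variables, and by
  the mean value theorem it equals h^2 times a value of \<open>f12\<close> and also h^2 times a
  value of \<open>f21\<close> in that square. In a small square these values are too close to those
  at (a, b) for the latter to differ.\<close>

lemma mixed_derivatives_eq:
  fixes f :: "real \<Rightarrow> real \<Rightarrow> real"
  assumes W: "open W" "(a, b) \<in> W"
    and d1: "\<And>s t. (s, t) \<in> W \<Longrightarrow> ((\<lambda>s. f s t) has_real_derivative f1 s t) (at s)"
    and d2: "\<And>s t. (s, t) \<in> W \<Longrightarrow> ((\<lambda>t. f s t) has_real_derivative f2 s t) (at t)"
    and d12: "\<And>s t. (s, t) \<in> W \<Longrightarrow> ((\<lambda>t. f1 s t) has_real_derivative f12 s t) (at t)"
    and d21: "\<And>s t. (s, t) \<in> W \<Longrightarrow> ((\<lambda>s. f2 s t) has_real_derivative f21 s t) (at s)"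
    and c12: "continuous_on W (\<lambda>(s, t). f12 s t)"
    and c21: "continuous_on W (\<lambda>(s, t). f21 s t)"
  shows "f12 a b = f21 a b"
proof (rule ccontr)
  assume ne: "f12 a b \<noteq> f21 a b"
  define e where "e = \<bar>f12 a b - f21 a b\<bar> / 2"
  have e: "e > 0" using ne by (simp add: e_def)
  have lim: "(g \<longlongrightarrow> g (a, b)) (nhds (a, b))" if "continuous_on W g" for g :: "real \<times> real \<Rightarrow> real"
    using that W by (auto simp: continuous_on_eq_continuous_at isCont_def tendsto_at_iff_tendsto_nhds)
  have "\<forall>\<^sub>F z in nhds (a, b). dist (case z of (s, t) \<Rightarrow> f12 s t) (f12 a b) < e"
    using tendstoD[OF lim[OF c12] e] by simp
  moreover have "\<forall>\<^sub>F z in nhds (a, b). dist (case z of (s, t) \<Rightarrow> f21 s t) (f21 a b) < e"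
    using tendstoD[OF lim[OF c21] e] by simp
  moreover have "\<forall>\<^sub>F z in nhds (a, b). z \<in> W" using W by (rule eventually_nhds_in_open)
  ultimately have "\<forall>\<^sub>F z in nhds (a, b). z \<in> W \<and> dist (case z of (s, t) \<Rightarrow> f12 s t) (f12 a b) < e
      \<and> dist (case z of (s, t) \<Rightarrow> f21 s t) (f21 a b) < e"
    by eventually_elim auto
  then obtain d where d: "d > 0" and dz: "\<And>s t. dist (s, t) (a, b) < d \<Longrightarrow> (s, t) \<in> W \<and>
     dist (f12 s t) (f12 a b) < e \<and> dist (f21 s t) (f21 a b) < e"
    unfolding eventually_nhds_metric by fastforce
  \<comment> \<open>The distance to the corner is at most the sum of the two sides, here d / 2, so
    the whole square lies in the ball of radius d.\<close>
  define h where "h = d / 4"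
  have h: "h > 0" using d by (simp add: h_def)
  have near: "dist (s, t) (a, b) < d" if "s \<in> {a..a+h}" "t \<in> {b..b+h}" for s t
  proof -
    have "dist (s, t) (a, b) \<le> dist s a + dist t b"
      unfolding dist_Pair_Pair by (rule sqrt_sum_squares_le_sum) auto
    also have "\<dots> < d" using that h d by (auto simp: dist_real_def h_def)
    finally show ?thesis .
  qed
  have inW: "(s, t) \<in> W" if "s \<in> {a..a+h}" "t \<in> {b..b+h}" for s t
    using dz[OF near[OF that]] by simp
  obtain s t where st: "s \<in> {a..a+h}" "t \<in> {b..b+h}"
    "f (a + h) (b + h) - f (a + h) b - f a (b + h) + f a b = h * h * f12 s t"
    by (rule mixed_difference_MVT[OF h, of a b f f1 f12]) (use d1 d12 inW in auto)
  obtain t' s' where st': "t' \<in> {b..b+h}" "s' \<in> {a..a+h}"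
    "f (a + h) (b + h) - f a (b + h) - f (a + h) b + f a b = h * h * f21 s' t'"
    by (rule mixed_difference_MVT[OF h, of b a "\<lambda>t s. f s t" "\<lambda>t s. f2 s t" "\<lambda>t s. f21 s t"])
       (use d2 d21 inW in auto)
  have "h * h * f12 s t = h * h * f21 s' t'" using st(3) st'(3) by linarith
  then have "f12 s t = f21 s' t'" using h by simp
  moreover have "dist (f12 s t) (f12 a b) < e" "dist (f21 s' t') (f21 a b) < e"
    using dz[OF near[OF st(1,2)]] dz[OF near[OF st'(2,1)]] by simp_all
  ultimately show False
    unfolding e_def dist_real_def by (auto simp: abs_if field_simps split: if_splits)
qed

text \<open>Freezing all coordinates except i and j and pairing with a fixed vector \<open>e\<close>
  leaves a real function of two real variables, to which the mean value argument applies.\<close>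

lemma pd_commute:
  fixes F :: "(nat \<Rightarrow> real) \<Rightarrow> 'v::real_inner"
  assumes S: "openin (Euclidean_space k) S" and F: "smooth_on k S F"
    and u: "u \<in> S" and ij: "i < k" "j < k"
  shows "pd i (pd j F) u = pd j (pd i F) u"
proof (cases "i = j")
  case False
  obtain T where T: "open T" "S = T \<inter> topspace (Euclidean_space k)"
    using openin_Euclidean_space_obtain[OF S] .
  define q where "q s t = u(i := s, j := t)" for s t
  have q: "q s t = (q s' t)(i := s)" "q s t = (q s t')(j := t)" "q s t i = s" "q s t j = t" for s t s' t'
    using False by (auto simp: q_def)
  have qE: "q s t \<in> topspace (Euclidean_space k)" for s t
    using u T ij by (auto simp: q_def topspace_Euclidean_space)
  define W where "W = (\<lambda>z. q (fst z) (snd z)) -` T"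
  have contq: "continuous_on A (\<lambda>z. q (fst z) (snd z))" for A
    unfolding q_def by (intro continuous_on_fun_upd continuous_intros)
  have W: "open W" unfolding W_def by (intro open_vimage T contq)
  have WS: "(s, t) \<in> W \<longleftrightarrow> q s t \<in> S" for s t
    using T qE by (auto simp: W_def)
  have d1: "((\<lambda>s. H (q s t)) has_vector_derivative pd i H (q s t)) (at s)"
    if "(s, t) \<in> W" "smooth_on k S H" for s t and H :: "(nat \<Rightarrow> real) \<Rightarrow> 'v"
    using pdiff_has_pd[OF smooth_on_pdiff[OF that(2) _ ij(1)], of "q s t"] that(1)
    unfolding WS by (simp add: q(3,4) flip: q(1,2))
  have d2: "((\<lambda>t. H (q s t)) has_vector_derivative pd j H (q s t)) (at t)"
    if "(s, t) \<in> W" "smooth_on k S H" for s t and H :: "(nat \<Rightarrow> real) \<Rightarrow> 'v"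
    using pdiff_has_pd[OF smooth_on_pdiff[OF that(2) _ ij(2)], of "q s t"] that(1)
    unfolding WS by (simp add: q(3,4) flip: q(1,2))
  note Fi = smooth_on_pd[OF F ij(1)] and Fj = smooth_on_pd[OF F ij(2)]
  have "inner (pd j (pd i F) u) e = inner (pd i (pd j F) u) e" for e
  proof -
    have inn: "((\<lambda>x. inner (g x) e) has_real_derivative inner g' e) (at x)"
      if "(g has_vector_derivative g') (at x)" for g g' x
      using bounded_linear.has_vector_derivative[OF bounded_linear_inner_left that, of e]
      by (simp add: has_real_derivative_iff_has_vector_derivative)
    have cont: "continuous_on W (\<lambda>(s, t). inner (pd a (pd b F) (q s t)) e)" if "a < k" "b < k" for a b
    proof -
      have "continuous_on S (pd a (pd b F))"
        by (rule smooth_on_continuous_on[OF smooth_on_pd[OF smooth_on_pd[OF F that(2)] that(1)]]) (use T in auto)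
      then have "continuous_on W (\<lambda>z. pd a (pd b F) (q (fst z) (snd z)))"
        by (rule continuous_on_compose2[OF _ contq]) (use WS in auto)
      then show ?thesis unfolding case_prod_beta by (intro continuous_intros)
    qed
    have uq: "q (u i) (u j) = u" by (simp add: q_def)
    have "(u i, u j) \<in> W" using u WS uq by simp
    then have "inner (pd j (pd i F) (q (u i) (u j))) e = inner (pd i (pd j F) (q (u i) (u j))) e"
    proof (rule mixed_derivatives_eq[OF W])
      show "((\<lambda>s. inner (F (q s t)) e) has_real_derivative inner (pd i F (q s t)) e) (at s)"
        "((\<lambda>t. inner (F (q s t)) e) has_real_derivative inner (pd j F (q s t)) e) (at t)"
        "((\<lambda>t. inner (pd i F (q s t)) e) has_real_derivative inner (pd j (pd i F) (q s t)) e) (at t)"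
        "((\<lambda>s. inner (pd j F (q s t)) e) has_real_derivative inner (pd i (pd j F) (q s t)) e) (at s)"
        if "(s, t) \<in> W" for s t
        using that F Fi Fj by (auto intro!: inn d1 d2)
    qed (use cont ij in auto)
    then show ?thesis by (simp add: uq)
  qed
  then have "inner (pd j (pd i F) u - pd i (pd j F) u) e = 0" for e
    by (simp add: inner_diff_left)
  then show ?thesis by (metis inner_eq_zero_iff right_minus_eq)
qed simp

section \<open>Minimal immersions into spheres\<close>

lemma has_real_pd_inner:
  assumes "has_pd F i u D" "has_pd G i u D'"
  shows "((\<lambda>t. inner (F (u(i := t))) (G (u(i := t)))) has_real_derivative
           inner (F u) D' + inner D (G u)) (at (u i))"
  using bounded_bilinear.has_vector_derivative[OF bounded_bilinear_inner assms]
  by (simp add: has_real_derivative_iff_has_vector_derivative)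

lemma real_has_pd_unique:
  assumes "((\<lambda>t. f (u(i := t))) has_real_derivative D) (at (u i))"
    "((\<lambda>t. g (u(i := t))) has_real_derivative D') (at (u i))"
    "\<forall>\<^sub>F t in nhds (u i). f (u(i := t)) = g (u(i := t))"
  shows "D = D'"
  using assms DERIV_cong_ev[OF refl assms(3) refl] DERIV_unique by blast

lemma inner_pd_unit_norm:
  fixes F :: "(nat \<Rightarrow> real) \<Rightarrow> 'v::real_inner"
  assumes S: "openin (Euclidean_space k) S" and F: "smooth_on k S F"
    and unit: "\<And>v. v \<in> S \<Longrightarrow> norm (F v) = 1" and u: "u \<in> S" and j: "j < k"
  shows "inner (F u) (pd j F u) = 0"
proof -
  have FF: "inner (F v) (F v) = 1" if "v \<in> S" for v
    using unit[OF that] by (simp add: norm_eq_sqrt_inner)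
  have d: "has_pd F j u (pd j F u)" by (rule pdiff_has_pd[OF smooth_on_pdiff[OF F u j]])
  have "inner (F u) (pd j F u) + inner (pd j F u) (F u) = 0"
    by (rule real_has_pd_unique[OF has_real_pd_inner[OF d d], of "\<lambda>_. 1"])
       (use eventually_fun_upd_in[OF S u j] in \<open>auto elim!: eventually_mono simp: FF simp del: fun_upd_apply\<close>)
  then show ?thesis by (simp add: inner_commute)
qed

section \<open>The divergence form of the Laplacian of an immersion\<close>

definition gram :: "nat \<Rightarrow> ((nat \<Rightarrow> real) \<Rightarrow> 'v::real_inner) \<Rightarrow> (nat \<Rightarrow> real) \<Rightarrow> real mat" where
  "gram k F u = Matrix.mat k k (\<lambda>(i, j). inner (pd i F u) (pd j F u))"

text \<open>The expression that \<open>laplace_beltrami\<close> differentiates in direction i, for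
  the metric induced by \<open>F\<close> and the function \<open>F\<close> itself: the density times
  the i-th component of the gradient.\<close>

definition flux :: "nat \<Rightarrow> ((nat \<Rightarrow> real) \<Rightarrow> 'v::real_inner) \<Rightarrow> nat \<Rightarrow> (nat \<Rightarrow> real) \<Rightarrow> 'v" where
  "flux k F i u =
     (\<Sum>j<k. (sqrt (Determinant.det (gram k F u)) * inverse_mat (gram k F u) $$ (i, j)) *\<^sub>R pd j F u)"

lemma gram_carrier: "gram k F u \<in> carrier_mat k k"
  by (simp add: gram_def)

lemma gram_index: "i < k \<Longrightarrow> j < k \<Longrightarrow> gram k F u $$ (i, j) = inner (pd i F u) (pd j F u)"
  by (simp add: gram_def)

context
  fixes k :: nat and S :: "(nat \<Rightarrow> real) set" and F :: "(nat \<Rightarrow> real) \<Rightarrow> 'v::real_inner"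
  assumes S: "openin (Euclidean_space k) S" and F: "smooth_on k S F"
    and d: "\<And>u. u \<in> S \<Longrightarrow> Determinant.det (gram k F u) \<noteq> 0"
begin

private abbreviation "r u \<equiv> sqrt (Determinant.det (gram k F u))"
private abbreviation "B u \<equiv> inverse_mat (gram k F u)"
private abbreviation "c i j u \<equiv> r u * B u $$ (i, j)"

private lemma F1: "has_pd F i u (pd i F u)" if "u \<in> S" "i < k" for u i
  by (rule pdiff_has_pd[OF smooth_on_pdiff[OF F that]])

private lemma F2: "has_pd (pd j F) i u (pd i (pd j F) u)" if "u \<in> S" "i < k" "j < k" for u i j
  by (rule pdiff_has_pd[OF smooth_on_pdiff[OF smooth_on_pd[OF F that(3)] that(1,2)]])

private lemma near: "\<forall>\<^sub>F t in nhds (u i). u(i := t) \<in> S" if "u \<in> S" "i < k" for u i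
  by (rule eventually_fun_upd_in[OF S that])

private lemma gram_pd:
  assumes "u \<in> S" "l < k" "i < k" "j < k"
  shows "((\<lambda>t. gram k F (u(l := t)) $$ (i, j)) has_real_derivative
           inner (pd i F u) (pd l (pd j F) u) + inner (pd l (pd i F) u) (pd j F u)) (at (u l))"
  using has_real_pd_inner[OF F2 F2, OF assms(1,2,3,1,2,4)] assms
  by (simp add: gram_index del: fun_upd_apply)

private lemma B_sym: "B u $$ (i, j) = B u $$ (j, i)" if "u \<in> S" "i < k" "j < k" for u i j
  by (rule inverse_mat_symmetric[OF gram_carrier d])
     (use that in \<open>auto simp: gram_index inner_commute\<close>)

text \<open>Differentiating an inner product gives two terms; symmetry of the inverse Gram matrix
  and of second partial derivatives makes their traces equal, which cancels the factor 1/2 coming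
  from the square root.\<close>

private lemma r_pd:
  assumes "u \<in> S" "l < k"
  shows "((\<lambda>t. r (u(l := t))) has_real_derivative
           r u * (\<Sum>i<k. \<Sum>j<k. B u $$ (i, j) * inner (pd j F u) (pd i (pd l F) u))) (at (u l))"
proof -
  let ?T = "\<Sum>i<k. \<Sum>j<k. B u $$ (i, j) * inner (pd j F u) (pd i (pd l F) u)"
  have "((\<lambda>t. r (u(l := t))) has_real_derivative
      (\<Sum>i<k. \<Sum>j<k. B u $$ (j, i) * (inner (pd i F u) (pd l (pd j F) u) + inner (pd l (pd i F) u) (pd j F u)))
        * r u / 2) (at (u l))"
    using has_real_derivative_sqrt_det[of "\<lambda>t. gram k F (u(l := t))" k
        "\<lambda>i j. inner (pd i F u) (pd l (pd j F) u) + inner (pd l (pd i F) u) (pd j F u)" "u l",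
        OF gram_carrier gram_pd[OF assms]] d[OF assms(1)] by (simp del: fun_upd_apply)
  moreover have "(\<Sum>i<k. \<Sum>j<k. B u $$ (j, i) * (inner (pd i F u) (pd l (pd j F) u) + inner (pd l (pd i F) u) (pd j F u)))
     = ?T + ?T"
  proof -
    have "(\<Sum>i<k. \<Sum>j<k. B u $$ (j, i) * inner (pd i F u) (pd l (pd j F) u)) = ?T"
      by (subst sum.swap) (use assms pd_commute[OF S F] in simp)
    moreover have "(\<Sum>i<k. \<Sum>j<k. B u $$ (j, i) * inner (pd l (pd i F) u) (pd j F u)) = ?T"
      using assms pd_commute[OF S F] B_sym by (simp add: inner_commute)
    ultimately show ?thesis by (simp add: distrib_left sum.distrib)
  qed
  ultimately show ?thesis by (simp add: mult.commute)
qed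

private lemma c_diff:
  assumes "u \<in> S" "l < k" "i < k" "j < k"
  shows "(\<lambda>t. c i j (u(l := t))) differentiable (at (u l))"
proof -
  have "(\<lambda>t. r (u(l := t))) differentiable (at (u l))"
    using r_pd[OF assms(1,2)] real_differentiable_def by blast
  moreover have "(\<lambda>t. B (u(l := t)) $$ (i, j)) differentiable (at (u l))"
    using inverse_mat_differentiable[of "\<lambda>t. gram k F (u(l := t))" k "u l" i j]
      gram_pd[OF assms(1,2)] gram_carrier d[OF assms(1)] assms
    by (simp add: real_differentiable_def) blast
  ultimately show ?thesis by (rule differentiable_mult)
qed

private lemma flux_has_pd:
  assumes "u \<in> S" "i < k"
  shows "has_pd (flux k F i) i u
    (\<Sum>j<k. c i j u *\<^sub>R pd i (pd j F) u + pd i (c i j) u *\<^sub>R pd j F u)"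
  unfolding flux_def
proof (rule has_vector_derivative_sum)
  fix j assume "j \<in> {..<k}"
  then have "((\<lambda>t. c i j (u(i := t))) has_vector_derivative pd i (c i j) u) (at (u i))"
    using pdiff_has_pd[OF c_diff[OF assms(1,2,2)]] by (simp del: fun_upd_apply)
  then have 1: "((\<lambda>t. c i j (u(i := t))) has_real_derivative pd i (c i j) u) (at (u i))"
    by (simp add: has_real_derivative_iff_has_vector_derivative)
  show "((\<lambda>t. c i j (u(i := t)) *\<^sub>R pd j F (u(i := t))) has_vector_derivative
      c i j u *\<^sub>R pd i (pd j F) u + pd i (c i j) u *\<^sub>R pd j F u) (at (u i))"
    using has_vector_derivative_scaleR[OF 1 F2[OF assms]] \<open>j \<in> {..<k}\<close> by (simp del: fun_upd_apply)
qed

lemma pdiff_flux: "u \<in> S \<Longrightarrow> i < k \<Longrightarrow> pdiff (flux k F i) i u"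
  by (rule has_pd_pdiff[OF flux_has_pd])

text \<open>The tangential part of the Laplacian of the position vector vanishes: by the Jacobi formula
  for \<open>\<partial>\<^sub>l \<surd>g\<close> it is the difference of two expressions that agree because second partial
  derivatives commute.\<close>

lemma divergence_flux_tangential:
  assumes u: "u \<in> S" and l: "l < k"
  shows "inner (\<Sum>i<k. pd i (flux k F i) u) (pd l F u) = 0"
proof -
  let ?T = "\<Sum>i<k. \<Sum>j<k. B u $$ (i, j) * inner (pd j F u) (pd i (pd l F) u)"
  \<comment> \<open>The inverse Gram matrix contracts with the Gram matrix, so only the density
    survives. Differentiating this in direction i by the product rule and summing over i isolates
    the wanted divergence.\<close>
  have fl: "inner (flux k F i v) (pd l F v) = r v * (if i = l then 1 else 0)" if "v \<in> S" "i < k" for v i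
  proof -
    have "inner (flux k F i v) (pd l F v) = r v * (\<Sum>j<k. B v $$ (i, j) * gram k F v $$ (j, l))"
      using l by (simp add: flux_def inner_sum_left sum_distrib_left gram_index mult.assoc)
    then show ?thesis
      using sum_inverse_mat_left[OF gram_carrier d[OF that(1)] that(2) l] by simp
  qed
  have "inner (flux k F i u) (pd i (pd l F) u) + inner (pd i (flux k F i) u) (pd l F u)
      = (if i = l then r u * ?T else 0)" if i: "i < k" for i
  proof (rule real_has_pd_unique[where f = "\<lambda>v. inner (flux k F i v) (pd l F v)"])
    show "((\<lambda>t. inner (flux k F i (u(i := t))) (pd l F (u(i := t)))) has_real_derivative
      inner (flux k F i u) (pd i (pd l F) u) + inner (pd i (flux k F i) u) (pd l F u)) (at (u i))"
      by (rule has_real_pd_inner[OF pdiff_has_pd[OF pdiff_flux[OF u i]] F2[OF u i l]])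
    show "((\<lambda>t. r (u(i := t)) * (if i = l then 1 else 0)) has_real_derivative
        (if i = l then r u * ?T else 0)) (at (u i))"
      using r_pd[OF u l] by auto
    show "\<forall>\<^sub>F t in nhds (u i). inner (flux k F i (u(i := t))) (pd l F (u(i := t)))
        = r (u(i := t)) * (if i = l then 1 else 0)"
      using near[OF u i] by eventually_elim (rule fl[OF _ i])
  qed
  then have "(\<Sum>i<k. inner (flux k F i u) (pd i (pd l F) u) + inner (pd i (flux k F i) u) (pd l F u))
     = (\<Sum>i<k. if i = l then r u * ?T else 0)" by (intro sum.cong) auto
  then have "(\<Sum>i<k. inner (flux k F i u) (pd i (pd l F) u)) + (\<Sum>i<k. inner (pd i (flux k F i) u) (pd l F u)) = r u * ?T"
    using l by (simp add: sum.distrib)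
  moreover have "(\<Sum>i<k. inner (flux k F i u) (pd i (pd l F) u)) = r u * ?T"
    by (simp add: flux_def inner_sum_left sum_distrib_left mult.assoc)
  ultimately show ?thesis by (simp add: inner_sum_left)
qed

text \<open>\<open>minimal\<close> is the vanishing of the mean curvature tested against normal
  vectors z, free of projections. The candidate z = W + k r F is normal: its tangential part
  vanishes by the previous lemma, its part along \<open>F\<close> by taking the trace of
  \<open>ddFF\<close>. Minimality then gives \<open>inner W z = 0\<close>, so z is orthogonal to
  itself.\<close>

lemma divergence_flux_minimal:
  assumes u: "u \<in> S" and unit: "\<And>v. v \<in> S \<Longrightarrow> norm (F v) = 1"
    and minimal: "\<And>z. inner (F u) z = 0 \<Longrightarrow> (\<And>i. i < k \<Longrightarrow> inner (pd i F u) z = 0) \<Longrightarrow>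
      (\<Sum>i<k. \<Sum>j<k. B u $$ (i, j) * inner (pd i (pd j F) u) z) = 0"
  shows "(\<Sum>i<k. pd i (flux k F i) u) = (- real k * r u) *\<^sub>R F u"
proof -
  define W where "W = (\<Sum>i<k. pd i (flux k F i) u)"
  have W: "W = (\<Sum>i<k. \<Sum>j<k. c i j u *\<^sub>R pd i (pd j F) u + pd i (c i j) u *\<^sub>R pd j F u)"
    unfolding W_def using pd_eqI[OF flux_has_pd[OF u]] by simp
  have dFF: "inner (pd j F v) (F v) = 0" if "v \<in> S" "j < k" for v j
    using inner_pd_unit_norm[OF S F unit that] by (simp add: inner_commute)
  \<comment> \<open>Differentiate the orthogonality of \<open>pd j F\<close> and \<open>F\<close> in
    direction i.\<close>
  have ddFF: "inner (pd i (pd j F) u) (F u) = - gram k F u $$ (j, i)" if ij: "i < k" "j < k" for i j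
  proof -
    have "inner (pd j F u) (pd i F u) + inner (pd i (pd j F) u) (F u) = 0"
      by (rule real_has_pd_unique[OF has_real_pd_inner[OF F2 F1, OF u ij u ij(1)], of "\<lambda>_. 0"])
         (use near[OF u ij(1)] ij in \<open>auto elim!: eventually_mono simp: dFF simp del: fun_upd_apply\<close>)
    then show ?thesis using ij by (simp add: gram_index)
  qed
  have WF: "inner W (F u) = - real k * r u"
  proof -
    have "inner W (F u) = (\<Sum>i<k. \<Sum>j<k. c i j u * (- gram k F u $$ (j, i)))"
      unfolding W by (simp add: inner_sum_left inner_add_left ddFF dFF u)
    also have "\<dots> = - r u * (\<Sum>i<k. \<Sum>j<k. B u $$ (i, j) * gram k F u $$ (j, i))"
      by (simp add: sum_distrib_left mult.assoc sum_negf)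
    also have "\<dots> = - real k * r u"
      using sum_inverse_mat_left[OF gram_carrier d[OF u]] by simp
    finally show ?thesis .
  qed
  define z where "z = W + (real k * r u) *\<^sub>R F u"
  have zF: "inner (F u) z = 0"
    using WF unit[OF u] by (simp add: z_def inner_add_right inner_commute dot_square_norm)
  have zT: "inner (pd i F u) z = 0" if "i < k" for i
    using divergence_flux_tangential[OF u that] dFF[OF u that]
    by (simp add: z_def inner_add_right W_def inner_commute)
  have "inner W z = (\<Sum>i<k. \<Sum>j<k. c i j u * inner (pd i (pd j F) u) z)"
    unfolding W by (simp add: inner_sum_left inner_add_left zT)
  also have "\<dots> = r u * (\<Sum>i<k. \<Sum>j<k. B u $$ (i, j) * inner (pd i (pd j F) u) z)"
    by (simp add: sum_distrib_left mult.assoc)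
  also have "\<dots> = 0" using minimal[OF zF zT] by simp
  finally have "inner z z = 0"
    using zF by (simp add: z_def inner_add_left)
  then have "z = 0" by simp
  then have "W = - ((real k * r u) *\<^sub>R F u)" unfolding z_def by (simp add: eq_neg_iff_add_eq_0)
  then show ?thesis by (simp add: W_def)
qed

end

section \<open>The equation of motion of a solution curve\<close>

text \<open>\<open>w\<close> is the speed of \<open>\<gamma>\<close> and \<open>(E1, E2)\<close> its unit tangent.\<close>

definition minimal_profile :: "nat \<Rightarrow> nat \<Rightarrow> real set \<Rightarrow> (real \<Rightarrow> complex \<times> complex) \<Rightarrow> bool" where
  "minimal_profile k1 k2 I \<gamma> \<longleftrightarrow>
     (\<exists>a b w E1 E2. \<forall>t\<in>I. a t > 0 \<and> b t > 0 \<and> w t > 0 \<and>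
        cmod (fst (\<gamma> t)) = a t \<and> cmod (snd (\<gamma> t)) = b t \<and>
        ((\<lambda>t. fst (\<gamma> t)) has_vector_derivative w t *\<^sub>R E1 t) (at t) \<and>
        ((\<lambda>t. snd (\<gamma> t)) has_vector_derivative w t *\<^sub>R E2 t) (at t) \<and>
        (cmod (E1 t))\<^sup>2 + (cmod (E2 t))\<^sup>2 = 1 \<and>
        ((\<lambda>t. (a t ^ k1 * b t ^ k2) *\<^sub>R E1 t) has_vector_derivative
           (w t * (a t ^ k1 * b t ^ k2) * (real k1 / (a t)\<^sup>2 - real (k1 + k2 + 1))) *\<^sub>R fst (\<gamma> t)) (at t) \<and>
        ((\<lambda>t. (a t ^ k1 * b t ^ k2) *\<^sub>R E2 t) has_vector_derivative
           (w t * (a t ^ k1 * b t ^ k2) * (real k2 / (b t)\<^sup>2 - real (k1 + k2 + 1))) *\<^sub>R snd (\<gamma> t)) (at t))"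

text \<open>Derivatives of \<open>s\<^sub>1\<close> and \<open>s\<^sub>2\<close> by arc length, with \<open>c = \<plusminus> 1 / \<surd>C\<^sub>2\<close>; \<open>radial_energy\<close> is then \<open>(ds/dt)\<^sup>2\<close>.\<close>

definition speed1 :: "nat \<Rightarrow> nat \<Rightarrow> real \<Rightarrow> real \<Rightarrow> real" where
  "speed1 k1 k2 c x = c / (cos x ^ (k1 + 2) * sin x ^ k2)"

definition speed2 :: "nat \<Rightarrow> nat \<Rightarrow> real \<Rightarrow> real \<Rightarrow> real \<Rightarrow> real" where
  "speed2 k1 k2 C c x = C * c / (cos x ^ k1 * sin x ^ (k2 + 2))"

definition radial_energy :: "nat \<Rightarrow> nat \<Rightarrow> real \<Rightarrow> real \<Rightarrow> real \<Rightarrow> real" where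
  "radial_energy k1 k2 C c x =
     1 - (cos x)\<^sup>2 * (speed1 k1 k2 c x)\<^sup>2 - (sin x)\<^sup>2 * (speed2 k1 k2 C c x)\<^sup>2"

text \<open>Half of the derivative of \<open>radial_energy\<close>: where ds/dt is nonzero,
  differentiating (ds/dt)^2 = R(s) makes this the second derivative of s by arc length.\<close>

definition radial_force :: "nat \<Rightarrow> nat \<Rightarrow> real \<Rightarrow> real \<Rightarrow> real \<Rightarrow> real" where
  "radial_force k1 k2 C c x =
     - ((cos x)\<^sup>2 * (speed1 k1 k2 c x)\<^sup>2 * ((real k1 + 1) * sin x / cos x - real k2 * cos x / sin x)
        + (sin x)\<^sup>2 * (speed2 k1 k2 C c x)\<^sup>2 * (real k1 * sin x / cos x - (real k2 + 1) * cos x / sin x))"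

text \<open>Written as a logarithmic derivative, the formula has no exponent n - 1 and therefore
  covers n = 0, that is, factors of dimension 0.\<close>

lemma DERIV_power_rel:
  assumes "(f has_real_derivative f') (at x)" "f x \<noteq> 0"
  shows "((\<lambda>x. f x ^ n) has_real_derivative f x ^ n * (real n * f' / f x)) (at x)"
  by (rule DERIV_cong[OF DERIV_power[OF assms(1), of n]])
     (use assms(2) in \<open>cases n; simp add: field_simps\<close>)

lemma DERIV_speed1:
  assumes "(s has_real_derivative s') (at t)" "cos (s t) \<noteq> 0" "sin (s t) \<noteq> 0"
  shows "((\<lambda>t. speed1 k1 k2 c (s t)) has_real_derivative
     speed1 k1 k2 c (s t) * ((real k1 + 2) * sin (s t) / cos (s t) - real k2 * cos (s t) / sin (s t)) * s') (at t)"
proof -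
  have dc: "((\<lambda>t. cos (s t)) has_real_derivative - sin (s t) * s') (at t)"
    and ds: "((\<lambda>t. sin (s t)) has_real_derivative cos (s t) * s') (at t)"
    using assms(1) by (auto intro!: derivative_eq_intros)
  show ?thesis unfolding speed1_def
    by (rule DERIV_cong[OF DERIV_divide[OF DERIV_const DERIV_mult[OF DERIV_power_rel[OF dc] DERIV_power_rel[OF ds]]]])
       (use assms in \<open>simp_all add: divide_simps, simp add: algebra_simps\<close>)
qed

lemma DERIV_speed2:
  assumes "(s has_real_derivative s') (at t)" "cos (s t) \<noteq> 0" "sin (s t) \<noteq> 0"
  shows "((\<lambda>t. speed2 k1 k2 C c (s t)) has_real_derivative
     speed2 k1 k2 C c (s t) * (real k1 * sin (s t) / cos (s t) - (real k2 + 2) * cos (s t) / sin (s t)) * s') (at t)"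
proof -
  have dc: "((\<lambda>t. cos (s t)) has_real_derivative - sin (s t) * s') (at t)"
    and ds: "((\<lambda>t. sin (s t)) has_real_derivative cos (s t) * s') (at t)"
    using assms(1) by (auto intro!: derivative_eq_intros)
  show ?thesis unfolding speed2_def
    by (rule DERIV_cong[OF DERIV_divide[OF DERIV_const DERIV_mult[OF DERIV_power_rel[OF dc] DERIV_power_rel[OF ds]]]])
       (use assms in \<open>simp_all add: divide_simps, simp add: algebra_simps\<close>)
qed

lemma DERIV_radial_energy:
  assumes "(s has_real_derivative s') (at t)" "cos (s t) \<noteq> 0" "sin (s t) \<noteq> 0"
  shows "((\<lambda>t. radial_energy k1 k2 C c (s t)) has_real_derivative
     2 * radial_force k1 k2 C c (s t) * s') (at t)"
proof -
  have dc: "((\<lambda>t. cos (s t)) has_real_derivative - sin (s t) * s') (at t)"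
    and ds: "((\<lambda>t. sin (s t)) has_real_derivative cos (s t) * s') (at t)"
    using assms(1) by (auto intro!: derivative_eq_intros)
  define m1 where "m1 = speed1 k1 k2 c (s t)"
  define m2 where "m2 = speed2 k1 k2 C c (s t)"
  show ?thesis unfolding radial_energy_def
    by (rule derivative_eq_intros dc ds DERIV_speed1[OF assms] DERIV_speed2[OF assms] refl)+
       (use assms(2,3) in \<open>simp add: radial_force_def divide_simps flip: m1_def m2_def,
          simp add: algebra_simps power2_eq_square\<close>)
qed

section \<open>The profile equation in rotating frames\<close>

lemma has_vector_derivative_cis:
  "(f has_real_derivative f') (at t) \<Longrightarrow> ((\<lambda>t. cis (f t)) has_vector_derivative f' *\<^sub>R (\<i> * cis (f t))) (at t)"
  by (auto simp: has_vector_derivative_complex_iff intro!: derivative_eq_intros)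

text \<open>In the frame rotating with angular speed m the derivative of x + i y gains the term i m
  (x + i y). The hypotheses \<open>re\<close> and \<open>im\<close> say that the weighted result is
  radial; with g the modulus of a component of the curve, the derivative is R times that
  component.\<close>

lemma has_vector_derivative_frame:
  assumes "(\<beta> has_real_derivative \<beta>') (at t)" "(x has_real_derivative x') (at t)"
    "(y has_real_derivative y') (at t)" "(\<phi> has_real_derivative m) (at t)"
    and re: "\<beta> t * (x' - y t * m) + \<beta>' * x t = R * g" and im: "\<beta> t * (y' + x t * m) + \<beta>' * y t = 0"
  shows "((\<lambda>t. \<beta> t *\<^sub>R (Complex (x t) (y t) * cis (\<phi> t))) has_vector_derivative
           R *\<^sub>R g *\<^sub>R cis (\<phi> t)) (at t)"
proof -
  have C: "((\<lambda>t. Complex (x t) (y t)) has_vector_derivative Complex x' y') (at t)"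
    using assms(2,3) by (simp add: has_vector_derivative_complex_iff)
  note mult = has_vector_derivative_mult[OF C has_vector_derivative_cis[OF assms(4)]]
  have "\<beta> t *\<^sub>R (Complex (x t) (y t) * (m *\<^sub>R (\<i> * cis (\<phi> t))) + Complex x' y' * cis (\<phi> t))
      + \<beta>' *\<^sub>R (Complex (x t) (y t) * cis (\<phi> t))
    = Complex (\<beta> t * (x' - y t * m) + \<beta>' * x t) (\<beta> t * (y' + x t * m) + \<beta>' * y t) * cis (\<phi> t)"
    by (simp add: complex_eq_iff algebra_simps)
  also have "\<dots> = R *\<^sub>R g *\<^sub>R cis (\<phi> t)"
    unfolding re im by (simp add: complex_eq_iff)
  finally show ?thesis
    using has_vector_derivative_scaleR[OF assms(1) mult] by simp
qed

text \<open>The real part of the profile equation for the first component, divided by w a^k1 b^k2.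
  Here p stands for ds/dt, \<open>K\<close> for its derivative, and \<open>M1\<close>,
  \<open>M2\<close> are the shares of the two rotations in the squared unit speed, so p^2 = 1 - M1 -
  M2.\<close>

lemma radial_balance1:
  fixes a b :: real
  assumes ab: "a > 0" "b > 0" "a * a + b * b = 1"
    and pp: "p * p = 1 - a * a * (m1 * m1) - b * b * (m2 * m2)"
    and K: "K = - (a * a * (m1 * m1) * ((k1 + 1) * b / a - k2 * a / b)
        + b * b * (m2 * m2) * (k1 * b / a - (k2 + 1) * a / b))"
  shows "- (a * m1 * m1) - a * (p * p) - b * K + (k1 * b / a - k2 * a / b) * b * (p * p)
     = (k1 / (a * a) - (k1 + k2 + 1)) * a"
proof -
  \<comment> \<open>With b^2 = 1 - a^2 every quotient reduces to q, since b^2 / a = q - a; what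
    remains is a polynomial identity.\<close>
  define q where "q = 1 / a"
  define M1 where "M1 = a * a * (m1 * m1)"
  define M2 where "M2 = b * b * (m2 * m2)"
  have bb: "b * b = 1 - a * a" using ab by simp
  have q: "b * b / a = q - a" "b * b * X / a = X * (q - a)" for X
    using ab by (simp_all add: bb q_def field_simps)
  have bK: "b * K = - (M1 * ((k1 + 1) * (q - a) - k2 * a) + M2 * (k1 * (q - a) - (k2 + 1) * a))"
  proof -
    have "b * K = - (M1 * ((k1 + 1) * (b * b / a) - k2 * a) + M2 * (k1 * (b * b / a) - (k2 + 1) * a))"
      unfolding K M1_def[symmetric] M2_def[symmetric] using ab by (simp add: field_simps)
    then show ?thesis by (simp add: q)
  qed
  have c: "(k1 * b / a - k2 * a / b) * b = k1 * (q - a) - k2 * a"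
  proof -
    have "(k1 * b / a - k2 * a / b) * b = k1 * (b * b / a) - k2 * a"
      using ab by (simp add: field_simps)
    then show ?thesis by (simp add: q)
  qed
  have m: "a * m1 * m1 = M1 * q" "k1 / (a * a) * a = k1 * q"
    using ab by (simp_all add: M1_def q_def)
  have p: "p * p = 1 - M1 - M2" unfolding pp M1_def M2_def ..
  have r: "(k1 / (a * a) - (k1 + k2 + 1)) * a = k1 * q - (k1 + k2 + 1) * a"
    unfolding left_diff_distrib m ..
  show ?thesis
    unfolding r m(1) bK c p by (simp add: algebra_simps)
qed

text \<open>Replacing s by pi/2 - s exchanges the two components and reverses the sign of
  \<open>K\<close>, while p enters only through its square.\<close>

lemma radial_balance2:
  fixes a b :: real
  assumes ab: "a > 0" "b > 0" "a * a + b * b = 1"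
    and pp: "p * p = 1 - a * a * (m1 * m1) - b * b * (m2 * m2)"
    and K: "K = - (a * a * (m1 * m1) * ((k1 + 1) * b / a - k2 * a / b)
        + b * b * (m2 * m2) * (k1 * b / a - (k2 + 1) * a / b))"
  shows "- (b * m2 * m2) - b * (p * p) + a * K + (- k1 * b / a + k2 * a / b) * a * (p * p)
     = (k2 / (b * b) - (k1 + k2 + 1)) * b"
proof -
  have "- K = - (b * b * (m2 * m2) * ((k2 + 1) * a / b - k1 * b / a)
        + a * a * (m1 * m1) * (k2 * a / b - (k1 + 1) * b / a))"
    unfolding K by (simp add: algebra_simps add_divide_distrib diff_divide_distrib)
  moreover have "b * b + a * a = 1" "p * p = 1 - b * b * (m2 * m2) - a * a * (m1 * m1)"
    using ab pp by simp_all
  ultimately have "- (b * m2 * m2) - b * (p * p) - a * (- K) + (k2 * a / b - k1 * b / a) * a * (p * p)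
     = (k2 / (b * b) - (k2 + k1 + 1)) * b"
    using radial_balance1[OF ab(2,1)] by blast
  then show ?thesis by (simp add: add.commute)
qed

text \<open>With \<open>w = 1\<close> the parameter is arc length and \<open>p = ds/dt\<close>; the factor \<open>w\<close> allows for
  local solutions, whose parameter is \<open>s\<close> itself.\<close>

lemma minimal_profile_of_motion:
  assumes s: "\<And>t. t \<in> I \<Longrightarrow> 0 < s t \<and> s t < pi / 2"
    and w: "\<And>t. t \<in> I \<Longrightarrow> w t > 0"
    and ds: "\<And>t. t \<in> I \<Longrightarrow> (s has_real_derivative w t * p t) (at t)"
    and dp: "\<And>t. t \<in> I \<Longrightarrow> (p has_real_derivative w t * radial_force k1 k2 C c (s t)) (at t)"
    and energy: "\<And>t. t \<in> I \<Longrightarrow> (p t)\<^sup>2 = radial_energy k1 k2 C c (s t)"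
    and ds1: "\<And>t. t \<in> I \<Longrightarrow> (s1 has_real_derivative w t * speed1 k1 k2 c (s t)) (at t)"
    and ds2: "\<And>t. t \<in> I \<Longrightarrow> (s2 has_real_derivative w t * speed2 k1 k2 C c (s t)) (at t)"
  shows "minimal_profile k1 k2 I (S3_curve s s1 s2)"
proof -
  \<comment> \<open>In the rotating frame the real part is the derivative of the modulus and the
    imaginary part is modulus times angular speed, both taken by arc length.\<close>
  define E1 where "E1 t = Complex (- sin (s t) * p t) (cos (s t) * speed1 k1 k2 c (s t)) * cis (s1 t)" for t
  define E2 where "E2 t = Complex (cos (s t) * p t) (sin (s t) * speed2 k1 k2 C c (s t)) * cis (s2 t)" for t
  have g1: "fst (S3_curve s s1 s2 t) = cos (s t) *\<^sub>R cis (s1 t)" for t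
    by (simp add: S3_curve_def cis_conv_exp scaleR_conv_of_real)
  have g2: "snd (S3_curve s s1 s2 t) = sin (s t) *\<^sub>R cis (s2 t)" for t
    by (simp add: S3_curve_def cis_conv_exp scaleR_conv_of_real)
  show ?thesis
    unfolding minimal_profile_def g1 g2
  proof (rule exI[of _ "\<lambda>t. cos (s t)"], rule exI[of _ "\<lambda>t. sin (s t)"], rule exI[of _ w],
      rule exI[of _ E1], rule exI[of _ E2], intro ballI conjI)
    fix t assume t: "t \<in> I"
    show a: "cos (s t) > 0" using s[OF t] by (intro cos_gt_zero) auto
    show b: "sin (s t) > 0" using s[OF t] by (intro sin_gt_zero) auto
    show "w t > 0" using w[OF t] .
    show "cmod (cos (s t) *\<^sub>R cis (s1 t)) = cos (s t)" "cmod (sin (s t) *\<^sub>R cis (s2 t)) = sin (s t)"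
      using a b by (simp_all add: norm_mult)
    have dc: "((\<lambda>t. cos (s t)) has_real_derivative - sin (s t) * (w t * p t)) (at t)"
      and dsn: "((\<lambda>t. sin (s t)) has_real_derivative cos (s t) * (w t * p t)) (at t)"
      using ds[OF t] by (auto intro!: derivative_eq_intros)
    note c1 = has_vector_derivative_cis[OF ds1[OF t]] and c2 = has_vector_derivative_cis[OF ds2[OF t]]
    show "((\<lambda>t. cos (s t) *\<^sub>R cis (s1 t)) has_vector_derivative w t *\<^sub>R E1 t) (at t)"
      by (rule has_vector_derivative_eq_rhs[OF has_vector_derivative_scaleR[OF dc c1]])
         (simp add: E1_def complex_eq_iff algebra_simps)
    show "((\<lambda>t. sin (s t) *\<^sub>R cis (s2 t)) has_vector_derivative w t *\<^sub>R E2 t) (at t)"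
      by (rule has_vector_derivative_eq_rhs[OF has_vector_derivative_scaleR[OF dsn c2]])
         (simp add: E2_def complex_eq_iff algebra_simps)
    have sc: "(sin (s t))\<^sup>2 = 1 - (cos (s t))\<^sup>2" by (simp add: sin_squared_eq)
    have "(cmod (E1 t))\<^sup>2 + (cmod (E2 t))\<^sup>2 =
       (sin (s t))\<^sup>2 * (p t)\<^sup>2 + (cos (s t))\<^sup>2 * (p t)\<^sup>2 + (cos (s t))\<^sup>2 * (speed1 k1 k2 c (s t))\<^sup>2 + (sin (s t))\<^sup>2 * (speed2 k1 k2 C c (s t))\<^sup>2"
      by (simp add: E1_def E2_def norm_mult power_mult_distrib cmod_power2 algebra_simps)
    also have "\<dots> = 1"
      unfolding distrib_right[symmetric] sin_cos_squared_add energy[OF t] radial_energy_def by simp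
    finally show "(cmod (E1 t))\<^sup>2 + (cmod (E2 t))\<^sup>2 = 1" .
    define a where "a = cos (s t)"
    define b where "b = sin (s t)"
    define m1 where "m1 = speed1 k1 k2 c (s t)"
    define m2 where "m2 = speed2 k1 k2 C c (s t)"
    have ab: "a > 0" "b > 0" "a * a + b * b = 1"
      using a b sc by (auto simp: a_def b_def power2_eq_square)
    have dbeta: "((\<lambda>t. cos (s t) ^ k1 * sin (s t) ^ k2) has_real_derivative
        a ^ k1 * b ^ k2 * (- real k1 * b / a + real k2 * a / b) * (w t * p t)) (at t)"
      by (rule DERIV_cong[OF DERIV_mult[OF DERIV_power_rel[OF dc] DERIV_power_rel[OF dsn]]])
         (use a b in \<open>simp_all add: a_def b_def algebra_simps\<close>)
    have nz: "cos (s t) \<noteq> 0" "sin (s t) \<noteq> 0" using a b by simp_all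
    note d1 = DERIV_speed1[OF ds[OF t] nz, of k1 k2 c] and d2 = DERIV_speed2[OF ds[OF t] nz, of k1 k2 C c]
    have pp: "p t * p t = 1 - a * a * (m1 * m1) - b * b * (m2 * m2)"
      using energy[OF t] by (simp add: radial_energy_def a_def b_def m1_def m2_def power2_eq_square)
    have kap: "radial_force k1 k2 C c (s t) = - (a * a * (m1 * m1) * ((real k1 + 1) * b / a - real k2 * a / b)
        + b * b * (m2 * m2) * (real k1 * b / a - (real k2 + 1) * a / b))"
      by (simp add: radial_force_def a_def b_def m1_def m2_def power2_eq_square)
    define K where "K = radial_force k1 k2 C c (s t)"
    note kap' = kap[folded K_def]
    have dx1: "((\<lambda>t. - sin (s t) * p t) has_real_derivative - (w t * (a * (p t * p t) + b * K))) (at t)"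
      by (rule DERIV_cong[OF DERIV_mult[OF DERIV_minus[OF dsn] dp[OF t]]])
         (simp add: a_def b_def K_def algebra_simps)
    have dy1: "((\<lambda>t. cos (s t) * speed1 k1 k2 c (s t)) has_real_derivative
        w t * (m1 * p t) * (- b + a * ((real k1 + 2) * b / a - real k2 * a / b))) (at t)"
      by (rule DERIV_cong[OF DERIV_mult[OF dc d1]]) (simp add: a_def b_def m1_def algebra_simps)
    have dx2: "((\<lambda>t. cos (s t) * p t) has_real_derivative w t * (- b * (p t * p t) + a * K)) (at t)"
      by (rule DERIV_cong[OF DERIV_mult[OF dc dp[OF t]]])
         (simp add: a_def b_def K_def algebra_simps)
    have dy2: "((\<lambda>t. sin (s t) * speed2 k1 k2 C c (s t)) has_real_derivative
        w t * (m2 * p t) * (a + b * (real k1 * b / a - (real k2 + 2) * a / b))) (at t)"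
      by (rule DERIV_cong[OF DERIV_mult[OF dsn d2]]) (simp add: a_def b_def m2_def algebra_simps)
    define \<beta> where "\<beta> = a ^ k1 * b ^ k2"
    show "((\<lambda>t. (cos (s t) ^ k1 * sin (s t) ^ k2) *\<^sub>R E1 t) has_vector_derivative
       (w t * (cos (s t) ^ k1 * sin (s t) ^ k2) * (real k1 / (cos (s t))\<^sup>2 - real (k1 + k2 + 1))) *\<^sub>R
         cos (s t) *\<^sub>R cis (s1 t)) (at t)"
      unfolding E1_def
    proof (rule has_vector_derivative_frame[OF dbeta dx1 dy1 ds1[OF t]];
        fold a_def b_def m1_def; fold \<beta>_def)
      have "\<beta> * (- (w t * (a * (p t * p t) + b * K)) - a * m1 * (w t * m1)) +
          \<beta> * (- real k1 * b / a + real k2 * a / b) * (w t * p t) * (- b * p t)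
        = w t * \<beta> * (- (a * m1 * m1) - a * (p t * p t) - b * K + (real k1 * b / a - real k2 * a / b) * b * (p t * p t))"
        by (simp add: algebra_simps)
      also have "\<dots> = w t * \<beta> * (real k1 / a\<^sup>2 - real (k1 + k2 + 1)) * a"
        unfolding radial_balance1[OF ab pp kap'] by (simp add: power2_eq_square)
      finally show "\<beta> * (- (w t * (a * (p t * p t) + b * K)) - a * m1 * (w t * m1)) +
          \<beta> * (- real k1 * b / a + real k2 * a / b) * (w t * p t) * (- b * p t)
        = w t * \<beta> * (real k1 / a\<^sup>2 - real (k1 + k2 + 1)) * a" .
      \<comment> \<open>This is conservation of angular momentum: \<beta> a^2 m1 has the constant
        value c. For the second component the constant is \<beta> b^2 m2 = C c.\<close>
      show "\<beta> * (w t * (m1 * p t) * (- b + a * ((real k1 + 2) * b / a - real k2 * a / b)) + - b * p t * (w t * m1)) +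
          \<beta> * (- real k1 * b / a + real k2 * a / b) * (w t * p t) * (a * m1) = 0"
        using ab(1,2) by (simp add: field_simps)
    qed
    show "((\<lambda>t. (cos (s t) ^ k1 * sin (s t) ^ k2) *\<^sub>R E2 t) has_vector_derivative
       (w t * (cos (s t) ^ k1 * sin (s t) ^ k2) * (real k2 / (sin (s t))\<^sup>2 - real (k1 + k2 + 1))) *\<^sub>R
         sin (s t) *\<^sub>R cis (s2 t)) (at t)"
      unfolding E2_def
    proof (rule has_vector_derivative_frame[OF dbeta dx2 dy2 ds2[OF t]];
        fold a_def b_def m2_def; fold \<beta>_def)
      have "\<beta> * (w t * (- b * (p t * p t) + a * K) - b * m2 * (w t * m2)) +
          \<beta> * (- real k1 * b / a + real k2 * a / b) * (w t * p t) * (a * p t)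
        = w t * \<beta> * (- (b * m2 * m2) - b * (p t * p t) + a * K + (- real k1 * b / a + real k2 * a / b) * a * (p t * p t))"
        by (simp add: algebra_simps)
      also have "\<dots> = w t * \<beta> * (real k2 / b\<^sup>2 - real (k1 + k2 + 1)) * b"
        unfolding radial_balance2[OF ab pp kap'] by (simp add: power2_eq_square)
      finally show "\<beta> * (w t * (- b * (p t * p t) + a * K) - b * m2 * (w t * m2)) +
          \<beta> * (- real k1 * b / a + real k2 * a / b) * (w t * p t) * (a * p t)
        = w t * \<beta> * (real k2 / b\<^sup>2 - real (k1 + k2 + 1)) * b" .
      show "\<beta> * (w t * (m2 * p t) * (a + b * (real k1 * b / a - (real k2 + 2) * a / b)) + a * p t * (w t * m2)) +
          \<beta> * (- real k1 * b / a + real k2 * a / b) * (w t * p t) * (b * m2) = 0"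
        using ab(1,2) by (simp add: field_simps)
    qed
  qed
qed

section \<open>The three types of solution curves\<close>

text \<open>Putting both rotation terms over a common denominator gives the numerator sin^2 + C1^2
  cos^2 = 1 + (C1^2 - 1) cos^2. The quotient is the function minimized by steady solutions, divided
  by C2.\<close>

lemma radial_energy_eq:
  assumes x: "0 < x" "x < pi / 2" and c: "c\<^sup>2 * C2 = 1"
  shows "radial_energy k1 k2 C1 c x =
     1 - (1 + (C1\<^sup>2 - 1) * (cos x)\<^sup>2) / (C2 * (cos x ^ (2 * k1 + 2) * sin x ^ (2 * k2 + 2)))"
proof -
  define A where "A = cos x ^ k1 * sin x ^ k2"
  define a where "a = cos x"
  define b where "b = sin x"
  have nz: "a \<noteq> 0" "b \<noteq> 0" "A \<noteq> 0" "C2 \<noteq> 0" "c \<noteq> 0"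
    using x c cos_gt_zero[of x] sin_gt_zero[of x] by (auto simp: A_def a_def b_def)
  have b2: "b\<^sup>2 = 1 - a\<^sup>2" by (simp add: a_def b_def sin_squared_eq)
  have C2: "C2 = 1 / c\<^sup>2" using c nz by (simp add: field_simps)
  have "speed1 k1 k2 c x = c / (A * a\<^sup>2)" "speed2 k1 k2 C1 c x = C1 * c / (A * b\<^sup>2)"
    "cos x ^ (2 * k1 + 2) * sin x ^ (2 * k2 + 2) = A\<^sup>2 * a\<^sup>2 * b\<^sup>2"
    by (simp_all add: speed1_def speed2_def A_def a_def b_def power_add power_mult power2_eq_square
        power_mult_distrib ac_simps)
  then have "radial_energy k1 k2 C1 c x = 1 - a\<^sup>2 * (c / (A * a\<^sup>2))\<^sup>2 - b\<^sup>2 * (C1 * c / (A * b\<^sup>2))\<^sup>2"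
    by (simp add: radial_energy_def a_def b_def)
  also have "\<dots> = 1 - (b\<^sup>2 + C1\<^sup>2 * a\<^sup>2) / (C2 * (A\<^sup>2 * a\<^sup>2 * b\<^sup>2))"
    unfolding C2 using nz by (simp add: field_simps power2_eq_square)
  also have "b\<^sup>2 + C1\<^sup>2 * a\<^sup>2 = 1 + (C1\<^sup>2 - 1) * a\<^sup>2" by (simp add: b2 algebra_simps)
  finally show ?thesis
    using \<open>cos x ^ (2 * k1 + 2) * sin x ^ (2 * k2 + 2) = A\<^sup>2 * a\<^sup>2 * b\<^sup>2\<close> by (simp add: a_def)
qed

text \<open>Explains the origin of P: up to a positive factor it is (ds/dt)^2, so ds/dt can vanish
  only at endpoints of J, and the square root of P contains the absolute value of ds/dt.\<close>

lemma P_fun_eq_radial_energy: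
  assumes x: "0 < x" "x < pi / 2" and c: "c\<^sup>2 * C2 = 1"
  shows "P_fun k1 k2 C1 C2 x = C2 * (cos x ^ (k1 + 1) * sin x ^ (k2 + 1))\<^sup>2 * radial_energy k1 k2 C1 c x"
proof -
  have "cos x \<noteq> 0" "sin x \<noteq> 0" "C2 \<noteq> 0" using x c cos_gt_zero[of x] sin_gt_zero[of x] by auto
  moreover have "(cos x ^ (k1 + 1) * sin x ^ (k2 + 1))\<^sup>2 = cos x ^ (2 * k1 + 2) * sin x ^ (2 * k2 + 2)"
    using power_mult[of "cos x" "k1 + 1" 2] power_mult[of "sin x" "k2 + 1" 2]
    by (simp add: power_mult_distrib mult.commute)
  ultimately show ?thesis
    unfolding radial_energy_eq[OF assms] P_fun_def by (simp add: field_simps)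
qed

text \<open>As s itself is the parameter, it increases, so ds/dt_arc is the positive root p of the
  energy and the speed is w = 1 / p. The sign \<epsilon> goes into c, that is, into both angular
  momenta.\<close>

lemma local_solution_minimal_profile:
  assumes I: "open I" and C2: "C2 > 0" and sol: "local_solution k1 k2 C1 C2 I s s1 s2"
  shows "minimal_profile k1 k2 I (S3_curve s s1 s2)"
proof -
  obtain \<epsilon> where IJ: "I \<subseteq> J_set k1 k2 C1 C2" and st: "\<And>t. t \<in> I \<Longrightarrow> s t = t" and e: "\<epsilon> \<in> {1, - 1}"
    and d: "\<And>t. t \<in> I \<Longrightarrow> (s1 has_real_derivative \<epsilon> * (tan t / sqrt (P_fun k1 k2 C1 C2 t))) (at t)"
      "\<And>t. t \<in> I \<Longrightarrow> (s2 has_real_derivative \<epsilon> * (C1 * cot t / sqrt (P_fun k1 k2 C1 C2 t))) (at t)"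
    using sol unfolding local_solution_def by blast
  define c where "c = \<epsilon> / sqrt C2"
  have c: "c\<^sup>2 * C2 = 1" using e C2 by (auto simp: c_def power_divide)
  define p where "p t = sqrt (radial_energy k1 k2 C1 c t)" for t
  have J: "0 < t" "t < pi / 2" "P_fun k1 k2 C1 C2 t > 0" if "t \<in> I" for t
    using IJ that by (auto simp: J_set_def)
  have pos: "cos t > 0" "sin t > 0" "radial_energy k1 k2 C1 c t > 0" "p t > 0" if "t \<in> I" for t
  proof -
    show "cos t > 0" "sin t > 0" using J[OF that] by (auto intro: cos_gt_zero sin_gt_zero)
    show "radial_energy k1 k2 C1 c t > 0"
      using J(3)[OF that] C2 unfolding P_fun_eq_radial_energy[OF J(1,2)[OF that] c]
      by (meson less_imp_le mult_nonneg_nonpos mult_nonneg_nonneg not_le zero_le_power2)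
    then show "p t > 0" by (simp add: p_def)
  qed
  have sP: "sqrt (P_fun k1 k2 C1 C2 t) = sqrt C2 * (cos t ^ (k1 + 1) * sin t ^ (k2 + 1)) * p t" if "t \<in> I" for t
    using pos[OF that] unfolding P_fun_eq_radial_energy[OF J(1,2)[OF that] c] p_def
    by (simp add: real_sqrt_mult abs_mult)
  show ?thesis
  proof (rule minimal_profile_of_motion[where w = "\<lambda>t. 1 / p t" and p = p and C = C1 and c = c])
    fix t assume t: "t \<in> I"
    note pt = pos[OF t]
    show "0 < s t \<and> s t < pi / 2" "1 / p t > 0" using st t J pt by auto
    have "(s has_real_derivative 1) (at t)"
      by (rule has_field_derivative_transform_within_open[OF DERIV_ident I t]) (simp add: st)
    then show "(s has_real_derivative 1 / p t * p t) (at t)" using pt by simp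
    have "((\<lambda>t. radial_energy k1 k2 C1 c t) has_real_derivative 2 * radial_force k1 k2 C1 c t * 1) (at t)"
      by (rule DERIV_radial_energy[OF DERIV_ident]) (use pt in auto)
    from DERIV_chain2[OF DERIV_real_sqrt[OF pt(3)] this]
    show "(p has_real_derivative 1 / p t * radial_force k1 k2 C1 c (s t)) (at t)"
      unfolding p_def st[OF t] by (simp add: field_simps)
    show "(p t)\<^sup>2 = radial_energy k1 k2 C1 c (s t)"
      using pt st[OF t] by (simp add: p_def)
    have "\<epsilon> * (tan t / sqrt (P_fun k1 k2 C1 C2 t)) = 1 / p t * speed1 k1 k2 c (s t)"
      unfolding sP[OF t] st[OF t] using pt C2 by (simp add: speed1_def c_def tan_def field_simps)
    then show "(s1 has_real_derivative 1 / p t * speed1 k1 k2 c (s t)) (at t)" using d(1)[OF t] by simp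
    have "\<epsilon> * (C1 * cot t / sqrt (P_fun k1 k2 C1 C2 t)) = 1 / p t * speed2 k1 k2 C1 c (s t)"
      unfolding sP[OF t] st[OF t] using pt C2 by (simp add: speed2_def c_def cot_def field_simps)
    then show "(s2 has_real_derivative 1 / p t * speed2 k1 k2 C1 c (s t)) (at t)" using d(2)[OF t] by simp
  qed
qed

text \<open>For constant s the equation (ds/dt)^2 = R(s) says only R(s0) = 0. The second order
  equation requires R'(s0) = 0 as well, which is the critical point condition at the interior
  minimum of Q.\<close>

lemma steady_solution_minimal_profile:
  assumes I: "open I" and C2: "C2 > 0" and sol: "steady_solution k1 k2 C1 C2 I s s1 s2"
  shows "minimal_profile k1 k2 I (S3_curve s s1 s2)"
proof -
  define Q where "Q x = (1 + (C1\<^sup>2 - 1) * (cos x)\<^sup>2) / (cos x ^ (2 * k1 + 2) * sin x ^ (2 * k2 + 2))" for x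
  obtain s0 \<sigma> where s0: "is_arg_min Q (\<lambda>s. s \<in> {0<..<pi/2}) s0" "C2 = Q s0"
    and st: "\<And>t. t \<in> I \<Longrightarrow> s t = s0" and e: "\<sigma> \<in> {1, - 1}"
    and d: "\<And>t. t \<in> I \<Longrightarrow> (s1 has_real_derivative \<sigma> * (1 / (sqrt C2 * cos s0 ^ (k1 + 2) * sin s0 ^ k2))) (at t)"
      "\<And>t. t \<in> I \<Longrightarrow> (s2 has_real_derivative \<sigma> * (C1 / (sqrt C2 * cos s0 ^ k1 * sin s0 ^ (k2 + 2)))) (at t)"
    using sol unfolding steady_solution_def Let_def Q_def[abs_def] by blast
  define c where "c = \<sigma> / sqrt C2"
  have c: "c\<^sup>2 * C2 = 1" using e C2 by (auto simp: c_def power_divide)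
  have s0': "0 < s0" "s0 < pi / 2" and min: "\<And>x. 0 < x \<Longrightarrow> x < pi / 2 \<Longrightarrow> Q s0 \<le> Q x"
    using s0(1) by (auto simp: is_arg_min_linorder)
  have RQ: "radial_energy k1 k2 C1 c x = 1 - Q x / C2" if "0 < x" "x < pi / 2" for x
    using radial_energy_eq[OF that c] by (simp add: Q_def mult.commute)
  have "((\<lambda>t. radial_energy k1 k2 C1 c t) has_real_derivative 2 * radial_force k1 k2 C1 c s0 * 1) (at s0)"
    by (rule DERIV_radial_energy[OF DERIV_ident]) (use s0' cos_gt_zero[of s0] sin_gt_zero[of s0] in auto)
  then have "2 * radial_force k1 k2 C1 c s0 * 1 = 0"
  proof (rule DERIV_local_max)
    \<comment> \<open>This radius keeps the comparison points inside (0, pi/2), where minimality of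
      Q is known.\<close>
    show "0 < min s0 (pi / 2 - s0)" using s0' by simp
    show "\<forall>y. \<bar>s0 - y\<bar> < min s0 (pi / 2 - s0) \<longrightarrow> radial_energy k1 k2 C1 c y \<le> radial_energy k1 k2 C1 c s0"
    proof (intro allI impI)
      fix y assume "\<bar>s0 - y\<bar> < min s0 (pi / 2 - s0)"
      then have y: "0 < y" "y < pi / 2" by (auto simp: abs_if split: if_splits)
      show "radial_energy k1 k2 C1 c y \<le> radial_energy k1 k2 C1 c s0"
        unfolding RQ[OF y] RQ[OF s0'] using min[OF y] C2 by (simp add: divide_right_mono)
    qed
  qed
  then have force: "radial_force k1 k2 C1 c s0 = 0" by simp
  show ?thesis
  proof (rule minimal_profile_of_motion[where w = "\<lambda>t. 1" and p = "\<lambda>t. 0" and C = C1 and c = c])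
    fix t assume t: "t \<in> I"
    show "0 < s t \<and> s t < pi / 2" using st[OF t] s0' by simp
    show "(s has_real_derivative 1 * 0) (at t)"
      by (rule has_field_derivative_transform_within_open[OF _ I t, of "\<lambda>_. s0"]) (simp_all add: st)
    show "((\<lambda>t. 0) has_real_derivative 1 * radial_force k1 k2 C1 c (s t)) (at t)"
      using force st[OF t] by simp
    show "0\<^sup>2 = radial_energy k1 k2 C1 c (s t)"
      unfolding st[OF t] RQ[OF s0'] using s0(2) C2 by simp
    show "(s1 has_real_derivative 1 * speed1 k1 k2 c (s t)) (at t)"
      using d(1)[OF t] st[OF t] by (simp add: speed1_def c_def mult.assoc)
    show "(s2 has_real_derivative 1 * speed2 k1 k2 C1 c (s t)) (at t)"
      using d(2)[OF t] st[OF t] by (simp add: speed2_def c_def mult.assoc mult.commute)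
  qed simp
qed

text \<open>Carries identities between continuous functions across the junctions of an assembled
  curve.\<close>

lemma continuous_eq_off_isolated:
  fixes f g :: "real \<Rightarrow> real"
  assumes I: "open I" and T: "\<And>t. t \<in> I \<Longrightarrow> \<forall>\<^sub>F t' in at t. t' \<notin> T"
    and f: "continuous_on I f" and g: "continuous_on I g"
    and eq: "\<And>t. t \<in> I - T \<Longrightarrow> f t = g t" and t: "t \<in> I"
  shows "f t = g t"
proof -
  have "(f \<longlongrightarrow> f t) (at t)" "(g \<longlongrightarrow> g t) (at t)"
    using f g I t by (auto simp: continuous_on_eq_continuous_at isCont_def)
  moreover have "\<forall>\<^sub>F t' in at t. f t' = g t'"
    using T[OF t] eventually_at_in_open'[OF I t] by eventually_elim (use eq in auto)
  ultimately show ?thesis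
    using tendsto_cong tendsto_unique[OF trivial_limit_at] by blast
qed

text \<open>L'Hopital's rule applied to the difference quotient: a differential equation valid
  around a junction extends to it when both sides are continuous there.\<close>

lemma DERIV_at_isolated:
  fixes f :: "real \<Rightarrow> real"
  assumes "isCont f t" "\<forall>\<^sub>F x in at t. (f has_real_derivative f' x) (at x)" "isCont f' t"
  shows "(f has_real_derivative f' t) (at t)"
proof -
  have "((\<lambda>x. (f x - f t) / (x - t)) \<longlongrightarrow> f' t) (at t)"
  proof (rule lhopital)
    show "((\<lambda>x. f x - f t) \<longlongrightarrow> 0) (at t)"
      using assms(1) by (simp add: isCont_def LIM_zero)
    show "((\<lambda>x. x - t) \<longlongrightarrow> 0) (at t)" by (intro LIM_zero tendsto_ident_at)
    show "\<forall>\<^sub>F x in at t. x - t \<noteq> 0" by (simp add: eventually_at_filter)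
    show "\<forall>\<^sub>F x in at t. ((\<lambda>x. f x - f t) has_real_derivative f' x) (at x)"
      using assms(2) by eventually_elim (auto intro!: derivative_eq_intros)
    show "\<forall>\<^sub>F x in at t. ((\<lambda>x. x - t) has_real_derivative 1) (at x)"
      by (intro always_eventually allI) (auto intro!: derivative_eq_intros)
    show "((\<lambda>x. f' x / 1) \<longlongrightarrow> f' t) (at t)" using assms(3) by (simp add: isCont_def)
  qed simp
  then show ?thesis by (simp add: has_field_derivative_iff)
qed

text \<open>By continuity \<open>f\<close> keeps its sign near \<open>t\<close>, so it is a fixed
  sign times the square root of \<open>g\<close>, which is differentiable because g t > 0.\<close>

lemma DERIV_of_square:
  fixes f :: "real \<Rightarrow> real"
  assumes f: "isCont f t" "f t \<noteq> 0"
    and sq: "\<forall>\<^sub>F x in nhds t. (f x)\<^sup>2 = g x" and g: "(g has_real_derivative 2 * k * f t) (at t)"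
  shows "(f has_real_derivative k) (at t)"
proof -
  have gt: "g t = (f t)\<^sup>2" using eventually_nhds_x_imp_x[OF sq] by simp
  then have gpos: "g t > 0" using f(2) by simp
  have "\<forall>\<^sub>F x in nhds t. f x * f t > 0"
  proof -
    have "(f \<longlongrightarrow> f t) (nhds t)" using f(1) by (simp add: isCont_def tendsto_at_iff_tendsto_nhds)
    then have "((\<lambda>x. f x * f t) \<longlongrightarrow> f t * f t) (nhds t)" by (intro tendsto_intros)
    then show ?thesis using f(2) order_tendstoD(1) by (metis not_real_square_gt_zero)
  qed
  then have ev: "\<forall>\<^sub>F x in nhds t. f x = sgn (f t) * sqrt (g x)"
    using sq
  proof eventually_elim
    case (elim x)
    have "sqrt (g x) = \<bar>f x\<bar>" using elim(2) by (metis real_sqrt_abs)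
    then show ?case using elim(1) by (auto simp: sgn_if abs_if zero_less_mult_iff)
  qed
  have "((\<lambda>x. sgn (f t) * sqrt (g x)) has_real_derivative
      sgn (f t) * (inverse (sqrt (g t)) / 2 * (2 * k * f t))) (at t)"
    by (intro DERIV_cmult DERIV_chain2[OF DERIV_real_sqrt[OF gpos] g])
  also have "sgn (f t) * (inverse (sqrt (g t)) / 2 * (2 * k * f t)) = k"
    using f(2) unfolding gt by (simp add: field_simps sgn_if)
  finally show ?thesis using DERIV_cong_ev[OF refl ev refl] by simp
qed

lemma arc_length_S3_curve:
  assumes arc: "arc_length_param I (S3_curve s s1 s2)" and t: "t \<in> I"
    and d: "(s has_real_derivative s') (at t)" "(s1 has_real_derivative m1) (at t)" "(s2 has_real_derivative m2) (at t)"
  shows "s'\<^sup>2 + (cos (s t))\<^sup>2 * m1\<^sup>2 + (sin (s t))\<^sup>2 * m2\<^sup>2 = 1"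
proof -
  have dc: "((\<lambda>t. cos (s t)) has_real_derivative - sin (s t) * s') (at t)"
    and ds: "((\<lambda>t. sin (s t)) has_real_derivative cos (s t) * s') (at t)"
    using d(1) by (auto intro!: derivative_eq_intros)
  have S3: "S3_curve s s1 s2 = (\<lambda>t. (cos (s t) *\<^sub>R cis (s1 t), sin (s t) *\<^sub>R cis (s2 t)))"
    by (simp add: S3_curve_def cis_conv_exp scaleR_conv_of_real fun_eq_iff)
  define v1 where "v1 = Complex (- sin (s t) * s') (cos (s t) * m1) * cis (s1 t)"
  define v2 where "v2 = Complex (cos (s t) * s') (sin (s t) * m2) * cis (s2 t)"
  have "((\<lambda>t. cos (s t) *\<^sub>R cis (s1 t)) has_vector_derivative v1) (at t)"
    by (rule has_vector_derivative_eq_rhs[OF has_vector_derivative_scaleR[OF dc has_vector_derivative_cis[OF d(2)]]])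
       (simp add: v1_def complex_eq_iff algebra_simps)
  moreover have "((\<lambda>t. sin (s t) *\<^sub>R cis (s2 t)) has_vector_derivative v2) (at t)"
    by (rule has_vector_derivative_eq_rhs[OF has_vector_derivative_scaleR[OF ds has_vector_derivative_cis[OF d(3)]]])
       (simp add: v2_def complex_eq_iff algebra_simps)
  ultimately have "(S3_curve s s1 s2 has_vector_derivative (v1, v2)) (at t)"
    unfolding S3 by (rule has_vector_derivative_Pair)
  then have "norm (v1, v2) = 1"
    using arc t vector_derivative_at unfolding arc_length_param_def by metis
  then have "(cmod v1)\<^sup>2 + (cmod v2)\<^sup>2 = 1"
    by (simp add: norm_prod_def)
  moreover have "(cmod v1)\<^sup>2 = (sin (s t))\<^sup>2 * s'\<^sup>2 + (cos (s t))\<^sup>2 * m1\<^sup>2"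
    "(cmod v2)\<^sup>2 = (cos (s t))\<^sup>2 * s'\<^sup>2 + (sin (s t))\<^sup>2 * m2\<^sup>2"
    by (simp_all add: v1_def v2_def norm_mult cmod_power2 power_mult_distrib)
  moreover have "(sin (s t))\<^sup>2 * s'\<^sup>2 + (cos (s t))\<^sup>2 * s'\<^sup>2 = s'\<^sup>2"
    by (simp flip: distrib_right)
  ultimately show ?thesis by linarith
qed

text \<open>The quantity \<open>cos\<^bsup>k1+2\<^esup> s sin\<^bsup>k2\<^esup> s (ds\<^sub>1/dt)\<close> takes only the values \<open>\<plusminus> 1 / \<surd>C\<^sub>2\<close> off the junctions,
  so by continuity it is constant: the sign change of \<open>\<epsilon>\<close> at a junction compensates that of \<open>ds/dt\<close>.\<close>

lemma assembled_solution_minimal_profile: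
  assumes I: "open I" "connected I" and C2: "C2 > 0" and sol: "assembled_solution k1 k2 C1 C2 I s s1 s2"
  shows "minimal_profile k1 k2 I (S3_curve s s1 s2)"
proof (cases "I = {}")
  case True
  then show ?thesis by (simp add: minimal_profile_def)
next
  case False
  have C1: "s C1_differentiable_on I" "s1 C1_differentiable_on I" "s2 C1_differentiable_on I"
    using sol unfolding assembled_solution_def by simp_all
  obtain D where D: "\<And>t. t \<in> I \<Longrightarrow> (s has_real_derivative D t) (at t)" "continuous_on I D"
    using C1(1) unfolding C1_differentiable_on_def has_real_derivative_iff_has_vector_derivative by blast
  obtain D1 where D1: "\<And>t. t \<in> I \<Longrightarrow> (s1 has_real_derivative D1 t) (at t)" "continuous_on I D1"
    using C1(2) unfolding C1_differentiable_on_def has_real_derivative_iff_has_vector_derivative by blast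
  obtain D2 where D2: "\<And>t. t \<in> I \<Longrightarrow> (s2 has_real_derivative D2 t) (at t)" "continuous_on I D2"
    using C1(3) unfolding C1_differentiable_on_def has_real_derivative_iff_has_vector_derivative by blast
  have arc: "arc_length_param I (S3_curve s s1 s2)"
    using sol unfolding assembled_solution_def by blast
  obtain T \<epsilon> where T': "\<forall>t\<in>I. \<forall>\<^sub>F t' in at t. t' \<notin> T"
    and e': "\<forall>t\<in>I - T. \<epsilon> t \<in> {1, - 1 :: real} \<and> (\<forall>\<^sub>F t' in at t. \<epsilon> t' = \<epsilon> t)"
    and sT': "\<forall>t\<in>T. s t \<in> {0<..<pi/2} \<and> s t \<in> frontier (J_set k1 k2 C1 C2)"
    and piece': "\<forall>t\<in>I - T. s t \<in> J_set k1 k2 C1 C2 \<and>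
       (\<exists>s'. s' \<noteq> 0 \<and> (s has_real_derivative s') (at t) \<and>
          (s1 has_real_derivative \<epsilon> t * (tan (s t) / sqrt (P_fun k1 k2 C1 C2 (s t))) * s') (at t) \<and>
          (s2 has_real_derivative \<epsilon> t * (C1 * cot (s t) / sqrt (P_fun k1 k2 C1 C2 (s t))) * s') (at t))"
    using sol unfolding assembled_solution_def by (elim conjE exE) (rule that; assumption)
  note T = bspec[OF T'] and e = bspec[OF e', THEN conjunct1] and sT = bspec[OF sT', THEN conjunct1]
    and piece = bspec[OF piece']
  have s: "0 < s t" "s t < pi / 2" if "t \<in> I" for t
    using that piece[of t] sT[of t] by (auto simp: J_set_def)
  have pos: "cos (s t) > 0" "sin (s t) > 0" if "t \<in> I" for t
    using s[OF that] by (auto intro: cos_gt_zero sin_gt_zero)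
  have cs: "continuous_on I s"
    using D(1) by (meson DERIV_isCont continuous_at_imp_continuous_on)
  have off: "D t \<noteq> 0" "D1 t = \<epsilon> t * (tan (s t) / sqrt (P_fun k1 k2 C1 C2 (s t))) * D t"
    "D2 t = C1 * (cot (s t))\<^sup>2 * D1 t" "P_fun k1 k2 C1 C2 (s t) > 0"
    if t: "t \<in> I - T" for t
  proof -
    obtain s' where s': "s' \<noteq> 0" "(s has_real_derivative s') (at t)"
          "(s1 has_real_derivative \<epsilon> t * (tan (s t) / sqrt (P_fun k1 k2 C1 C2 (s t))) * s') (at t)"
          "(s2 has_real_derivative \<epsilon> t * (C1 * cot (s t) / sqrt (P_fun k1 k2 C1 C2 (s t))) * s') (at t)"
      using piece[OF t] by blast
    have eq: "D t = s'" "D1 t = \<epsilon> t * (tan (s t) / sqrt (P_fun k1 k2 C1 C2 (s t))) * s'"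
      "D2 t = \<epsilon> t * (C1 * cot (s t) / sqrt (P_fun k1 k2 C1 C2 (s t))) * s'"
      using s' D(1)[of t] D1(1)[of t] D2(1)[of t] t by (auto intro: DERIV_unique)
    show "P_fun k1 k2 C1 C2 (s t) > 0" using piece[OF t] by (auto simp: J_set_def)
    show "D t \<noteq> 0" "D1 t = \<epsilon> t * (tan (s t) / sqrt (P_fun k1 k2 C1 C2 (s t))) * D t"
      using eq s' by auto
    show "D2 t = C1 * (cot (s t))\<^sup>2 * D1 t"
      using pos[of t] t unfolding eq by (simp add: cot_def tan_def power2_eq_square)
  qed
  have speed: "(D t)\<^sup>2 + (cos (s t))\<^sup>2 * (D1 t)\<^sup>2 + (sin (s t))\<^sup>2 * (D2 t)\<^sup>2 = 1" if "t \<in> I" for t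
    by (rule arc_length_S3_curve[OF arc that D(1)[OF that] D1(1)[OF that] D2(1)[OF that]])
  define h where "h t = D1 t * (cos (s t) ^ (k1 + 2) * sin (s t) ^ k2)" for t
  have ch: "continuous_on I h" unfolding h_def by (intro continuous_intros D1 cs)
  \<comment> \<open>The quotient of the two angular equations contains neither the sign nor P nor
    s', so it stays meaningful at the junctions, where P degenerates.\<close>
  have D2eq: "D2 t = C1 * (cot (s t))\<^sup>2 * D1 t" if "t \<in> I" for t
    by (rule continuous_eq_off_isolated[OF I(1) T D2(2) _ off(3) that])
       (use pos in \<open>force simp: cot_def intro!: continuous_intros cs D1\<close>)+
  have h2: "(h t)\<^sup>2 = 1 / C2" if "t \<in> I" for t
  proof (rule continuous_eq_off_isolated[OF I(1) T _ _ _ that])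
    fix t assume t: "t \<in> I - T"
    define a b P A where "a = cos (s t)" and "b = sin (s t)" and "P = P_fun k1 k2 C1 C2 (s t)"
      and "A = cos (s t) ^ k1 * sin (s t) ^ k2"
    have nz: "a > 0" "b > 0" "P > 0" "A > 0" using pos[of t] t off(4)[OF t] by (auto simp: a_def b_def P_def A_def)
    have ab: "b\<^sup>2 = 1 - a\<^sup>2" by (simp add: a_def b_def sin_squared_eq)
    have Z: "cos (s t) ^ (2 * k1 + 2) * sin (s t) ^ (2 * k2 + 2) = A\<^sup>2 * a\<^sup>2 * b\<^sup>2"
      by (simp add: A_def a_def b_def power_add power_mult power2_eq_square power_mult_distrib ac_simps)
    have "P = C2 * (A\<^sup>2 * a\<^sup>2 * b\<^sup>2) - 1 - (C1\<^sup>2 - 1) * a\<^sup>2"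
      unfolding Z[symmetric] by (simp add: P_def P_fun_def a_def)
    moreover have "1 + (C1\<^sup>2 - 1) * a\<^sup>2 = b\<^sup>2 + C1\<^sup>2 * a\<^sup>2"
      unfolding ab by (simp add: algebra_simps)
    ultimately have Peq: "P = C2 * (A\<^sup>2 * a\<^sup>2 * b\<^sup>2) - b\<^sup>2 - C1\<^sup>2 * a\<^sup>2" by linarith
    have e2: "(\<epsilon> t)\<^sup>2 = 1" using e[OF t] by auto
    have D1': "(D1 t)\<^sup>2 = b\<^sup>2 / (a\<^sup>2 * P) * (D t)\<^sup>2"
      using nz off(2)[OF t] e2 by (simp add: power_mult_distrib power_divide tan_def P_def a_def b_def)
    have "(D2 t)\<^sup>2 = (C1 * (a / b)\<^sup>2)\<^sup>2 * (D1 t)\<^sup>2"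
      using off(3)[OF t] by (simp add: power_mult_distrib cot_def a_def b_def)
    then have D2': "(D2 t)\<^sup>2 = C1\<^sup>2 * a\<^sup>2 / (b\<^sup>2 * P) * (D t)\<^sup>2"
      unfolding D1' using nz by (simp add: field_simps power2_eq_square)
    \<comment> \<open>Unit speed after inserting \<open>D1'\<close> and \<open>D2'\<close>. By the
      definition of P the bracket equals C2 A^2 a^2 b^2, so the arc length condition determines
      (ds/dt)^2 and with it the angular momentum up to sign.\<close>
    have "(D t)\<^sup>2 * (P + b\<^sup>2 + C1\<^sup>2 * a\<^sup>2) = P"
      using speed[of t] t nz unfolding D1' D2' a_def[symmetric] b_def[symmetric]
      by (simp add: field_simps)
    then have "(D t)\<^sup>2 * (C2 * (A\<^sup>2 * a\<^sup>2 * b\<^sup>2)) = P" unfolding Peq by simp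
    then have DD: "(D t)\<^sup>2 = P / (C2 * (A\<^sup>2 * a\<^sup>2 * b\<^sup>2))" using nz C2 by (simp add: field_simps)
    have "(D1 t)\<^sup>2 = 1 / (C2 * (A * a\<^sup>2)\<^sup>2)"
      unfolding D1' DD using nz C2 by (simp add: field_simps power2_eq_square)
    moreover have "h t = D1 t * (A * a\<^sup>2)"
      by (simp add: h_def A_def a_def power_add power2_eq_square)
    ultimately show "(h t)\<^sup>2 = 1 / C2" using nz C2 by (simp add: power_mult_distrib)
  qed (auto intro!: continuous_intros ch)
  \<comment> \<open>A continuous function with finitely many values on a connected set is constant;
    its value c carries one sign for the whole curve.\<close>
  have "h ` I \<subseteq> {sqrt (1 / C2), - sqrt (1 / C2)}"
  proof
    fix y assume "y \<in> h ` I"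
    then have "y\<^sup>2 = 1 / C2" using h2 by auto
    then have "\<bar>y\<bar> = sqrt (1 / C2)" by (metis real_sqrt_abs)
    then show "y \<in> {sqrt (1 / C2), - sqrt (1 / C2)}" by (auto simp: abs_if split: if_splits)
  qed
  then have "finite (h ` I)" using finite_subset by blast
  then obtain c where hc: "\<And>t. t \<in> I \<Longrightarrow> h t = c"
    using continuous_finite_range_constant[OF I(2) ch] unfolding constant_on_def by blast
  have D1c: "D1 t = speed1 k1 k2 c (s t)" if "t \<in> I" for t
    using hc[OF that] pos[OF that] by (auto simp: h_def speed1_def field_simps)
  have D2c: "D2 t = speed2 k1 k2 C1 c (s t)" if "t \<in> I" for t
    using pos[OF that] unfolding D2eq[OF that] D1c[OF that] speed1_def speed2_def
    by (simp add: cot_def field_simps power2_eq_square)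
  have energy: "(D t)\<^sup>2 = radial_energy k1 k2 C1 c (s t)" if "t \<in> I" for t
    using speed[OF that] unfolding radial_energy_def D1c[OF that] D2c[OF that] by linarith
  have dE: "((\<lambda>t. radial_energy k1 k2 C1 c (s t)) has_real_derivative 2 * radial_force k1 k2 C1 c (s t) * D t) (at t)"
    if "t \<in> I" for t
    by (rule DERIV_radial_energy[OF D(1)[OF that]]) (use pos[OF that] in auto)
  have cD: "isCont D t" if "t \<in> I" for t
    using D(2) I(1) that by (simp add: continuous_on_eq_continuous_at)
  have cforce: "isCont (\<lambda>t. radial_force k1 k2 C1 c (s t)) t" if "t \<in> I" for t
  proof -
    have "isCont s t" using D(1)[OF that] by (rule DERIV_isCont)
    then show ?thesis unfolding radial_force_def speed1_def speed2_def
      using pos[OF that] by (intro continuous_intros) auto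
  qed
  \<comment> \<open>Between junctions ds/dt is nonzero, so the energy equation can be divided by it
    after differentiation.\<close>
  have regular: "(D has_real_derivative radial_force k1 k2 C1 c (s t)) (at t)" if "t \<in> I - T" for t
  proof (rule DERIV_of_square[OF cD _ _ dE])
    show "\<forall>\<^sub>F x in nhds t. (D x)\<^sup>2 = radial_energy k1 k2 C1 c (s x)"
      using eventually_nhds_in_open[OF I(1), of t] that by (auto elim!: eventually_mono simp: energy)
  qed (use that off in auto)
  \<comment> \<open>At a junction that division may fail, but both \<open>D\<close> and the force
    are continuous and the equation holds around the point.\<close>
  have dD: "(D has_real_derivative radial_force k1 k2 C1 c (s t)) (at t)" if "t \<in> I" for t
  proof (rule DERIV_at_isolated[OF cD[OF that] _ cforce[OF that]])
    show "\<forall>\<^sub>F x in at t. (D has_real_derivative radial_force k1 k2 C1 c (s x)) (at x)"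
      using T[OF that] eventually_at_in_open'[OF I(1) that] by eventually_elim (use regular in auto)
  qed
  show ?thesis
    by (rule minimal_profile_of_motion[where w = "\<lambda>_. 1" and p = D and C = C1 and c = c])
       (use s D D1 D2 D1c D2c energy dD in auto)
qed

section \<open>Change of parameter\<close>

text \<open>The speed is multiplied by the absolute value of \<tau>', so the unit tangent acquires
  the sign of \<tau>'; the weighted equation is then the chain rule.\<close>

lemma minimal_profile_reparametrization:
  assumes K: "minimal_profile k1 k2 K \<gamma>0" and I: "open I" and \<tau>: "\<And>t. t \<in> I \<Longrightarrow> \<tau> t \<in> K"
    and d\<tau>: "\<And>t. t \<in> I \<Longrightarrow> (\<tau> has_real_derivative \<tau>' t) (at t)"
    and c\<tau>: "\<And>t. t \<in> I \<Longrightarrow> isCont \<tau>' t" and nz: "\<And>t. t \<in> I \<Longrightarrow> \<tau>' t \<noteq> 0"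
    and \<gamma>: "\<And>t. t \<in> I \<Longrightarrow> \<gamma> t = \<gamma>0 (\<tau> t)"
  shows "minimal_profile k1 k2 I \<gamma>"
proof -
  let ?N = "real (k1 + k2 + 1)"
  obtain a b w E1 E2 where prof: "\<And>t. t \<in> K \<Longrightarrow> a t > 0 \<and> b t > 0 \<and> w t > 0 \<and>
        cmod (fst (\<gamma>0 t)) = a t \<and> cmod (snd (\<gamma>0 t)) = b t \<and>
        ((\<lambda>t. fst (\<gamma>0 t)) has_vector_derivative w t *\<^sub>R E1 t) (at t) \<and>
        ((\<lambda>t. snd (\<gamma>0 t)) has_vector_derivative w t *\<^sub>R E2 t) (at t) \<and>
        (cmod (E1 t))\<^sup>2 + (cmod (E2 t))\<^sup>2 = 1 \<and>
        ((\<lambda>t. (a t ^ k1 * b t ^ k2) *\<^sub>R E1 t) has_vector_derivative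
           (w t * (a t ^ k1 * b t ^ k2) * (real k1 / (a t)\<^sup>2 - ?N)) *\<^sub>R fst (\<gamma>0 t)) (at t) \<and>
        ((\<lambda>t. (a t ^ k1 * b t ^ k2) *\<^sub>R E2 t) has_vector_derivative
           (w t * (a t ^ k1 * b t ^ k2) * (real k2 / (b t)\<^sup>2 - ?N)) *\<^sub>R snd (\<gamma>0 t)) (at t)"
    using K unfolding minimal_profile_def by blast
  have chain: "((\<lambda>t. F (\<tau> t)) has_vector_derivative \<tau>' t *\<^sub>R F') (at t)"
    if "t \<in> I" "(F has_vector_derivative F') (at (\<tau> t))" for F :: "real \<Rightarrow> complex" and F' t
    using vector_diff_chain_at[of \<tau> "\<tau>' t" t F F'] d\<tau>[OF that(1)] that(2)
    by (simp add: o_def has_real_derivative_iff_has_vector_derivative)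
  have near\<gamma>: "\<forall>\<^sub>F t' in nhds t. \<gamma> t' = \<gamma>0 (\<tau> t')" if "t \<in> I" for t
    using eventually_nhds_in_open[OF I that] by eventually_elim (rule \<gamma>)
  \<comment> \<open>The sign is locally constant, so it can be frozen at \<open>t\<close> before
    differentiating.\<close>
  have sgn: "\<forall>\<^sub>F t' in nhds t. sgn (\<tau>' t') = sgn (\<tau>' t)" if "t \<in> I" for t
  proof -
    have "(\<tau>' \<longlongrightarrow> \<tau>' t) (nhds t)"
      using c\<tau>[OF that] by (simp add: isCont_def tendsto_at_iff_tendsto_nhds)
    then have "((\<lambda>t'. \<tau>' t' * \<tau>' t) \<longlongrightarrow> \<tau>' t * \<tau>' t) (nhds t)" by (intro tendsto_intros)
    then have "\<forall>\<^sub>F t' in nhds t. \<tau>' t' * \<tau>' t > 0"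
      using nz[OF that] order_tendstoD(1) by (metis not_real_square_gt_zero)
    then show ?thesis by eventually_elim (auto simp: sgn_if zero_less_mult_iff)
  qed
  have ch: "((\<lambda>t. \<beta> (\<tau> t) *\<^sub>R (sgn (\<tau>' t) *\<^sub>R E (\<tau> t))) has_vector_derivative (w (\<tau> t) * \<bar>\<tau>' t\<bar> * R * R') *\<^sub>R z) (at t)"
    if t: "t \<in> I" and "((\<lambda>t. \<beta> t *\<^sub>R E t) has_vector_derivative (w (\<tau> t) * R * R') *\<^sub>R z) (at (\<tau> t))"
    for t z R R' and \<beta> :: "real \<Rightarrow> real" and E :: "real \<Rightarrow> complex"
  proof -
    have "((\<lambda>x. sgn (\<tau>' t) *\<^sub>R (\<beta> (\<tau> x) *\<^sub>R E (\<tau> x))) has_vector_derivative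
        sgn (\<tau>' t) *\<^sub>R (\<tau>' t *\<^sub>R ((w (\<tau> t) * R * R') *\<^sub>R z))) (at t)"
      by (rule bounded_linear.has_vector_derivative[OF bounded_linear_scaleR_right chain[OF that]])
    also have "sgn (\<tau>' t) *\<^sub>R (\<tau>' t *\<^sub>R ((w (\<tau> t) * R * R') *\<^sub>R z)) = (w (\<tau> t) * \<bar>\<tau>' t\<bar> * R * R') *\<^sub>R z"
      using nz[OF t] by (simp add: sgn_if abs_if mult.assoc mult.left_commute mult.commute)
    finally show ?thesis
    proof (rule has_vector_derivative_cong_ev[THEN iffD1, rotated 2])
      show "\<forall>\<^sub>F x in nhds t. x \<in> UNIV \<longrightarrow> sgn (\<tau>' t) *\<^sub>R \<beta> (\<tau> x) *\<^sub>R E (\<tau> x) = \<beta> (\<tau> x) *\<^sub>R sgn (\<tau>' x) *\<^sub>R E (\<tau> x)"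
        using sgn[OF t] by eventually_elim simp
    qed simp
  qed
  show ?thesis
    unfolding minimal_profile_def
  proof (rule exI[of _ "\<lambda>t. a (\<tau> t)"], rule exI[of _ "\<lambda>t. b (\<tau> t)"], rule exI[of _ "\<lambda>t. w (\<tau> t) * \<bar>\<tau>' t\<bar>"],
      rule exI[of _ "\<lambda>t. sgn (\<tau>' t) *\<^sub>R E1 (\<tau> t)"], rule exI[of _ "\<lambda>t. sgn (\<tau>' t) *\<^sub>R E2 (\<tau> t)"], intro ballI conjI)
    fix t assume t: "t \<in> I"
    note pr = prof[OF \<tau>[OF t]]
    have cong: "((\<lambda>t. f (\<gamma> t)) has_vector_derivative D) (at t)"
      if "((\<lambda>t. f (\<gamma>0 (\<tau> t))) has_vector_derivative D) (at t)" for f :: "complex \<times> complex \<Rightarrow> complex" and D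
      by (rule has_vector_derivative_cong_ev[THEN iffD2, OF _ _ that])
         (use near\<gamma>[OF t] \<gamma>[OF t] in \<open>auto elim!: eventually_mono\<close>)
    have v: "(w (\<tau> t) * \<bar>\<tau>' t\<bar>) *\<^sub>R sgn (\<tau>' t) *\<^sub>R e = \<tau>' t *\<^sub>R (w (\<tau> t) *\<^sub>R e)" for e :: complex
      by (simp add: sgn_if abs_if)
    show "((\<lambda>t. fst (\<gamma> t)) has_vector_derivative (w (\<tau> t) * \<bar>\<tau>' t\<bar>) *\<^sub>R sgn (\<tau>' t) *\<^sub>R E1 (\<tau> t)) (at t)"
      unfolding v by (rule cong, rule chain[OF t]) (use pr in blast)
    show "((\<lambda>t. snd (\<gamma> t)) has_vector_derivative (w (\<tau> t) * \<bar>\<tau>' t\<bar>) *\<^sub>R sgn (\<tau>' t) *\<^sub>R E2 (\<tau> t)) (at t)"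
      unfolding v by (rule cong, rule chain[OF t]) (use pr in blast)
    show "((\<lambda>t. (a (\<tau> t) ^ k1 * b (\<tau> t) ^ k2) *\<^sub>R sgn (\<tau>' t) *\<^sub>R E1 (\<tau> t)) has_vector_derivative
        (w (\<tau> t) * \<bar>\<tau>' t\<bar> * (a (\<tau> t) ^ k1 * b (\<tau> t) ^ k2) * (real k1 / (a (\<tau> t))\<^sup>2 - ?N)) *\<^sub>R fst (\<gamma> t)) (at t)"
      unfolding \<gamma>[OF t] by (rule ch[OF t]) (use pr in blast)
    show "((\<lambda>t. (a (\<tau> t) ^ k1 * b (\<tau> t) ^ k2) *\<^sub>R sgn (\<tau>' t) *\<^sub>R E2 (\<tau> t)) has_vector_derivative
        (w (\<tau> t) * \<bar>\<tau>' t\<bar> * (a (\<tau> t) ^ k1 * b (\<tau> t) ^ k2) * (real k2 / (b (\<tau> t))\<^sup>2 - ?N)) *\<^sub>R snd (\<gamma> t)) (at t)"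
      unfolding \<gamma>[OF t] by (rule ch[OF t]) (use pr in blast)
  qed (use prof \<tau> nz \<gamma> in \<open>auto simp: sgn_if\<close>)
qed

lemma solution_curve_minimal_profile:
  assumes "solution_curve k1 k2 I \<gamma>"
  shows "open I" "minimal_profile k1 k2 I \<gamma>"
proof -
  show I: "open I" using assms by (auto simp: solution_curve_def open_interval_def)
  obtain K \<tau> C1 C2 s s1 s2 where K: "open_interval K" and \<tau>: "smooth_reparametrization I K \<tau>" and C2: "C2 > 0"
    and \<gamma>: "\<And>t. t \<in> I \<Longrightarrow> \<gamma> t = S3_curve s s1 s2 (\<tau> t)"
    and sol: "local_solution k1 k2 C1 C2 K s s1 s2 \<or> assembled_solution k1 k2 C1 C2 K s s1 s2 \<or>
       steady_solution k1 k2 C1 C2 K s s1 s2"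
    using assms unfolding solution_curve_def by blast
  have oK: "open K" and cK: "connected K" using K by (auto simp: open_interval_def is_interval_connected)
  from sol have prof: "minimal_profile k1 k2 K (S3_curve s s1 s2)"
  proof (elim disjE)
  qed (rule local_solution_minimal_profile[OF oK C2] assembled_solution_minimal_profile[OF oK cK C2]
      steady_solution_minimal_profile[OF oK C2], assumption)+
  have diff: "(deriv ^^ m) \<tau> differentiable (at t)" if "t \<in> I" for m t
    using \<tau> that by (auto simp: smooth_reparametrization_def)
  show "minimal_profile k1 k2 I \<gamma>"
  proof (rule minimal_profile_reparametrization[OF prof I])
    fix t assume t: "t \<in> I"
    show "\<tau> t \<in> K" "deriv \<tau> t \<noteq> 0" using \<tau> t by (auto simp: smooth_reparametrization_def)
    show "(\<tau> has_real_derivative deriv \<tau> t) (at t)"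
      using diff[OF t, of 0] by (simp add: DERIV_deriv_iff_real_differentiable)
    show "isCont (deriv \<tau>) t"
      using diff[OF t, of 1] by (auto intro: differentiable_imp_continuous_within)
  qed (rule \<gamma>)
qed

section \<open>Immersions and minimality in a chart\<close>

text \<open>Finite dimension provides the projection and positivity its uniqueness, so the definite
  description is meaningful. Its products with vectors of \<open>S\<close> are what a mean curvature
  tested against normal vectors involves.\<close>

lemma inner_orthogonal_projection:
  fixes S :: "'v::euclidean_space set"
  assumes S: "subspace S" and z: "z \<in> S"
  shows "inner (orthogonal_projection S v) z = inner v z"
proof -
  obtain y y' where y: "y \<in> span S" "\<And>w. w \<in> span S \<Longrightarrow> inner y' w = 0" "v = y + y'"
    using orthogonal_subspace_decomp_exists[of S v] unfolding Linear_Algebra.orthogonal_def by blast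
  have S': "span S = S" using S by (rule span_eq_iff[THEN iffD2])
  have "orthogonal_projection S v = y"
    unfolding orthogonal_projection_def
  proof (rule the_equality)
    show "y \<in> S \<and> (\<forall>z\<in>S. inner (v - y) z = 0)"
      using y by (auto simp: S')
    fix w assume w: "w \<in> S \<and> (\<forall>z\<in>S. inner (v - w) z = 0)"
    then have "w - y \<in> S" using y S S' by (metis subspace_diff)
    then have "inner (v - w) (w - y) = 0" "inner (v - y) (w - y) = 0"
      using w y by (auto simp: S')
    then have "inner (w - y) (w - y) = 0" by (simp add: inner_diff_left)
    then show "w = y" by simp
  qed
  then show ?thesis using y z by (simp add: S' inner_add_left)
qed

text \<open>Collects the local data of a factor. For the last claim, a kernel vector of the Gram
  matrix gives a tangent vector whose image has squared norm 0, contradicting injectivity of the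
  differential.\<close>

lemma immersion_in_chart:
  assumes M: "smooth_manifold k X A" and f: "sphere_immersion k X A f" and c: "(U, \<phi>) \<in> A"
  shows "inj_on \<phi> U" "openin (Euclidean_space k) (\<phi> ` U)" "smooth_on k (\<phi> ` U) (in_chart (U, \<phi>) f)"
    "u \<in> \<phi> ` U \<Longrightarrow> norm (in_chart (U, \<phi>) f u) = 1"
    "u \<in> \<phi> ` U \<Longrightarrow> Determinant.det (gram k (in_chart (U, \<phi>) f) u) \<noteq> 0"
proof -
  have XU: "openin X U" "openin (Euclidean_space k) (\<phi> ` U)"
    "homeomorphic_map (subtopology X U) (subtopology (Euclidean_space k) (\<phi> ` U)) \<phi>"
    using M c unfolding smooth_manifold_def by blast+
  have U: "U \<subseteq> topspace X" using XU(1) by (rule openin_subset)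
  show "openin (Euclidean_space k) (\<phi> ` U)" by (rule XU)
  show inj: "inj_on \<phi> U"
    using homeomorphic_imp_injective_map[OF XU(3)] U by (simp add: inf.absorb2)
  have fs: "f ` topspace X \<subseteq> sphere 0 1" and imm: "immersion k A f"
    using f by (auto simp: sphere_immersion_def)
  show "smooth_on k (\<phi> ` U) (in_chart (U, \<phi>) f)"
    using imm c unfolding immersion_def by fastforce
  show "norm (in_chart (U, \<phi>) f u) = 1" if "u \<in> \<phi> ` U"
  proof -
    have "inv_into U \<phi> u \<in> topspace X" using inv_into_into[OF that] U by blast
    then have "f (inv_into U \<phi> u) \<in> sphere 0 1" using fs by blast
    then show ?thesis by (simp add: in_chart_def)
  qed
  show "Determinant.det (gram k (in_chart (U, \<phi>) f) u) \<noteq> 0" if u: "u \<in> \<phi> ` U"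
  proof
    let ?F = "in_chart (U, \<phi>) f"
    obtain p where p: "p \<in> U" "u = \<phi> p" using u by blast
    have injd: "inj_on (differential k (U, \<phi>) f p) (topspace (Euclidean_space k))"
      using imm c p unfolding immersion_def by fastforce
    assume "Determinant.det (gram k ?F u) = 0"
    then obtain v where v: "v \<in> carrier_vec k" "v \<noteq> 0\<^sub>v k" "gram k ?F u *\<^sub>v v = 0\<^sub>v k"
      using det_0_iff_vec_prod_zero_field[OF gram_carrier] by blast
    \<comment> \<open>Extension by 0 beyond k turns the kernel vector into a point of the Euclidean
      space, on which the differential is injective.\<close>
    define x where "x i = (if i < k then vec_index v i else 0)" for i
    have row: "(\<Sum>j<k. inner (pd i ?F u) (pd j ?F u) * x j) = 0" if i: "i < k" for i
    proof -
      have "vec_index (gram k ?F u *\<^sub>v v) i = (\<Sum>j<k. inner (pd i ?F u) (pd j ?F u) * x j)"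
        using i v(1) by (auto simp: gram_def scalar_prod_def x_def atLeast0LessThan intro!: sum.cong)
      then show ?thesis using v(3) i by simp
    qed
    define d where "d = differential k (U, \<phi>) f p x"
    have d: "d = (\<Sum>i<k. x i *\<^sub>R pd i ?F u)" by (simp add: d_def differential_def p)
    have "inner d d = (\<Sum>i<k. x i * (\<Sum>j<k. inner (pd i ?F u) (pd j ?F u) * x j))"
      unfolding d by (simp add: inner_sum_left inner_sum_right sum_distrib_left mult_ac inner_commute)
    also have "\<dots> = 0" using row by simp
    finally have "differential k (U, \<phi>) f p x = differential k (U, \<phi>) f p (\<lambda>_. 0)"
      by (simp add: d_def differential_def)
    then have "x = (\<lambda>_. 0)"
      by (rule inj_onD[OF injd]) (auto simp: topspace_Euclidean_space x_def)
    then have "v = 0\<^sub>v k" using v(1) by (intro eq_vecI) (auto simp: x_def fun_eq_iff split: if_splits)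
    with v(2) show False by simp
  qed
qed

text \<open>Takahashi's theorem.\<close>

lemma minimal_in_sphere_divergence_flux:
  fixes f :: "'a \<Rightarrow> 'v::euclidean_space"
  assumes M: "smooth_manifold k X A" and f: "sphere_immersion k X A f" and c: "(U, \<phi>) \<in> A"
    and min: "minimal_in_sphere k A f" and u: "u \<in> \<phi> ` U"
  shows "(\<Sum>i<k. pd i (flux k (in_chart (U, \<phi>) f) i) u)
     = (- real k * sqrt (Determinant.det (gram k (in_chart (U, \<phi>) f) u))) *\<^sub>R in_chart (U, \<phi>) f u"
proof -
  let ?F = "in_chart (U, \<phi>) f"
  note ch = immersion_in_chart[OF M f c]
  obtain p where p: "p \<in> U" "u = \<phi> p" using u by blast
  have Fp: "?F u = f p" using p ch(1) by (simp add: in_chart_def)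
  let ?N = "normal_space k (U, \<phi>) f p"
  have sub: "subspace ?N"
    by (auto simp: subspace_def normal_space_def inner_add_left)
  have metric: "induced_metric k f (U, \<phi>) = gram k ?F"
    by (simp add: induced_metric_def gram_def fun_eq_iff)
  have "mean_curvature k (U, \<phi>) f p = 0"
    using min c p unfolding minimal_in_sphere_def by fastforce
  then have mc: "(\<Sum>i<k. \<Sum>j<k. inverse_mat (gram k ?F u) $$ (i, j) *\<^sub>R orthogonal_projection ?N (pd i (pd j ?F) u)) = 0"
    by (simp add: mean_curvature_def second_fundamental_form_def metric p)
  show ?thesis
  proof (rule divergence_flux_minimal[OF ch(2,3,5) u ch(4)])
    fix z assume z: "inner (?F u) z = 0" "\<And>i. i < k \<Longrightarrow> inner (pd i ?F u) z = 0"
    have zN: "z \<in> ?N"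
      using z(1)[unfolded Fp] z(2) unfolding normal_space_def tangent_image_def differential_def
      by (auto simp: p inner_commute[of z] inner_sum_left)
    \<comment> \<open>Against the normal vector \<open>z\<close> each projection may be replaced by
      the second partial derivative itself.\<close>
    have "0 = inner (\<Sum>i<k. \<Sum>j<k. inverse_mat (gram k ?F u) $$ (i, j) *\<^sub>R orthogonal_projection ?N (pd i (pd j ?F) u)) z"
      unfolding mc by simp
    also have "\<dots> = (\<Sum>i<k. \<Sum>j<k. inverse_mat (gram k ?F u) $$ (i, j) * inner (pd i (pd j ?F) u) z)"
      by (simp add: inner_sum_left inner_orthogonal_projection[OF sub zN])
    finally show "(\<Sum>i<k. \<Sum>j<k. inverse_mat (gram k ?F u) $$ (i, j) * inner (pd i (pd j ?F) u) z) = 0" by simp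
  qed
qed

lemma C_totally_real_in_chart:
  assumes M: "smooth_manifold k X A" and f: "sphere_immersion k X A f" and c: "(U, \<phi>) \<in> A"
    and C: "C_totally_real k A f" and u: "u \<in> \<phi> ` U" and i: "i < k"
  shows "inner (\<i> *s in_chart (U, \<phi>) f u) (pd i (in_chart (U, \<phi>) f) u) = 0"
proof -
  obtain p where p: "p \<in> U" "u = \<phi> p" using u by blast
  have "in_chart (U, \<phi>) f u = f p"
    using p immersion_in_chart(1)[OF M f c] by (simp add: in_chart_def)
  moreover have "pd i (in_chart (U, \<phi>) f) u \<in> tangent_image k (U, \<phi>) f p"
    unfolding tangent_image_def
  proof (rule image_eqI)
    show "pd i (in_chart (U, \<phi>) f) u = differential k (U, \<phi>) f p (\<lambda>j. if j = i then 1 else 0)"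
      using i by (simp add: differential_def p if_distrib[of "\<lambda>x. x *\<^sub>R _"] cong: if_cong)
    show "(\<lambda>j. if j = i then 1 else 0) \<in> topspace (Euclidean_space k)"
      using i by (simp add: topspace_Euclidean_space)
  qed
  ultimately show ?thesis
    using C c p unfolding C_totally_real_def by fastforce
qed

section \<open>The spiral product in a product chart\<close>

lemma bounded_bilinear_vector_scalar_mult:
  "bounded_bilinear (vector_scalar_mult :: complex \<Rightarrow> complex ^ 'm \<Rightarrow> complex ^ 'm)"
  unfolding bilinear_conv_bounded_bilinear[symmetric] bilinear_def
  by (auto intro!: linearI simp: Finite_Cartesian_Product.vec_eq_iff algebra_simps)

interpretation vsm: bounded_bilinear "vector_scalar_mult :: complex \<Rightarrow> complex ^ 'm \<Rightarrow> complex ^ 'm"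
  by (rule bounded_bilinear_vector_scalar_mult)

text \<open>The real part of \<open>cnj c * d\<close> times the Hermitian product of x and y, whose
  imaginary part is \<open>inner (\<i> *s x) y\<close>. For x = F and y a partial derivative of F
  the first term vanishes on the unit sphere, the second by C-total reality.\<close>

lemma inner_vector_scalar_mult:
  fixes x y :: "complex ^ 'm"
  shows "inner (c *s x) (d *s y) = Re (cnj c * d) * inner x y - Im (cnj c * d) * inner (\<i> *s x) y"
  unfolding inner_vec_def
  by (simp add: sum_distrib_left inner_complex_def algebra_simps flip: sum_subtractf)

lemma inner_vector_scalar_mult_same:
  fixes x y :: "complex ^ 'm"
  shows "inner (c *s x) (c *s y) = (cmod c)\<^sup>2 * inner x y"
proof -
  have "Re (cnj c * c) = (cmod c)\<^sup>2" "Im (cnj c * c) = 0"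
    by (simp_all add: cmod_power2, simp add: power2_eq_square)
  then show ?thesis unfolding inner_vector_scalar_mult by simp
qed

lemma sum_lessThan_product_coordinates:
  fixes X :: "nat \<Rightarrow> 'v::ab_group_add"
  shows "(\<Sum>j<k1 + k2 + 1. X j) = X 0 + (\<Sum>j<k1. X (Suc j)) + (\<Sum>j<k2. X (Suc (k1 + j)))"
proof -
  have "(\<Sum>j<k1 + k2. X (Suc j)) = (\<Sum>j<k1. X (Suc j)) + (\<Sum>j<k2. X (Suc (k1 + j)))"
    by (induction k2) (simp_all add: add.assoc)
  then show ?thesis by (simp add: sum.lessThan_Suc_shift add.assoc del: sum.lessThan_Suc)
qed

text \<open>Coordinate 0 is the curve parameter, hence the shift by \<open>Suc\<close>. The cut-off
  at k1 removes the coordinates of the second factor, so that the result can lie in the Euclidean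
  space of dimension k1.\<close>

definition coords1 :: "nat \<Rightarrow> (nat \<Rightarrow> real) \<Rightarrow> nat \<Rightarrow> real" where
  "coords1 k1 u = (\<lambda>i. if i < k1 then u (Suc i) else 0)"

definition coords2 :: "nat \<Rightarrow> (nat \<Rightarrow> real) \<Rightarrow> nat \<Rightarrow> real" where
  "coords2 k1 u = (\<lambda>i. u (Suc (k1 + i)))"

text \<open>A coordinate line of the product moves exactly one of the three components, which
  reduces partial derivatives of the product to those of the curve or of one factor.\<close>

lemma coords_upd [simp]:
  "coords1 k1 (u(0 := t)) = coords1 k1 u"
  "coords2 k1 (u(0 := t)) = coords2 k1 u"
  "i < k1 \<Longrightarrow> coords1 k1 (u(Suc i := t)) = (coords1 k1 u)(i := t)"
  "i < k1 \<Longrightarrow> coords2 k1 (u(Suc i := t)) = coords2 k1 u"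
  "coords1 k1 (u(Suc (k1 + i) := t)) = coords1 k1 u"
  "coords2 k1 (u(Suc (k1 + i) := t)) = (coords2 k1 u)(i := t)"
  by (auto simp: coords1_def coords2_def fun_eq_iff)

lemma coords_index:
  "i < k1 \<Longrightarrow> coords1 k1 u i = u (Suc i)"
  "coords2 k1 u i = u (Suc (k1 + i))"
  by (simp_all add: coords1_def coords2_def)

context
  fixes k1 k2 N :: nat and S1 S2 :: "(nat \<Rightarrow> real) set" and I :: "real set"
    and F1 :: "(nat \<Rightarrow> real) \<Rightarrow> complex ^ 'm1" and F2 :: "(nat \<Rightarrow> real) \<Rightarrow> complex ^ 'm2"
    and F :: "(nat \<Rightarrow> real) \<Rightarrow> (complex ^ 'm1) \<times> (complex ^ 'm2)"
    and \<gamma>1 \<gamma>2 E1 E2 :: "real \<Rightarrow> complex" and a b w :: "real \<Rightarrow> real" and \<Omega> :: "(nat \<Rightarrow> real) set"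
  assumes N: "N = k1 + k2 + 1"
    and S1: "openin (Euclidean_space k1) S1" and S2: "openin (Euclidean_space k2) S2" and I: "open I"
    and F1: "smooth_on k1 S1 F1" and F2: "smooth_on k2 S2 F2"
    and unit1: "\<And>u. u \<in> S1 \<Longrightarrow> norm (F1 u) = 1" and unit2: "\<And>u. u \<in> S2 \<Longrightarrow> norm (F2 u) = 1"
    and det1: "\<And>u. u \<in> S1 \<Longrightarrow> Determinant.det (gram k1 F1 u) \<noteq> 0"
    and det2: "\<And>u. u \<in> S2 \<Longrightarrow> Determinant.det (gram k2 F2 u) \<noteq> 0"
    and C1: "\<And>u i. u \<in> S1 \<Longrightarrow> i < k1 \<Longrightarrow> inner (\<i> *s F1 u) (pd i F1 u) = 0"
    and C2: "\<And>u i. u \<in> S2 \<Longrightarrow> i < k2 \<Longrightarrow> inner (\<i> *s F2 u) (pd i F2 u) = 0"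
    and div1: "\<And>u. u \<in> S1 \<Longrightarrow> (\<Sum>i<k1. pd i (flux k1 F1 i) u) =
        (- real k1 * sqrt (Determinant.det (gram k1 F1 u))) *\<^sub>R F1 u"
    and div2: "\<And>u. u \<in> S2 \<Longrightarrow> (\<Sum>i<k2. pd i (flux k2 F2 i) u) =
        (- real k2 * sqrt (Determinant.det (gram k2 F2 u))) *\<^sub>R F2 u"
    and pos: "\<And>t. t \<in> I \<Longrightarrow> a t > 0" "\<And>t. t \<in> I \<Longrightarrow> b t > 0" "\<And>t. t \<in> I \<Longrightarrow> w t > 0"
    and mod: "\<And>t. t \<in> I \<Longrightarrow> cmod (\<gamma>1 t) = a t" "\<And>t. t \<in> I \<Longrightarrow> cmod (\<gamma>2 t) = b t"
    and d\<gamma>: "\<And>t. t \<in> I \<Longrightarrow> (\<gamma>1 has_vector_derivative w t *\<^sub>R E1 t) (at t)"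
      "\<And>t. t \<in> I \<Longrightarrow> (\<gamma>2 has_vector_derivative w t *\<^sub>R E2 t) (at t)"
    and EE: "\<And>t. t \<in> I \<Longrightarrow> (cmod (E1 t))\<^sup>2 + (cmod (E2 t))\<^sup>2 = 1"
    and dE: "\<And>t. t \<in> I \<Longrightarrow> ((\<lambda>t. (a t ^ k1 * b t ^ k2) *\<^sub>R E1 t) has_vector_derivative
           (w t * (a t ^ k1 * b t ^ k2) * (real k1 / (a t)\<^sup>2 - real N)) *\<^sub>R \<gamma>1 t) (at t)"
      "\<And>t. t \<in> I \<Longrightarrow> ((\<lambda>t. (a t ^ k1 * b t ^ k2) *\<^sub>R E2 t) has_vector_derivative
           (w t * (a t ^ k1 * b t ^ k2) * (real k2 / (b t)\<^sup>2 - real N)) *\<^sub>R \<gamma>2 t) (at t)"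
    and \<Omega>: "\<Omega> = {u. u 0 \<in> I \<and> coords1 k1 u \<in> S1 \<and> coords2 k1 u \<in> S2}"
    and F: "\<And>u. u \<in> \<Omega> \<Longrightarrow> F u = (\<gamma>1 (u 0) *s F1 (coords1 k1 u), \<gamma>2 (u 0) *s F2 (coords2 k1 u))"
begin

private abbreviation "x u \<equiv> coords1 k1 u"
private abbreviation "y u \<equiv> coords2 k1 u"
private abbreviation "r1 u \<equiv> sqrt (Determinant.det (gram k1 F1 u))"
private abbreviation "r2 u \<equiv> sqrt (Determinant.det (gram k2 F2 u))"
private abbreviation "\<beta> t \<equiv> a t ^ k1 * b t ^ k2"

private lemmas sum_N = sum_lessThan_product_coordinates[where ?k1.0 = k1 and ?k2.0 = k2, folded N]

private lemma near0: "\<forall>\<^sub>F t in nhds (u 0). u(0 := t) \<in> \<Omega>" if "u \<in> \<Omega>" for u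
  using eventually_nhds_in_open[OF I, of "u 0"] that by (auto simp: \<Omega> elim!: eventually_mono)

private lemma near1: "\<forall>\<^sub>F t in nhds (u (Suc i)). u(Suc i := t) \<in> \<Omega>" if "u \<in> \<Omega>" "i < k1" for u i
  using eventually_fun_upd_in[OF S1, of "x u" i] that by (auto simp: \<Omega> coords_index(1) elim!: eventually_mono)

private lemma near2: "\<forall>\<^sub>F t in nhds (u (Suc (k1 + i))). u(Suc (k1 + i) := t) \<in> \<Omega>"
  if "u \<in> \<Omega>" "i < k2" for u i
  using eventually_fun_upd_in[OF S2, of "y u" i, unfolded coords_index(2)[of k1 u i]] that by (auto simp: \<Omega> elim!: eventually_mono)

private lemma pd0: "pd 0 F u = w (u 0) *\<^sub>R (E1 (u 0) *s F1 (x u), E2 (u 0) *s F2 (y u))" if u: "u \<in> \<Omega>" for u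
proof -
  have "has_pd (\<lambda>v. (\<gamma>1 (v 0) *s F1 (x v), \<gamma>2 (v 0) *s F2 (y v))) 0 u
     ((w (u 0) *\<^sub>R E1 (u 0)) *s F1 (x u), (w (u 0) *\<^sub>R E2 (u 0)) *s F2 (y u))"
    using u by (auto simp: \<Omega> intro!: has_vector_derivative_Pair
        bounded_linear.has_vector_derivative[OF vsm.bounded_linear_left] d\<gamma>)
  from pd_eqI[OF this] show ?thesis
    using near0[OF u] by (subst pd_cong[where G = "\<lambda>v. (\<gamma>1 (v 0) *s F1 (x v), \<gamma>2 (v 0) *s F2 (y v))"])
      (auto elim!: eventually_mono simp: F vsm.scaleR_left simp del: fun_upd_apply)
qed

private lemma pd1: "pd (Suc i) F u = (\<gamma>1 (u 0) *s pd i F1 (x u), 0)" if u: "u \<in> \<Omega>" and i: "i < k1" for u i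
proof -
  have "has_pd F1 i (x u) (pd i F1 (x u))"
    by (rule pdiff_has_pd[OF smooth_on_pdiff[OF F1 _ i]]) (use u in \<open>simp add: \<Omega>\<close>)
  from this[unfolded coords_index(1)[OF i]] have "has_pd (\<lambda>v. (\<gamma>1 (v 0) *s F1 (x v), \<gamma>2 (v 0) *s F2 (y v))) (Suc i) u (\<gamma>1 (u 0) *s pd i F1 (x u), 0)"
    using i by (auto intro!: has_vector_derivative_Pair
        bounded_linear.has_vector_derivative[OF vsm.bounded_linear_right])
  from pd_eqI[OF this] show ?thesis
    using near1[OF u i] by (subst pd_cong[where G = "\<lambda>v. (\<gamma>1 (v 0) *s F1 (x v), \<gamma>2 (v 0) *s F2 (y v))"])
      (auto elim!: eventually_mono simp: F simp del: fun_upd_apply)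
qed

private lemma pd2: "pd (Suc (k1 + i)) F u = (0, \<gamma>2 (u 0) *s pd i F2 (y u))" if u: "u \<in> \<Omega>" and i: "i < k2" for u i
proof -
  have "has_pd F2 i (y u) (pd i F2 (y u))"
    by (rule pdiff_has_pd[OF smooth_on_pdiff[OF F2 _ i]]) (use u in \<open>simp add: \<Omega>\<close>)
  from this[unfolded coords_index(2)[of k1 u i]] have "has_pd (\<lambda>v. (\<gamma>1 (v 0) *s F1 (x v), \<gamma>2 (v 0) *s F2 (y v))) (Suc (k1 + i)) u (0, \<gamma>2 (u 0) *s pd i F2 (y u))"
    using i by (auto intro!: has_vector_derivative_Pair
        bounded_linear.has_vector_derivative[OF vsm.bounded_linear_right])
  from pd_eqI[OF this] show ?thesis
    using near2[OF u i] by (subst pd_cong[where G = "\<lambda>v. (\<gamma>1 (v 0) *s F1 (x v), \<gamma>2 (v 0) *s F2 (y v))"])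
      (auto elim!: eventually_mono simp: F simp del: fun_upd_apply)
qed

section \<open>Metric, volume density and flux of the product\<close>

private abbreviation "block A B C \<equiv>
  four_block_mat A (0\<^sub>m 1 (k1 + k2)) (0\<^sub>m (k1 + k2) 1) (four_block_mat B (0\<^sub>m k1 k2) (0\<^sub>m k2 k1) C)"

private lemma gram_block:
  assumes u: "u \<in> \<Omega>"
  shows "gram N F u = block ((w (u 0))\<^sup>2 \<cdot>\<^sub>m 1\<^sub>m 1) ((a (u 0))\<^sup>2 \<cdot>\<^sub>m gram k1 F1 (x u)) ((b (u 0))\<^sup>2 \<cdot>\<^sub>m gram k2 F2 (y u))"
    (is "_ = ?R")
proof (rule eq_matI)
  have t: "u 0 \<in> I" "x u \<in> S1" "y u \<in> S2" using u by (auto simp: \<Omega>)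
  have n1: "inner (F1 (x u)) (F1 (x u)) = 1" "inner (F2 (y u)) (F2 (y u)) = 1"
    using unit1[OF t(2)] unit2[OF t(3)] by (simp_all add: norm_eq_sqrt_inner)
  have e00: "inner (pd 0 F u) (pd 0 F u) = (w (u 0))\<^sup>2"
  proof -
    have "inner (pd 0 F u) (pd 0 F u) = (w (u 0))\<^sup>2 * ((cmod (E1 (u 0)))\<^sup>2 + (cmod (E2 (u 0)))\<^sup>2)"
      by (simp add: pd0[OF u] inner_vector_scalar_mult_same n1 power2_eq_square algebra_simps)
    then show ?thesis using EE[OF t(1)] by simp
  qed
  \<comment> \<open>The coefficient \<open>cnj (E1) * \<gamma>1\<close> is genuinely complex: its
    real part meets the orthogonality of position and tangent vectors, its imaginary part the
    C-totally real condition.\<close>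
  have e01: "inner (pd 0 F u) (pd (Suc j) F u) = 0" if "j < k1" for j
    using inner_pd_unit_norm[OF S1 F1 unit1 t(2) that] C1[OF t(2) that]
    by (simp add: pd0[OF u] pd1[OF u that] inner_vector_scalar_mult)
  have e02: "inner (pd 0 F u) (pd (Suc (k1 + j)) F u) = 0" if "j < k2" for j
    using inner_pd_unit_norm[OF S2 F2 unit2 t(3) that] C2[OF t(3) that]
    by (simp add: pd0[OF u] pd2[OF u that] inner_vector_scalar_mult)
  have e11: "inner (pd (Suc i) F u) (pd (Suc j) F u) = (a (u 0))\<^sup>2 * inner (pd i F1 (x u)) (pd j F1 (x u))"
    if "i < k1" "j < k1" for i j
    using that by (simp add: pd1[OF u] inner_vector_scalar_mult_same mod[OF t(1)])
  have e22: "inner (pd (Suc (k1 + i)) F u) (pd (Suc (k1 + j)) F u) = (b (u 0))\<^sup>2 * inner (pd i F2 (y u)) (pd j F2 (y u))"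
    if "i < k2" "j < k2" for i j
    using that by (simp add: pd2[OF u] inner_vector_scalar_mult_same mod[OF t(1)])
  have e12: "inner (pd (Suc i) F u) (pd (Suc (k1 + j)) F u) = 0" if "i < k1" "j < k2" for i j
    using that by (simp add: pd1[OF u] pd2[OF u])
  have e10: "inner (pd (Suc j) F u) (pd 0 F u) = 0" if "j < k1" for j
    using e01[OF that] by (simp only: inner_commute)
  have e20: "inner (pd (Suc (k1 + j)) F u) (pd 0 F u) = 0" if "j < k2" for j
    using e02[OF that] by (simp only: inner_commute)
  have e21: "inner (pd (Suc (k1 + j)) F u) (pd (Suc i) F u) = 0" if "i < k1" "j < k2" for i j
    using e12[OF that] by (simp only: inner_commute)
  show "dim_row (gram N F u) = dim_row ?R" "dim_col (gram N F u) = dim_col ?R"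
    by (simp_all add: gram_def N)
  have cases: "i = 0 \<or> (\<exists>i'<k1. i = Suc i') \<or> (\<exists>i'<k2. i = Suc (k1 + i'))" if "i < N" for i
  proof (cases i)
    case (Suc i')
    then show ?thesis using that by (cases "i' < k1") (auto simp: N intro: exI[of _ "i' - k1"])
  qed simp
  fix i j assume "i < dim_row ?R" "j < dim_col ?R"
  then have ij: "i < N" "j < N" by (simp_all add: gram_def N)
  have "inner (pd i F u) (pd j F u) = ?R $$ (i, j)"
    using cases[OF ij(1)] cases[OF ij(2)]
    by (elim disjE exE conjE)
      (simp_all add: gram_def e00 e01 e02 e11 e12 e22 e10 e20 e21)
  then show "gram N F u $$ (i, j) = ?R $$ (i, j)" using ij by (simp add: gram_index)
qed

text \<open>The volume density of the warped product; this is where the weight a^k1 b^k2 of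
  \<open>minimal_profile\<close> comes from.\<close>

private lemma sqrt_det_gram:
  assumes u: "u \<in> \<Omega>"
  shows "sqrt (Determinant.det (gram N F u)) = w (u 0) * \<beta> (u 0) * r1 (x u) * r2 (y u)"
proof -
  have t: "u 0 \<in> I" using u by (auto simp: \<Omega>)
  have "Determinant.det (gram N F u) = (w (u 0))\<^sup>2 * (((a (u 0))\<^sup>2) ^ k1 * Determinant.det (gram k1 F1 (x u)) *
      (((b (u 0))\<^sup>2) ^ k2 * Determinant.det (gram k2 F2 (y u))))"
    unfolding gram_block[OF u]
    by (subst det_four_block_diag, simp, simp add: gram_def, subst det_four_block_diag)
       (simp_all add: gram_def)
  moreover have "((a (u 0))\<^sup>2) ^ k1 = (a (u 0) ^ k1)\<^sup>2" "((b (u 0))\<^sup>2) ^ k2 = (b (u 0) ^ k2)\<^sup>2"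
    by (simp_all add: mult.commute flip: power_mult)
  ultimately show ?thesis using pos[OF t] by (simp add: real_sqrt_mult mult_ac)
qed

private lemma inverse_gram:
  assumes u: "u \<in> \<Omega>"
  shows "inverse_mat (gram N F u) = block ((1 / (w (u 0))\<^sup>2) \<cdot>\<^sub>m 1\<^sub>m 1)
    ((1 / (a (u 0))\<^sup>2) \<cdot>\<^sub>m inverse_mat (gram k1 F1 (x u))) ((1 / (b (u 0))\<^sup>2) \<cdot>\<^sub>m inverse_mat (gram k2 F2 (y u)))"
proof -
  have t: "u 0 \<in> I" "x u \<in> S1" "y u \<in> S2" using u by (auto simp: \<Omega>)
  have nz: "(w (u 0))\<^sup>2 \<noteq> 0" "(a (u 0))\<^sup>2 \<noteq> 0" "(b (u 0))\<^sup>2 \<noteq> 0" using pos[OF t(1)] by auto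
  have i1: "inverse_mat (1\<^sub>m (Suc 0)) = 1\<^sub>m (Suc 0)" by (rule inverse_mat_eqI[where n = 1]) auto
  have A: "(w (u 0))\<^sup>2 \<cdot>\<^sub>m 1\<^sub>m 1 \<in> carrier_mat 1 1" "Determinant.det ((w (u 0))\<^sup>2 \<cdot>\<^sub>m 1\<^sub>m 1) \<noteq> 0"
    using nz by auto
  have B: "(a (u 0))\<^sup>2 \<cdot>\<^sub>m gram k1 F1 (x u) \<in> carrier_mat k1 k1" "Determinant.det ((a (u 0))\<^sup>2 \<cdot>\<^sub>m gram k1 F1 (x u)) \<noteq> 0"
    using nz det1[OF t(2)] by (auto simp: gram_carrier)
  have C: "(b (u 0))\<^sup>2 \<cdot>\<^sub>m gram k2 F2 (y u) \<in> carrier_mat k2 k2" "Determinant.det ((b (u 0))\<^sup>2 \<cdot>\<^sub>m gram k2 F2 (y u)) \<noteq> 0"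
    using nz det2[OF t(3)] by (auto simp: gram_carrier)
  have D: "four_block_mat ((a (u 0))\<^sup>2 \<cdot>\<^sub>m gram k1 F1 (x u)) (0\<^sub>m k1 k2) (0\<^sub>m k2 k1) ((b (u 0))\<^sup>2 \<cdot>\<^sub>m gram k2 F2 (y u))
      \<in> carrier_mat (k1 + k2) (k1 + k2)"
    "Determinant.det (four_block_mat ((a (u 0))\<^sup>2 \<cdot>\<^sub>m gram k1 F1 (x u)) (0\<^sub>m k1 k2) (0\<^sub>m k2 k1) ((b (u 0))\<^sup>2 \<cdot>\<^sub>m gram k2 F2 (y u))) \<noteq> 0"
    using B C by (simp_all only: det_four_block_diag[OF B(1) C(1)] four_block_carrier_mat mult_eq_0_iff simp_thms)
  show ?thesis
    unfolding gram_block[OF u] inverse_mat_four_block_diag[OF A D] inverse_mat_four_block_diag[OF B C]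
      inverse_mat_smult[OF gram_carrier det1[OF t(2)] nz(2)] inverse_mat_smult[OF gram_carrier det2[OF t(3)] nz(3)]
    by (subst inverse_mat_smult[of _ 1]) (use nz in \<open>simp_all add: i1\<close>)
qed

private lemma inverse_gram_index:
  assumes u: "u \<in> \<Omega>"
  defines "B \<equiv> inverse_mat (gram N F u)"
  shows "B $$ (0, 0) = 1 / (w (u 0))\<^sup>2"
    "\<And>j. j < k1 \<Longrightarrow> B $$ (0, Suc j) = 0" "\<And>j. j < k2 \<Longrightarrow> B $$ (0, Suc (k1 + j)) = 0"
    "\<And>i. i < k1 \<Longrightarrow> B $$ (Suc i, 0) = 0" "\<And>i. i < k2 \<Longrightarrow> B $$ (Suc (k1 + i), 0) = 0"
    "\<And>i j. i < k1 \<Longrightarrow> j < k1 \<Longrightarrow> B $$ (Suc i, Suc j) = inverse_mat (gram k1 F1 (x u)) $$ (i, j) / (a (u 0))\<^sup>2"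
    "\<And>i j. i < k1 \<Longrightarrow> j < k2 \<Longrightarrow> B $$ (Suc i, Suc (k1 + j)) = 0"
    "\<And>i j. i < k2 \<Longrightarrow> j < k1 \<Longrightarrow> B $$ (Suc (k1 + i), Suc j) = 0"
    "\<And>i j. i < k2 \<Longrightarrow> j < k2 \<Longrightarrow> B $$ (Suc (k1 + i), Suc (k1 + j)) = inverse_mat (gram k2 F2 (y u)) $$ (i, j) / (b (u 0))\<^sup>2"
proof -
  have t: "x u \<in> S1" "y u \<in> S2" using u by (auto simp: \<Omega>)
  note c = inverse_mat_carrier[OF gram_carrier det1[OF t(1)]] inverse_mat_carrier[OF gram_carrier det2[OF t(2)]]
  note dims = carrier_matD[OF c(1)] carrier_matD[OF c(2)]
  show "B $$ (0, 0) = 1 / (w (u 0))\<^sup>2"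
    "\<And>j. j < k1 \<Longrightarrow> B $$ (0, Suc j) = 0" "\<And>j. j < k2 \<Longrightarrow> B $$ (0, Suc (k1 + j)) = 0"
    "\<And>i. i < k1 \<Longrightarrow> B $$ (Suc i, 0) = 0" "\<And>i. i < k2 \<Longrightarrow> B $$ (Suc (k1 + i), 0) = 0"
    "\<And>i j. i < k1 \<Longrightarrow> j < k1 \<Longrightarrow> B $$ (Suc i, Suc j) = inverse_mat (gram k1 F1 (x u)) $$ (i, j) / (a (u 0))\<^sup>2"
    "\<And>i j. i < k1 \<Longrightarrow> j < k2 \<Longrightarrow> B $$ (Suc i, Suc (k1 + j)) = 0"
    "\<And>i j. i < k2 \<Longrightarrow> j < k1 \<Longrightarrow> B $$ (Suc (k1 + i), Suc j) = 0"
    "\<And>i j. i < k2 \<Longrightarrow> j < k2 \<Longrightarrow> B $$ (Suc (k1 + i), Suc (k1 + j)) = inverse_mat (gram k2 F2 (y u)) $$ (i, j) / (b (u 0))\<^sup>2"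
    unfolding B_def inverse_gram[OF u] by (simp_all add: dims)
qed

text \<open>The density contributes w, the inverse metric 1 / w^2 and the velocity w. They cancel
  and leave the weighted unit tangent, whose derivative is the hypothesis \<open>dE\<close>.\<close>

private lemma flux0:
  assumes u: "u \<in> \<Omega>"
  shows "flux N F 0 u = (r1 (x u) * r2 (y u)) *\<^sub>R
     ((\<beta> (u 0) *\<^sub>R E1 (u 0)) *s F1 (x u), (\<beta> (u 0) *\<^sub>R E2 (u 0)) *s F2 (y u))"
proof -
  have t: "u 0 \<in> I" using u by (auto simp: \<Omega>)
  show ?thesis
    unfolding flux_def sum_N sqrt_det_gram[OF u]
    using pos(3)[OF t]
    by (simp add: inverse_gram_index[OF u] pd0[OF u] vsm.scaleR_left power2_eq_square mult_ac)
qed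

text \<open>The scalar coefficient does not depend on the coordinates of the first factor, so
  differentiating in them acts on the flux of that factor alone.\<close>

private lemma flux1:
  assumes u: "u \<in> \<Omega>" and i: "i < k1"
  shows "flux N F (Suc i) u = (w (u 0) * \<beta> (u 0) / (a (u 0))\<^sup>2 * r2 (y u)) *\<^sub>R (\<gamma>1 (u 0) *s flux k1 F1 i (x u), 0)"
  unfolding flux_def sum_N sqrt_det_gram[OF u]
  by (simp add: inverse_gram_index[OF u] pd1[OF u] i vsm.sum_right vsm.scaleR_right sum_prod scaleR_sum_right
      mult_ac)

private lemma flux2:
  assumes u: "u \<in> \<Omega>" and i: "i < k2"
  shows "flux N F (Suc (k1 + i)) u = (w (u 0) * \<beta> (u 0) / (b (u 0))\<^sup>2 * r1 (x u)) *\<^sub>R (0, \<gamma>2 (u 0) *s flux k2 F2 i (y u))"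
  unfolding flux_def sum_N sqrt_det_gram[OF u]
  by (simp add: inverse_gram_index[OF u] pd2[OF u] i vsm.sum_right vsm.scaleR_right sum_prod scaleR_sum_right
      mult_ac)

private lemma pd_flux0:
  assumes u: "u \<in> \<Omega>"
  shows "pd 0 (flux N F 0) u = (w (u 0) * \<beta> (u 0) * r1 (x u) * r2 (y u)) *\<^sub>R
     (((real k1 / (a (u 0))\<^sup>2 - real N) *\<^sub>R \<gamma>1 (u 0)) *s F1 (x u), ((real k2 / (b (u 0))\<^sup>2 - real N) *\<^sub>R \<gamma>2 (u 0)) *s F2 (y u))"
proof -
  let ?G = "\<lambda>v. (r1 (x v) * r2 (y v)) *\<^sub>R ((\<beta> (v 0) *\<^sub>R E1 (v 0)) *s F1 (x v), (\<beta> (v 0) *\<^sub>R E2 (v 0)) *s F2 (y v))"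
  have t: "u 0 \<in> I" using u by (auto simp: \<Omega>)
  have "has_pd ?G 0 u ((r1 (x u) * r2 (y u)) *\<^sub>R
     (((w (u 0) * \<beta> (u 0) * (real k1 / (a (u 0))\<^sup>2 - real N)) *\<^sub>R \<gamma>1 (u 0)) *s F1 (x u),
      ((w (u 0) * \<beta> (u 0) * (real k2 / (b (u 0))\<^sup>2 - real N)) *\<^sub>R \<gamma>2 (u 0)) *s F2 (y u)))"
    unfolding coords_upd fun_upd_same
    by (intro bounded_linear.has_vector_derivative[OF bounded_linear_scaleR_right] has_vector_derivative_Pair
        bounded_linear.has_vector_derivative[OF vsm.bounded_linear_left] dE t)
  from pd_eqI[OF this] have "pd 0 ?G u = (w (u 0) * \<beta> (u 0) * r1 (x u) * r2 (y u)) *\<^sub>R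
     (((real k1 / (a (u 0))\<^sup>2 - real N) *\<^sub>R \<gamma>1 (u 0)) *s F1 (x u), ((real k2 / (b (u 0))\<^sup>2 - real N) *\<^sub>R \<gamma>2 (u 0)) *s F2 (y u))"
    by (simp add: vsm.scaleR_left mult_ac)
  moreover have "pd 0 (flux N F 0) u = pd 0 ?G u"
    using near0[OF u] by (intro pd_cong, elim eventually_mono) (rule flux0)
  ultimately show ?thesis by simp
qed

private lemma pd_flux1:
  assumes u: "u \<in> \<Omega>" and i: "i < k1"
  shows "pd (Suc i) (flux N F (Suc i)) u =
    (w (u 0) * \<beta> (u 0) / (a (u 0))\<^sup>2 * r2 (y u)) *\<^sub>R (\<gamma>1 (u 0) *s pd i (flux k1 F1 i) (x u), 0)"
proof -
  let ?G = "\<lambda>v. (w (v 0) * \<beta> (v 0) / (a (v 0))\<^sup>2 * r2 (y v)) *\<^sub>R (\<gamma>1 (v 0) *s flux k1 F1 i (x v), 0 :: complex ^ 'm2)"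
  have "x u \<in> S1" using u by (auto simp: \<Omega>)
  then have "has_pd (flux k1 F1 i) i (x u) (pd i (flux k1 F1 i) (x u))"
    by (intro pdiff_has_pd pdiff_flux[OF S1 F1 det1] i)
  from this[unfolded coords_index(1)[OF i]] have "has_pd ?G (Suc i) u ((w (u 0) * \<beta> (u 0) / (a (u 0))\<^sup>2 * r2 (y u)) *\<^sub>R (\<gamma>1 (u 0) *s pd i (flux k1 F1 i) (x u), 0))"
    using i by (auto intro!: bounded_linear.has_vector_derivative[OF bounded_linear_scaleR_right] has_vector_derivative_Pair
        bounded_linear.has_vector_derivative[OF vsm.bounded_linear_right])
  from pd_eqI[OF this] show ?thesis
    by (subst pd_cong[where G = ?G]) (use near1[OF u i] in \<open>auto elim!: eventually_mono simp: flux1 i simp del: fun_upd_apply\<close>)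
qed

private lemma pd_flux2:
  assumes u: "u \<in> \<Omega>" and i: "i < k2"
  shows "pd (Suc (k1 + i)) (flux N F (Suc (k1 + i))) u =
    (w (u 0) * \<beta> (u 0) / (b (u 0))\<^sup>2 * r1 (x u)) *\<^sub>R (0, \<gamma>2 (u 0) *s pd i (flux k2 F2 i) (y u))"
proof -
  let ?G = "\<lambda>v. (w (v 0) * \<beta> (v 0) / (b (v 0))\<^sup>2 * r1 (x v)) *\<^sub>R (0 :: complex ^ 'm1, \<gamma>2 (v 0) *s flux k2 F2 i (y v))"
  have "y u \<in> S2" using u by (auto simp: \<Omega>)
  then have "has_pd (flux k2 F2 i) i (y u) (pd i (flux k2 F2 i) (y u))"
    by (intro pdiff_has_pd pdiff_flux[OF S2 F2 det2] i)
  from this[unfolded coords_index(2)[of k1 u i]] have "has_pd ?G (Suc (k1 + i)) u ((w (u 0) * \<beta> (u 0) / (b (u 0))\<^sup>2 * r1 (x u)) *\<^sub>R (0, \<gamma>2 (u 0) *s pd i (flux k2 F2 i) (y u)))"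
    using i by (auto intro!: bounded_linear.has_vector_derivative[OF bounded_linear_scaleR_right] has_vector_derivative_Pair
        bounded_linear.has_vector_derivative[OF vsm.bounded_linear_right])
  from pd_eqI[OF this] show ?thesis
    by (subst pd_cong[where G = ?G]) (use near2[OF u i] in \<open>auto elim!: eventually_mono simp: flux2 i simp del: fun_upd_apply\<close>)
qed

lemma divergence_flux_product:
  assumes u: "u \<in> \<Omega>"
  shows "(1 / sqrt (Determinant.det (gram N F u))) *\<^sub>R (\<Sum>i<N. pd i (flux N F i) u) = - real N *\<^sub>R F u"
proof -
  define t where "t = u 0"
  have t: "t \<in> I" "x u \<in> S1" "y u \<in> S2" using u by (auto simp: \<Omega> t_def)
  note p = pos[OF t(1)]
  have "r1 (x u) \<noteq> 0" "r2 (y u) \<noteq> 0" using det1[OF t(2)] det2[OF t(3)] by auto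
  define R where "R = w t * \<beta> t * r1 (x u) * r2 (y u)"
  have R: "R \<noteq> 0" using p \<open>r1 (x u) \<noteq> 0\<close> \<open>r2 (y u) \<noteq> 0\<close> by (simp add: R_def)
  have "(\<Sum>i<k1. pd (Suc i) (flux N F (Suc i)) u)
      = (w t * \<beta> t / (a t)\<^sup>2 * r2 (y u)) *\<^sub>R (\<gamma>1 t *s (\<Sum>i<k1. pd i (flux k1 F1 i) (x u)), 0)"
    by (simp add: pd_flux1[OF u] t_def vsm.sum_right sum_prod scaleR_sum_right)
  also have "\<dots> = R *\<^sub>R ((- (real k1 / (a t)\<^sup>2)) *\<^sub>R (\<gamma>1 t *s F1 (x u)), 0)"
    unfolding div1[OF t(2)] by (simp add: R_def vsm.scaleR_right mult_ac)
  finally have s1: "(\<Sum>i<k1. pd (Suc i) (flux N F (Suc i)) u) = R *\<^sub>R ((- (real k1 / (a t)\<^sup>2)) *\<^sub>R (\<gamma>1 t *s F1 (x u)), 0)" .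
  have "(\<Sum>i<k2. pd (Suc (k1 + i)) (flux N F (Suc (k1 + i))) u)
      = (w t * \<beta> t / (b t)\<^sup>2 * r1 (x u)) *\<^sub>R (0, \<gamma>2 t *s (\<Sum>i<k2. pd i (flux k2 F2 i) (y u)))"
    by (simp add: pd_flux2[OF u] t_def vsm.sum_right sum_prod scaleR_sum_right)
  also have "\<dots> = R *\<^sub>R (0, (- (real k2 / (b t)\<^sup>2)) *\<^sub>R (\<gamma>2 t *s F2 (y u)))"
    unfolding div2[OF t(3)] by (simp add: R_def vsm.scaleR_right mult_ac)
  finally have s2: "(\<Sum>i<k2. pd (Suc (k1 + i)) (flux N F (Suc (k1 + i))) u) = R *\<^sub>R (0, (- (real k2 / (b t)\<^sup>2)) *\<^sub>R (\<gamma>2 t *s F2 (y u)))" .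
  have s0: "pd 0 (flux N F 0) u = R *\<^sub>R ((real k1 / (a t)\<^sup>2 - real N) *\<^sub>R (\<gamma>1 t *s F1 (x u)), (real k2 / (b t)\<^sup>2 - real N) *\<^sub>R (\<gamma>2 t *s F2 (y u)))"
    unfolding pd_flux0[OF u] by (simp add: R_def t_def vsm.scaleR_left)
  \<comment> \<open>The terms k1 / a^2 and k2 / b^2 of the curve direction cancel those of the two
    factors; R is the volume density.\<close>
  have "(\<Sum>i<N. pd i (flux N F i) u) = R *\<^sub>R (- real N *\<^sub>R F u)"
    unfolding sum_N s0 s1 s2 F[OF u] t_def[symmetric]
    by (simp add: scaleR_left_diff_distrib flip: scaleR_add_right del: scaleR_Pair) (simp add: algebra_simps)
  then show ?thesis
    unfolding sqrt_det_gram[OF u] using R by (simp add: R_def t_def)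
qed

end

section \<open>The Laplacian in a chart of the product atlas\<close>

theorem theorem3p2:
  fixes L1 :: "'a topology" and L2 :: "'b topology"
    and A1 :: "'a chart set" and A2 :: "'b chart set"
    and f1 :: "'a \<Rightarrow> complex ^ 'm1" and f2 :: "'b \<Rightarrow> complex ^ 'm2"
    and n1 n2 k1 k2 :: nat and I :: "real set" and \<gamma> :: "real \<Rightarrow> complex \<times> complex"
  assumes "CARD('m1) = n1 + 1" and "CARD('m2) = n2 + 1"
    and "smooth_manifold k1 L1 A1" and "smooth_manifold k2 L2 A2"
    and "sphere_immersion k1 L1 A1 f1" and "sphere_immersion k2 L2 A2 f2"
    and "C_totally_real k1 A1 f1" and "C_totally_real k2 A2 f2"
    and "minimal_in_sphere k1 A1 f1" and "minimal_in_sphere k2 A2 f2"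
    and "solution_curve k1 k2 I \<gamma>"
  shows "\<forall>c \<in> prod_atlas 1 (interval_atlas I) (prod_atlas k1 A1 A2). \<forall>p \<in> fst c.
           laplace_beltrami (k1 + k2 + 1) (induced_metric (k1 + k2 + 1) (G_map \<gamma> f1 f2)) c
             (G_map \<gamma> f1 f2) p
           = - real (k1 + k2 + 1) *\<^sub>R G_map \<gamma> f1 f2 p"
proof (intro ballI)
  fix c p assume c: "c \<in> prod_atlas 1 (interval_atlas I) (prod_atlas k1 A1 A2)" and p: "p \<in> fst c"
  obtain U \<phi> V \<psi> where U: "(U, \<phi>) \<in> A1" and V: "(V, \<psi>) \<in> A2"
    and c': "c = (I \<times> U \<times> V, \<lambda>(t, z) i. if i < 1 then (if i = 0 then t else 0)
      else (case z of (x, y) \<Rightarrow> \<lambda>i. if i < k1 then \<phi> x i else \<psi> y (i - k1)) (i - 1))"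
    using c unfolding prod_atlas_def interval_atlas_def by auto
  \<comment> \<open>The nested product chart with its two index shifts unfolded into a case
    distinction on the index.\<close>
  define \<Phi> where "\<Phi> = (\<lambda>(t :: real, x, y) i. case i of 0 \<Rightarrow> t | Suc i \<Rightarrow> if i < k1 then \<phi> x i else \<psi> y (i - k1))"
  have c\<Phi>: "c = (I \<times> U \<times> V, \<Phi>)"
    unfolding c' \<Phi>_def by (auto simp: fun_eq_iff split: nat.split)
  note ch1 = immersion_in_chart[OF assms(3,5) U] and ch2 = immersion_in_chart[OF assms(4,6) V]
  have I: "open I" and prof: "minimal_profile k1 k2 I \<gamma>"
    using solution_curve_minimal_profile[OF assms(11)] .
  obtain a b w E1 E2 where prof: "\<And>t. t \<in> I \<Longrightarrow> a t > 0 \<and> b t > 0 \<and> w t > 0 \<and>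
        cmod (fst (\<gamma> t)) = a t \<and> cmod (snd (\<gamma> t)) = b t \<and>
        ((\<lambda>t. fst (\<gamma> t)) has_vector_derivative w t *\<^sub>R E1 t) (at t) \<and>
        ((\<lambda>t. snd (\<gamma> t)) has_vector_derivative w t *\<^sub>R E2 t) (at t) \<and>
        (cmod (E1 t))\<^sup>2 + (cmod (E2 t))\<^sup>2 = 1 \<and>
        ((\<lambda>t. (a t ^ k1 * b t ^ k2) *\<^sub>R E1 t) has_vector_derivative
           (w t * (a t ^ k1 * b t ^ k2) * (real k1 / (a t)\<^sup>2 - real (k1 + k2 + 1))) *\<^sub>R fst (\<gamma> t)) (at t) \<and>
        ((\<lambda>t. (a t ^ k1 * b t ^ k2) *\<^sub>R E2 t) has_vector_derivative
           (w t * (a t ^ k1 * b t ^ k2) * (real k2 / (b t)\<^sup>2 - real (k1 + k2 + 1))) *\<^sub>R snd (\<gamma> t)) (at t)"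
    using prof unfolding minimal_profile_def by blast
  define \<Omega> where "\<Omega> = {u. u 0 \<in> I \<and> coords1 k1 u \<in> \<phi> ` U \<and> coords2 k1 u \<in> \<psi> ` V}"
  let ?G = "G_map \<gamma> f1 f2"
  let ?F = "in_chart c ?G" and ?F1 = "in_chart (U, \<phi>) f1" and ?F2 = "in_chart (V, \<psi>) f2"
  have \<phi>0: "\<phi> x i = 0" if "x \<in> U" "i \<ge> k1" for x i
    using openin_subset[OF ch1(2)] that by (auto simp: topspace_Euclidean_space)
  have coords\<Phi>: "coords1 k1 (\<Phi> (t, x, y)) = \<phi> x" "coords2 k1 (\<Phi> (t, x, y)) = \<psi> y" "\<Phi> (t, x, y) 0 = t"
    if "x \<in> U" for t x y
    using that \<phi>0 by (auto simp: coords1_def coords2_def \<Phi>_def fun_eq_iff)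
  have inj: "inj_on \<Phi> (I \<times> U \<times> V)"
  proof (rule inj_onI)
    fix z z' assume z: "z \<in> I \<times> U \<times> V" "z' \<in> I \<times> U \<times> V" "\<Phi> z = \<Phi> z'"
    obtain t x y t' x' y' where zz: "z = (t, x, y)" "z' = (t', x', y')" by (metis prod.exhaust)
    have "t = t'" "\<phi> x = \<phi> x'" "\<psi> y = \<psi> y'"
      using z coords\<Phi>[of x t y] coords\<Phi>[of x' t' y'] by (auto simp: zz)
    then show "z = z'" using z ch1(1) ch2(1) by (auto simp: zz dest: inj_onD)
  qed
  have F\<Phi>: "?F (\<Phi> z) = ?G z" if "z \<in> I \<times> U \<times> V" for z
    using that inj by (simp add: in_chart_def c\<Phi>)
  have F: "?F u = (fst (\<gamma> (u 0)) *s ?F1 (coords1 k1 u), snd (\<gamma> (u 0)) *s ?F2 (coords2 k1 u))" if u: "u \<in> \<Omega>" for u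
  proof -
    obtain x y where x: "x \<in> U" "coords1 k1 u = \<phi> x" and y: "y \<in> V" "coords2 k1 u = \<psi> y"
      using u by (auto simp: \<Omega>_def)
    \<comment> \<open>Points of \<Omega> are determined by their three components, so \<Omega>
      consists of chart points and the formula for the map in coordinates holds on all of it, as
      partial derivatives require.\<close>
    have "u = \<Phi> (u 0, x, y)"
    proof
      fix i show "u i = \<Phi> (u 0, x, y) i"
        using fun_cong[OF x(2), of "i - 1"] fun_cong[OF y(2), of "i - 1 - k1"]
        by (cases i) (auto simp: \<Phi>_def coords1_def coords2_def)
    qed
    then have "?F u = ?G (u 0, x, y)"
      using F\<Phi>[of "(u 0, x, y)"] u x y by (simp add: \<Omega>_def)
    then show ?thesis
      using x y ch1(1) ch2(1) by (simp add: G_map_def in_chart_def)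
  qed
  have p': "p \<in> I \<times> U \<times> V" using p by (simp add: c\<Phi>)
  have \<Phi>p: "\<Phi> p \<in> \<Omega>"
    using p' coords\<Phi> by (auto simp: \<Omega>_def)
  have "(1 / sqrt (Determinant.det (gram (k1 + k2 + 1) ?F (\<Phi> p)))) *\<^sub>R
      (\<Sum>i<k1 + k2 + 1. pd i (flux (k1 + k2 + 1) ?F i) (\<Phi> p)) = - real (k1 + k2 + 1) *\<^sub>R ?F (\<Phi> p)"
    by (rule divergence_flux_product[OF refl ch1(2) ch2(2) I ch1(3) ch2(3) ch1(4) ch2(4) ch1(5) ch2(5)
          C_totally_real_in_chart[OF assms(3,5) U assms(7)] C_totally_real_in_chart[OF assms(4,6) V assms(8)]
          minimal_in_sphere_divergence_flux[OF assms(3,5) U assms(9)]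
          minimal_in_sphere_divergence_flux[OF assms(4,6) V assms(10)]
          _ _ _ _ _ _ _ _ _ _ \<Omega>_def F \<Phi>p, where a = a and b = b and w = w and ?E1.0 = E1 and ?E2.0 = E2])
       (use prof in blast)+
  \<comment> \<open>Hence \<open>laplace_beltrami\<close> for the induced metric is the divergence
    of \<open>flux\<close> over the density.\<close>
  moreover have "induced_metric (k1 + k2 + 1) ?G c = gram (k1 + k2 + 1) ?F"
    by (simp add: induced_metric_def gram_def fun_eq_iff)
  ultimately show "laplace_beltrami (k1 + k2 + 1) (induced_metric (k1 + k2 + 1) ?G) c ?G p
      = - real (k1 + k2 + 1) *\<^sub>R ?G p"
    using F\<Phi>[OF p'] unfolding laplace_beltrami_def Let_def flux_def[abs_def] by (simp add: c\<Phi>)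
qed

end
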